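(* Let $n\ge2$, let $\Omega\subset\mathbb{R}^n$ be a non-empty bounded open set, and let $L:\Omega\times\mathbb{R}\times\mathbb{R}^n\to\mathcal{S}^{n\times n}$ be locally Lipschitz continuous. Assume that for some $m>1$ the following holds: for every $R>0$ and $\Lambda>0$ there exist $\bar\theta>0$ and $C>0$ such that, for all $x\in\Omega$ and $p\in\mathbb{R}^n$, $$|\nabla_xL(x,s,p)|\le C|p|^m\qquad\forall\,|s|\le R,$$ $$0\le L(x,s',p)-L(x,s,p)\le C(s'-s)|p|^m I\qquad\forall\,-R\le s\le s'\le R,$$ $$p\cdot\nabla_pL(x,s,p)-L(x,s,p)+\theta\Lambda|\nabla_pL(x,s,p)|\,I-\theta I\le C\,p\otimes p-\frac1C|p|^mI\qquad\forall\,\theta\in[0,\bar\theta],\ |s|\le R.$$ Let $F[\psi]=\nabla^2\psi+L(\cdot,\psi,\nabla\psi)$, and let $U$ be a non-empty open subset of $\mathcal{S}^{n\times n}$ such that (i) if $A\in U$, $B\in\mathcal{S}^{n\times n}$ and $B>0$, then $A+B\in U$; and (ii) if $A\in U$ and $c\in(0,1)$, then $cA\in U$. If $w\in LSC(\overline\Omega)$ and $v\in USC(\overline\Omega)$ are respectively a viscosity supersolution and a viscosity subsolution of $F[\psi]\in\partial U$ in $\Omega$, and if $w\ge v$ in $\Omega$ and $w>v$ on $\partial\Omega$, then $w>v$ in $\Omega$.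
   Context: $\mathcal{S}^{n\times n}$ is the space of real symmetric $n\times n$ matrices; $M\le N$ means $N-M$ is non-negative definite and $B>0$ means $B$ is positive definite; $I$ is the identity matrix, $(p\otimes q)_{ij}=p_iq_j$, and $p\cdot\nabla_pL=\sum_k p_k\,\partial_{p_k}L$. Since $L$ is only locally Lipschitz, the conditions involving $\nabla_xL$ and $\nabla_pL$ are understood where these derivatives exist (almost everywhere). For $S\subset\mathbb{R}^n$, $USC(S)$ is the set of functions $\psi:S\to\mathbb{R}\cup\{-\infty\}$, $\psi\not\equiv-\infty$ in $S$, with $\limsup_{x\to\bar x}\psi(x)\le\psi(\bar x)$ for all $\bar x\in S$; $LSC(S)$ is the set of functions $\psi:S\to\mathbb{R}\cup\{+\infty\}$, $\psi\not\equiv+\infty$ in $S$, with $\liminf_{x\to\bar x}\psi(x)\ge\psi(\bar x)$ for all $\bar x\in S$. A function $\psi\in USC(\Omega)$ (resp. $\psi\in LSC(\Omega)$) is a viscosity subsolution (resp. supersolution) of $F[\psi]\in\partial U$ in $\Omega$ if for every $x_0\in\Omega$ and $\varphi\in C^2(\Omega)$ with $(\psi-\varphi)(x_0)=0$ and $\psi-\varphi\le0$ (resp. $\psi-\varphi\ge0$) near $x_0$, one has $F[\varphi](x_0)\in\overline U$ (resp. $F[\varphi](x_0)\in\mathcal{S}^{n\times n}\setminus U$). *)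

theory Defs
  imports "HOL-Analysis.Analysis"
begin

definition sym_mats :: "(real ^ 'n ^ 'n) set" where
  "sym_mats = {A. transpose A = A}"

definition nonneg_definite :: "real ^ 'n ^ 'n \<Rightarrow> bool" where
  "nonneg_definite A \<longleftrightarrow> A \<in> sym_mats \<and> (\<forall>\<xi>. 0 \<le> \<xi> \<bullet> (A *v \<xi>))"

definition pos_definite :: "real ^ 'n ^ 'n \<Rightarrow> bool" where
  "pos_definite A \<longleftrightarrow> A \<in> sym_mats \<and> (\<forall>\<xi>. \<xi> \<noteq> 0 \<longrightarrow> 0 < \<xi> \<bullet> (A *v \<xi>))"

(* The library order \<le> on vectors is componentwise, so the order on symmetric matrices
   needs its own symbol. *)
definition mat_le :: "real ^ 'n ^ 'n \<Rightarrow> real ^ 'n ^ 'n \<Rightarrow> bool"  (infix "\<preceq>" 50) where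
  "M \<preceq> N \<longleftrightarrow> nonneg_definite (N - M)"

definition tensor :: "real ^ 'n \<Rightarrow> real ^ 'n \<Rightarrow> real ^ 'n ^ 'n"  (infixl "\<otimes>" 70) where
  "p \<otimes> q = (\<chi> i j. p $ i * q $ j)"

(* The array of first partial derivatives of f at x; only meaningful where f is differentiable.
   For matrix-valued f its norm is the Euclidean norm of all entries of all partials. *)
definition grad :: "(real ^ 'n \<Rightarrow> 'a::real_normed_vector) \<Rightarrow> real ^ 'n \<Rightarrow> 'a ^ 'n" where
  "grad f x = (\<chi> k. frechet_derivative f (at x) (axis k 1))"

definition hessian :: "(real ^ 'n \<Rightarrow> real) \<Rightarrow> real ^ 'n \<Rightarrow> real ^ 'n ^ 'n" where
  "hessian \<phi> = grad (grad \<phi>)"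

(* Intended for open \<Omega>. *)
definition C2_on :: "(real ^ 'n) set \<Rightarrow> (real ^ 'n \<Rightarrow> real) \<Rightarrow> bool" where
  "C2_on \<Omega> \<phi> \<longleftrightarrow>
     (\<forall>x\<in>\<Omega>. \<phi> differentiable (at x)) \<and>
     (\<forall>x\<in>\<Omega>. grad \<phi> differentiable (at x)) \<and>
     continuous_on \<Omega> (hessian \<phi>)"

definition USC :: "'a::topological_space set \<Rightarrow> ('a \<Rightarrow> ereal) set" where
  "USC S = {\<psi>. (\<forall>x\<in>S. \<psi> x \<noteq> \<infinity>) \<and> (\<exists>x\<in>S. \<psi> x \<noteq> -\<infinity>) \<and>
                (\<forall>x\<in>S. Limsup (at x within S) \<psi> \<le> \<psi> x)}"

definition LSC :: "'a::topological_space set \<Rightarrow> ('a \<Rightarrow> ereal) set" where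
  "LSC S = {\<psi>. (\<forall>x\<in>S. \<psi> x \<noteq> -\<infinity>) \<and> (\<exists>x\<in>S. \<psi> x \<noteq> \<infinity>) \<and>
                (\<forall>x\<in>S. \<psi> x \<le> Liminf (at x within S) \<psi>)}"

definition locally_lipschitz_on ::
    "'a::metric_space set \<Rightarrow> ('a \<Rightarrow> 'b::metric_space) \<Rightarrow> bool" where
  "locally_lipschitz_on S f \<longleftrightarrow>
     (\<forall>z\<in>S. \<exists>r>0. \<exists>K. K-lipschitz_on (ball z r \<inter> S) f)"

definition F_op ::
    "(real ^ 'n \<Rightarrow> real \<Rightarrow> real ^ 'n \<Rightarrow> real ^ 'n ^ 'n) \<Rightarrow>
     (real ^ 'n \<Rightarrow> real) \<Rightarrow> real ^ 'n \<Rightarrow> real ^ 'n ^ 'n" where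
  "F_op L \<phi> x = hessian \<phi> x + L x (\<phi> x) (grad \<phi> x)"

(* The equation is F[\<psi>] \<in> \<partial>U in \<Omega>. Since sym_mats is closed, closure U is also the closure
   of U relative to sym_mats. *)
definition viscosity_subsolution ::
    "(real ^ 'n \<Rightarrow> real \<Rightarrow> real ^ 'n \<Rightarrow> real ^ 'n ^ 'n) \<Rightarrow> (real ^ 'n ^ 'n) set \<Rightarrow>
     (real ^ 'n) set \<Rightarrow> (real ^ 'n \<Rightarrow> ereal) \<Rightarrow> bool" where
  "viscosity_subsolution L U \<Omega> \<psi> \<longleftrightarrow> \<psi> \<in> USC \<Omega> \<and>
     (\<forall>x\<^sub>0\<in>\<Omega>. \<forall>\<phi>. C2_on \<Omega> \<phi> \<and> \<psi> x\<^sub>0 = ereal (\<phi> x\<^sub>0) \<and>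
        (\<forall>\<^sub>F x in nhds x\<^sub>0. \<psi> x \<le> ereal (\<phi> x)) \<longrightarrow> F_op L \<phi> x\<^sub>0 \<in> closure U)"

definition viscosity_supersolution ::
    "(real ^ 'n \<Rightarrow> real \<Rightarrow> real ^ 'n \<Rightarrow> real ^ 'n ^ 'n) \<Rightarrow> (real ^ 'n ^ 'n) set \<Rightarrow>
     (real ^ 'n) set \<Rightarrow> (real ^ 'n \<Rightarrow> ereal) \<Rightarrow> bool" where
  "viscosity_supersolution L U \<Omega> \<psi> \<longleftrightarrow> \<psi> \<in> LSC \<Omega> \<and>
     (\<forall>x\<^sub>0\<in>\<Omega>. \<forall>\<phi>. C2_on \<Omega> \<phi> \<and> \<psi> x\<^sub>0 = ereal (\<phi> x\<^sub>0) \<and>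
        (\<forall>\<^sub>F x in nhds x\<^sub>0. \<psi> x \<ge> ereal (\<phi> x)) \<longrightarrow> F_op L \<phi> x\<^sub>0 \<in> sym_mats - U)"

end

(*
  The Hessian enters the equation with constant coefficients, so the comparison can be made by
  doubling variables against a perturbation of w. If w touches v at an interior point, w is replaced
  by f(w) - nu |x|^2, where f is a concave increasing function with f' = 1 + mu slightly above 1 and
  f'' = - 8 C mu. Dilating the gradient by the factor 1 + mu is what the third structure condition
  controls: its term C p (x) p is absorbed by f'', the gain |p|^m / C absorbs the errors of the first
  two structure conditions caused by comparing at two different points, and theta I is absorbed by
  the Hessian of - nu |x|^2. Property (ii) of U removes the factor f' from the inequality for w, and
  the strict gap contradicts property (i).

  The matrices at the doubled maximum come from sup-convolutions. Instead of the theorems of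
  Aleksandrov and Jensen, the Moreau envelope of one of the two semiconvex functions is used: its
  gradient is Lipschitz, hence differentiable almost everywhere by Rademacher's theorem, and the set
  of points reached by small linear tilts of the maximum is not negligible, because the tilt is a
  Lipschitz function of that point. Rademacher's theorem is derived from the one-dimensional case,
  from Tonelli's theorem, and from the fact that a set of positive measure meets its small translates.
*)
theory Submission
  imports Defs
begin

section \<open>Differentiability of Lipschitz functions almost everywhere\<close>

text \<open>The resolvent yields second-order expansions with a small error rather than exact ones:
  for semiconvexity constant \<open>l\<close> the error is of order \<open>l * l * \<eta>\<close>,
  and the Moreau parameter \<open>\<eta>\<close> is chosen after \<open>l\<close>. This is enough
  because the comparison leaves a strict gap of size \<open>\<nu>\<close>, while everything that is
  only approximate (tilt, distance of the doubled points, second-order error) is bounded by one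
  \<open>\<rho>\<close> chosen after \<open>\<nu>\<close>. The constants are fixed in this order:
  \<open>R\<close> and \<open>\<Lambda>\<close> from bounds on \<open>v\<close>, \<open>w\<close>
  and \<open>\<Omega>\<close>; then \<open>C\<close> and the threshold \<open>\<theta>0\<close>;
  then \<open>f\<close>, through \<open>\<beta>\<close>; then \<open>\<nu>\<close>; then
  \<open>\<rho>\<close>. The excess slope \<open>\<mu>\<close> is read off at the doubled point, but
  its lower bound \<open>\<mu>0\<close> is known before \<open>\<nu>\<close>, so
  \<open>\<theta> = \<nu> / \<mu>\<close> can be kept below \<open>\<theta>0\<close>. The exponent
  \<open>m > 1\<close> serves to make \<open>|e|^m\<close> small compared with \<open>\<nu>\<close>
  for a gradient error \<open>e\<close> of size \<open>\<nu>\<close>. As \<open>L\<close> is only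
  locally Lipschitz, its conditions hold almost everywhere; they are integrated along curves
  perturbed so as to meet the exceptional set in null sets of parameters, and continuity removes the
  perturbation.\<close>

text \<open>Adding \<open>(C + 1) * x\<close> gives a function \<open>F\<close> with slopes between
  1 and \<open>2 * C + 1\<close>. The Lebesgue measure of the image of a set under \<open>F\<close>
  is then an absolutely continuous measure, its Radon-Nikodym density integrates to
  \<open>F b - F a\<close>, and Lebesgue's differentiation theorem applies to the density. Averages
  over \<open>{x..x + h}\<close> give the derivative from the right only, which suffices
  below.\<close>

lemma lipschitz_right_derivative_ae:
  fixes g :: "real \<Rightarrow> real"
  assumes "C-lipschitz_on UNIV g"
  obtains N where "negligible N"
    and "\<And>x. x \<notin> N \<Longrightarrow> \<exists>d. ((\<lambda>h. (g (x + h) - g x) / h) \<longlongrightarrow> d) (at_right 0)"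
proof -
  define F where "F = (\<lambda>x. g x + (C + 1) * x)"
  have C0: "C \<ge> 0" using assms lipschitz_on_nonneg by blast
  have gl: "\<bar>g x - g y\<bar> \<le> C * \<bar>x - y\<bar>" for x y
    using lipschitz_onD[OF assms, of x y] by (simp add: dist_real_def)
  have Flow: "y - x \<le> F y - F x" if "x \<le> y" for x y
    using gl[of x y] that by (simp add: F_def algebra_simps abs_if split: if_splits)
  have Flip: "\<bar>F x - F y\<bar> \<le> (2 * C + 1) * \<bar>x - y\<bar>" for x y
  proof -
    have "F x - F y = (g x - g y) + (C + 1) * (x - y)" by (simp add: F_def algebra_simps)
    then have "\<bar>F x - F y\<bar> \<le> \<bar>g x - g y\<bar> + \<bar>(C + 1) * (x - y)\<bar>" by linarith
    also have "\<bar>(C + 1) * (x - y)\<bar> = (C + 1) * \<bar>x - y\<bar>" using C0 by (simp add: abs_mult)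
    finally show ?thesis using gl[of x y] by (simp add: algebra_simps)
  qed
  have Fmono: "x \<le> y \<longleftrightarrow> F x \<le> F y" for x y
    using Flow[of x y] Flow[of y x] by linarith
  have injF: "inj F" by (rule injI) (metis Fmono order_antisym order_refl)
  have "(2 * C + 1)-lipschitz_on UNIV F"
    using Flip C0 by (intro lipschitz_onI) (auto simp: dist_real_def)
  then have contF: "continuous_on UNIV F" by (rule lipschitz_on_continuous_on)
  have surjF: "surj F"
  proof (unfold surj_def, rule allI)
    fix y
    define a b where "a = - \<bar>y\<bar> - \<bar>F 0\<bar>" and "b = \<bar>y\<bar> + \<bar>F 0\<bar>"
    have "F a \<le> y" using Flow[of a 0] unfolding a_def by linarith
    moreover have "y \<le> F b" using Flow[of 0 b] unfolding b_def by linarith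
    moreover have "a \<le> b" unfolding a_def b_def by linarith
    ultimately show "\<exists>x. y = F x"
      using IVT'[of F a y b] continuous_on_subset[OF contF] by auto
  qed
  \<comment> \<open>The image measure is realised as the push-forward of Lebesgue measure under the
    inverse \<open>G\<close>, which is 1-Lipschitz because \<open>F\<close> has slope at least 1.
    Images under \<open>F\<close> are preimages under \<open>G\<close>, hence Borel.\<close>
  define G where "G = inv F"
  have FG: "F (G y) = y" for y using surjF by (simp add: G_def surj_f_inv_f)
  have GF: "G (F x) = x" for x using injF by (simp add: G_def)
  have "\<bar>G x - G y\<bar> \<le> \<bar>x - y\<bar>" for x y
    using Flow[of "G x" "G y"] Flow[of "G y" "G x"] unfolding FG by linarith
  then have "1-lipschitz_on UNIV G" by (intro lipschitz_onI) (auto simp: dist_real_def)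
  then have contG: "continuous_on UNIV G" by (rule lipschitz_on_continuous_on)
  then have Gm [measurable]: "G \<in> borel_measurable borel"
    by (rule borel_measurable_continuous_onI)
  have vim: "G -` A = F ` A" for A
    by (auto simp: GF) (metis FG image_eqI)
  define \<mu> where "\<mu> = distr lborel borel G"
  have em: "emeasure \<mu> A = emeasure lborel (F ` A)" if "A \<in> sets borel" for A :: "real set"
    using that unfolding \<mu>_def by (subst emeasure_distr) (auto simp: vim)
  have ac: "absolutely_continuous lborel \<mu>"
    unfolding absolutely_continuous_def
  proof
    fix A :: "real set" assume A: "A \<in> null_sets lborel"
    then have Ab: "A \<in> sets borel" by auto
    have "negligible A" using A by (simp add: negligible_iff_null_sets null_sets_completionI)
    then have "negligible (F ` A)"
      by (rule negligible_locally_Lipschitz_image[rotated])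
        (auto intro!: exI[of _ "UNIV::real set"] exI[of _ "2 * C + 1"] Flip)
    moreover have "F ` A \<in> sets borel"
      using measurable_sets_borel[OF Gm, of A] Ab by (simp add: vim)
    ultimately have "emeasure lborel (F ` A) = 0"
      by (simp add: negligible_iff_emeasure0)
    then show "A \<in> null_sets \<mu>" using Ab em by (auto simp: \<mu>_def null_sets_def)
  qed
  obtain D where Dm [measurable]: "D \<in> borel_measurable borel" and D: "density lborel D = \<mu>"
    using sigma_finite_measure.Radon_Nikodym[OF sigma_finite_lborel ac] by (auto simp: \<mu>_def)
  have FI: "F ` {a..b} = {F a..F b}" if "a \<le> b" for a b
  proof -
    have "F ` {a..b} = G -` {a..b}" by (simp add: vim)
    also have "\<dots> = {F a..F b}" using Fmono FG by (auto simp: FG) (metis Fmono FG)+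
    finally show ?thesis .
  qed
  have Dint: "(\<integral>\<^sup>+x. D x * indicator {a..b} x \<partial>lborel) = ennreal (F b - F a)" if "a \<le> b" for a b
  proof -
    have "(\<integral>\<^sup>+x. D x * indicator {a..b} x \<partial>lborel) = emeasure (density lborel D) {a..b}"
      by (simp add: emeasure_density)
    also have "\<dots> = ennreal (F b - F a)"
      using em[of "{a..b}"] FI[OF that] Fmono[of a b] that by (simp add: D)
    finally show ?thesis .
  qed
  have fin: "AE x in lborel. D x \<noteq> \<infinity>"
  proof -
    have "AE x in lborel. D x * indicator {- real n..real n} x \<noteq> \<infinity>" for n
      using Dint[of "- real n" "real n"] by (intro nn_integral_PInf_AE) auto
    then have "AE x in lborel. \<forall>n. D x * indicator {- real n..real n} x \<noteq> \<infinity>"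
      by (simp add: AE_all_countable)
    then show ?thesis
    proof eventually_elim
      case (elim x)
      obtain n where "\<bar>x\<bar> \<le> real n" using real_arch_simple by blast
      then show ?case using elim[rule_format, of n] by (auto simp: indicator_def abs_le_iff)
    qed
  qed
  \<comment> \<open>\<open>enn2real\<close> sends infinity to 0; since \<open>D\<close> is finite
    almost everywhere, no integral changes.\<close>
  define D' where "D' = (\<lambda>x. enn2real (D x))"
  have D'int: "(D' has_integral (F b - F a)) (cbox a b)" if "a \<le> b" for a b
  proof -
    have "(\<integral>\<^sup>+x. ennreal (D' x * indicator {a..b} x) \<partial>lborel) = (\<integral>\<^sup>+x. D x * indicator {a..b} x \<partial>lborel)"
      using fin by (intro nn_integral_cong_AE, eventually_elim)
        (auto simp: D'_def indicator_def less_top[symmetric] ennreal_enn2real_if)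
    then have "((\<lambda>x. D' x * indicator {a..b} x) has_integral (F b - F a)) UNIV"
      using Dint[OF that] Fmono[of a b] that
      by (intro nn_integral_has_integral) (auto simp: D'_def)
    then have "((\<lambda>x. if x \<in> {a..b} then D' x else 0) has_integral (F b - F a)) UNIV"
      by (rule has_integral_cong[THEN iffD1, rotated]) (auto simp: indicator_def)
    then show ?thesis using has_integral_restrict_UNIV[of "{a..b}" D'] by simp
  qed
  have "D' integrable_on cbox a b" for a b
    using D'int[of a b] by (cases "a \<le> b") (auto simp: integrable_on_def)
  from integrable_ccontinuous_explicit[OF this] obtain N where N: "negligible N" and
    Nd: "\<And>x e. \<lbrakk>x \<notin> N; 0 < e\<rbrakk> \<Longrightarrow> \<exists>d>0. \<forall>h. 0 < h \<and> h < d \<longrightarrow>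
                 norm(integral (cbox x (x + h)) D' /\<^sub>R h - D' x) < e"
    by (auto simp: )
  show ?thesis
  proof (rule that[OF N])
    fix x assume x: "x \<notin> N"
    have "((\<lambda>h. (F (x + h) - F x) / h) \<longlongrightarrow> D' x) (at_right 0)"
    proof (rule tendstoI)
      fix e :: real assume "e > 0"
      from Nd[OF x this] obtain d where d: "d > 0"
        "\<And>h. 0 < h \<Longrightarrow> h < d \<Longrightarrow> norm(integral (cbox x (x + h)) D' /\<^sub>R h - D' x) < e" by auto
      show "\<forall>\<^sub>F h in at_right 0. dist ((F (x + h) - F x) / h) (D' x) < e"
        unfolding eventually_at_right_field
      proof (intro exI[of _ d] conjI allI impI)
        fix h :: real assume h: "0 < h" "h < d"
        have "integral (cbox x (x + h)) D' = F (x + h) - F x"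
          using D'int[of x "x + h"] h by (intro integral_unique) auto
        then show "dist ((F (x + h) - F x) / h) (D' x) < e"
          using d(2)[OF h] by (simp add: dist_norm divide_inverse mult.commute)
      qed (use d in auto)
    qed
    then have "((\<lambda>h. (F (x + h) - F x) / h - (C + 1)) \<longlongrightarrow> D' x - (C + 1)) (at_right 0)"
      by (intro tendsto_intros)
    moreover have "\<forall>\<^sub>F h in at_right 0. (F (x + h) - F x) / h - (C + 1) = (g (x + h) - g x) / h"
      using eventually_at_right_less[of 0]
      by eventually_elim (simp add: F_def field_simps)
    ultimately have "((\<lambda>h. (g (x + h) - g x) / h) \<longlongrightarrow> D' x - (C + 1)) (at_right 0)"
      by (simp add: tendsto_cong)
    then show "\<exists>d. ((\<lambda>h. (g (x + h) - g x) / h) \<longlongrightarrow> d) (at_right 0)" by blast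
  qed
qed

section \<open>Null sets under translations, along curves and along lines\<close>

text \<open>A compact part \<open>K\<close> of positive measure has an open neighbourhood
  \<open>U\<close> with \<open>U - K\<close> smaller than \<open>K\<close>. A small translate of
  \<open>K\<close> stays in \<open>U\<close>; if it missed \<open>K\<close>, it would fit into
  \<open>U - K\<close>, contradicting translation invariance.\<close>

lemma steinhaus_closed:
  fixes S :: "'a::euclidean_space set"
  assumes "closed S" and "\<not> negligible S"
  obtains \<delta> where "\<delta> > 0" and "\<And>h. norm h < \<delta> \<Longrightarrow> \<exists>x\<in>S. x + h \<in> S"
proof -
  have "\<exists>n::nat. \<not> negligible (S \<inter> cball 0 (real n))"
  proof (rule ccontr)
    assume "\<not> ?thesis"
    then have "negligible (\<Union>n::nat. S \<inter> cball 0 (real n))"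
      by (intro negligible_countable_Union) auto
    moreover have "S \<subseteq> (\<Union>n::nat. S \<inter> cball 0 (real n))"
      by (auto simp: real_arch_simple)
    ultimately show False using assms negligible_subset by blast
  qed
  then obtain n :: nat where n: "\<not> negligible (S \<inter> cball 0 (real n))" by blast
  define K where "K = S \<inter> cball 0 (real n)"
  have K: "compact K" using assms by (simp add: K_def closed_Int_compact)
  then have Km: "K \<in> lmeasurable" by (rule lmeasurable_compact)
  have m: "measure lebesgue K > 0"
    using n Km by (simp add: K_def[symmetric] negligible_iff_measure zero_less_measure_iff)
  obtain U where U: "open U" "K \<subseteq> U" "U - K \<in> lmeasurable"
      "emeasure lebesgue (U - K) < ennreal (measure lebesgue K)"
    using sets_lebesgue_outer_open[OF fmeasurableD[OF Km] m] by blast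
  have Um: "measure lebesgue (U - K) < measure lebesgue K"
    using U(3,4) m by (simp add: emeasure_eq_measure2 ennreal_less_iff)
  obtain \<delta> where \<delta>: "\<delta> > 0" "\<And>x. x \<in> K \<Longrightarrow> ball x \<delta> \<subseteq> U"
    using K U(1,2) compact_subset_open_imp_ball_epsilon_subset
    by (metis UN_subset_iff)
  show ?thesis
  proof (rule that[OF \<delta>(1)])
    fix h :: 'a assume h: "norm h < \<delta>"
    have "\<exists>x\<in>K. x + h \<in> K"
    proof (rule ccontr)
      assume neg: "\<not> ?thesis"
      let ?T = "(+) h ` K"
      have "?T \<subseteq> U"
      proof clarify
        fix x assume "x \<in> K"
        then show "h + x \<in> U" using \<delta>(2)[of x] h by (auto simp: dist_norm)
      qed
      moreover have "K \<inter> ?T = {}" using neg by (auto simp: add.commute)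
      ultimately have "?T \<subseteq> U - K" by auto
      moreover have "?T \<in> lmeasurable" using Km by (simp add: measurable_translation)
      ultimately have "measure lebesgue ?T \<le> measure lebesgue (U - K)"
        using U(3) by (intro measure_mono_fmeasurable) auto
      then show False using Um by (simp add: measure_translation)
    qed
    then show "\<exists>x\<in>S. x + h \<in> S" by (auto simp: K_def)
  qed
qed

lemma negligible_affine_preimage:
  fixes N :: "'a::euclidean_space set"
  assumes "negligible N" and "r \<noteq> 0"
  shows "negligible {k. a + r *\<^sub>R k \<in> N}"
proof -
  have "{k. a + r *\<^sub>R k \<in> N} \<subseteq> (\<lambda>y. (1 / r) *\<^sub>R (y - a)) ` N"
    using assms(2) by (auto intro!: image_eqI[where x = "a + r *\<^sub>R _"])
  moreover have "negligible ((\<lambda>y. (1 / r) *\<^sub>R (y - a)) ` N)"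
    using assms
    by (intro negligible_locally_Lipschitz_image)
      (auto intro!: exI[of _ "UNIV::'a set"] exI[of _ "1 / \<bar>r\<bar>"]
        simp: scaleR_diff_right[symmetric] divide_right_mono)
  ultimately show ?thesis using negligible_subset by blast
qed

lemma negligible_borel_superset:
  fixes N :: "'a::euclidean_space set"
  assumes "negligible N"
  obtains N' where "N \<subseteq> N'" "N' \<in> sets borel" "negligible N'"
proof -
  have "N \<in> null_sets (completion lborel)" using assms by (simp add: negligible_iff_null_sets)
  then obtain N' where "N' \<in> null_sets lborel" "N \<subseteq> N'"
    using null_sets_completion_iff2[THEN iffD1, of N lborel] by metis
  then show ?thesis
    by (intro that[of N']) (auto simp: negligible_iff_null_sets null_sets_completionI)
qed

lemma AE_lborel_notin_iff_negligible:
  fixes N :: "'a::euclidean_space set"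
  assumes "N \<in> sets borel"
  shows "(AE x in lborel. x \<notin> N) \<longleftrightarrow> negligible N"
  using assms AE_iff_null_sets[of N lborel] null_sets_completion_iff[of N lborel]
  by (simp add: negligible_iff_null_sets)

text \<open>Tonelli along curves: swapping the roles of the parameter and of the shift replaces any
  decomposition of the space into lines.\<close>
lemma negligible_along_shifted_curves:
  fixes N :: "'a::euclidean_space set" and \<alpha> :: "real \<Rightarrow> 'a" and \<beta> :: "real \<Rightarrow> real"
  assumes N: "negligible N" and cont: "continuous_on UNIV \<alpha>" "continuous_on UNIV \<beta>"
  obtains M where "negligible M"
    and "\<And>k. k \<notin> M \<Longrightarrow> negligible {t. \<beta> t \<noteq> 0 \<and> \<alpha> t + \<beta> t *\<^sub>R k \<in> N}"
proof -
  obtain N' where N': "N \<subseteq> N'" "N' \<in> sets borel" "negligible N'"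
    using negligible_borel_superset[OF N] .
  have [measurable]: "\<alpha> \<in> borel_measurable borel" "\<beta> \<in> borel_measurable borel" "N' \<in> sets borel"
    using cont N' by (auto intro: borel_measurable_continuous_onI)
  have 1: "{z\<in>space (lborel \<Otimes>\<^sub>M lborel). \<not> (\<beta> (fst z) \<noteq> 0 \<and> \<alpha> (fst z) + \<beta> (fst z) *\<^sub>R snd z \<in> N')}
      \<in> sets (lborel \<Otimes>\<^sub>M (lborel :: 'a measure))"
    by measurable
  have "AE k in lborel. \<not> (\<beta> t \<noteq> 0 \<and> \<alpha> t + \<beta> t *\<^sub>R k \<in> N')" for t
  proof (cases "\<beta> t = 0")
    case False
    have "{k. \<alpha> t + \<beta> t *\<^sub>R k \<in> N'} \<in> sets borel" by measurable
    then show ?thesis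
      using AE_lborel_notin_iff_negligible[of "{k. \<alpha> t + \<beta> t *\<^sub>R k \<in> N'}"]
        negligible_affine_preimage[OF N'(3) False] by auto
  qed simp
  then have "AE t in lborel. AE k in lborel. \<not> (\<beta> t \<noteq> 0 \<and> \<alpha> t + \<beta> t *\<^sub>R k \<in> N')" by simp
  then have "AE k in lborel. AE t in lborel. \<not> (\<beta> t \<noteq> 0 \<and> \<alpha> t + \<beta> t *\<^sub>R k \<in> N')"
    using lborel_pair.AE_commute[OF 1] by simp
  then obtain M where M: "M \<in> null_sets lborel"
      "\<And>k. k \<notin> M \<Longrightarrow> AE t in lborel. \<not> (\<beta> t \<noteq> 0 \<and> \<alpha> t + \<beta> t *\<^sub>R k \<in> N')"
    by (auto elim!: AE_E3)
  show ?thesis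
  proof (rule that)
    show "negligible M" using M(1) by (simp add: negligible_iff_null_sets null_sets_completionI)
    fix k assume "k \<notin> M"
    have "{t. \<beta> t \<noteq> 0 \<and> \<alpha> t + \<beta> t *\<^sub>R k \<in> N'} \<in> sets borel" by measurable
    then have "negligible {t. \<beta> t \<noteq> 0 \<and> \<alpha> t + \<beta> t *\<^sub>R k \<in> N'}"
      using M(2)[OF \<open>k \<notin> M\<close>] AE_lborel_notin_iff_negligible by fastforce
    then show "negligible {t. \<beta> t \<noteq> 0 \<and> \<alpha> t + \<beta> t *\<^sub>R k \<in> N}"
      by (rule negligible_subset) (use N' in auto)
  qed
qed

text \<open>Tonelli on pairs (point, parameter): for almost every \<open>t\<close> the set of
  \<open>x\<close> with \<open>x + t *\<^sub>R e \<in> N\<close> is null, and this set is a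
  translate of \<open>N\<close>, so a single such \<open>t\<close> is enough.\<close>

lemma negligible_if_negligible_on_lines:
  fixes N :: "'a::euclidean_space set"
  assumes N: "N \<in> sets borel" and lines: "\<And>x. negligible {t. x + t *\<^sub>R e \<in> N}"
  shows "negligible N"
proof -
  note [measurable] = N
  have 1: "{z\<in>space (lborel \<Otimes>\<^sub>M lborel). \<not> (snd z + fst z *\<^sub>R e \<in> N)}
      \<in> sets (lborel \<Otimes>\<^sub>M (lborel :: 'a measure))"
    by measurable
  have "AE t in lborel. \<not> (x + t *\<^sub>R e \<in> N)" for x
  proof -
    have "{t. x + t *\<^sub>R e \<in> N} \<in> sets borel" by measurable
    then show ?thesis
      using AE_lborel_notin_iff_negligible[of "{t. x + t *\<^sub>R e \<in> N}"] lines[of x] by simp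
  qed
  then have "AE x in lborel. AE t in lborel. \<not> (x + t *\<^sub>R e \<in> N)" by simp
  then have "AE t in lborel. AE x in lborel. \<not> (x + t *\<^sub>R e \<in> N)"
    using lborel_pair.AE_commute[OF 1] by simp
  then obtain M where M: "M \<in> null_sets lborel"
      "\<And>t. t \<notin> M \<Longrightarrow> AE x in lborel. \<not> (x + t *\<^sub>R e \<in> N)"
    by (auto elim!: AE_E3)
  have "M \<noteq> UNIV" using M(1) by auto
  then obtain t where "t \<notin> M" by blast
  have "{x. x + t *\<^sub>R e \<in> N} \<in> sets borel" by measurable
  then have "negligible {x. x + t *\<^sub>R e \<in> N}"
    using M(2)[OF \<open>t \<notin> M\<close>] AE_lborel_notin_iff_negligible by fastforce
  then have "negligible ((+) (t *\<^sub>R e) ` {x. x + t *\<^sub>R e \<in> N})"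
    by (simp add: negligible_translation)
  also have "(+) (t *\<^sub>R e) ` {x. x + t *\<^sub>R e \<in> N} = N"
    by (force simp: image_iff algebra_simps intro: exI[where x = "_ - t *\<^sub>R e"])
  finally show ?thesis .
qed

text \<open>A Sard-type argument: a Lipschitz map sends the exceptional set to a null set of values,
  so some intermediate value is taken only at good points. At the last time it is taken, a negative
  derivative forces the function down again.\<close>

lemma lipschitz_nonincreasing_if_deriv_nonpos_ae:
  fixes \<phi> :: "real \<Rightarrow> real"
  assumes "a \<le> b" and lip: "C-lipschitz_on {a..b} \<phi>" and N: "negligible N"
    and der: "\<And>t. a < t \<Longrightarrow> t < b \<Longrightarrow> t \<notin> N \<Longrightarrow> \<exists>d\<le>0. (\<phi> has_real_derivative d) (at t)"
  shows "\<phi> b \<le> \<phi> a"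
proof (rule ccontr)
  assume "\<not> ?thesis"
  then have less: "\<phi> a < \<phi> b" by simp
  then have ab: "a < b" using \<open>a \<le> b\<close> by (cases "a = b") auto
  \<comment> \<open>Half the average slope: subtracting \<open>\<sigma> * t\<close> keeps
    \<open>\<psi> a < \<psi> b\<close> and turns non-positive derivatives into strictly negative
    ones.\<close>
  define \<sigma> where "\<sigma> = (\<phi> b - \<phi> a) / (2 * (b - a))"
  have \<sigma>: "\<sigma> > 0" using less ab by (simp add: \<sigma>_def)
  define \<psi> where "\<psi> = (\<lambda>t. \<phi> t - \<sigma> * t)"
  have "\<sigma> * (b - a) = (\<phi> b - \<phi> a) / 2" using ab by (simp add: \<sigma>_def field_simps)
  then have \<psi>ab: "\<psi> a < \<psi> b" using less unfolding \<psi>_def by (simp add: algebra_simps)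
  have lip\<psi>: "\<bar>\<psi> s - \<psi> t\<bar> \<le> (C + \<sigma>) * \<bar>s - t\<bar>" if "s \<in> {a..b}" "t \<in> {a..b}" for s t
  proof -
    have "\<psi> s - \<psi> t = (\<phi> s - \<phi> t) - \<sigma> * (s - t)" by (simp add: \<psi>_def algebra_simps)
    then have "\<bar>\<psi> s - \<psi> t\<bar> \<le> \<bar>\<phi> s - \<phi> t\<bar> + \<bar>\<sigma> * (s - t)\<bar>" by linarith
    also have "\<bar>\<sigma> * (s - t)\<bar> = \<sigma> * \<bar>s - t\<bar>" using \<sigma> by (simp add: abs_mult)
    finally show ?thesis using lipschitz_onD[OF lip that] by (simp add: dist_real_def algebra_simps)
  qed
  have C0: "C \<ge> 0" using lip lipschitz_on_nonneg by blast
  have "(C + \<sigma>)-lipschitz_on {a..b} \<psi>"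
    using lip\<psi> C0 \<sigma> by (intro lipschitz_onI) (auto simp: dist_real_def)
  then have cont\<psi>: "continuous_on {a..b} \<psi>" by (rule lipschitz_on_continuous_on)
  have "negligible (\<psi> ` (N \<inter> {a..b}))"
    using lip\<psi> N
    by (intro negligible_locally_Lipschitz_image)
      (auto intro!: exI[of _ "UNIV::real set"] exI[of _ "C + \<sigma>"] simp: negligible_Int)
  moreover have "\<not> negligible {\<psi> a<..<\<psi> b}"
    using \<psi>ab open_not_negligible[of "{\<psi> a<..<\<psi> b}"] by simp
  ultimately obtain s where s: "\<psi> a < s" "s < \<psi> b" "s \<notin> \<psi> ` (N \<inter> {a..b})"
    by (meson greaterThanLessThan_iff negligible_subset subsetI)
  define T where "T = {t \<in> {a..b}. \<psi> t \<le> s}"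
  have "closed T"
    unfolding T_def using continuous_closed_preimage[OF cont\<psi>, of "{..s}"]
    by (simp add: vimage_def Int_def)
  then have Tc: "compact T" by (auto simp: T_def compact_eq_bounded_closed intro: bounded_subset[OF bounded_closed_interval[of a b]])
  have "a \<in> T" using ab s by (auto simp: T_def)
  \<comment> \<open>The last parameter at which \<open>\<psi>\<close> is at most \<open>s\<close>;
    beyond it \<open>\<psi>\<close> exceeds \<open>s\<close>, and continuity gives
    \<open>\<psi> t = s\<close>.\<close>
  then obtain t where t: "t \<in> T" "\<And>u. u \<in> T \<Longrightarrow> u \<le> t"
    using compact_attains_sup[OF Tc] by auto
  have tb: "t < b" using t s by (auto simp: T_def intro: le_neq_trans)
  have gt: "\<psi> u > s" if "t < u" "u \<le> b" for u
    using t(2)[of u] that t(1) by (force simp: T_def)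
  have eq: "\<psi> t = s"
  proof (rule ccontr)
    assume "\<psi> t \<noteq> s"
    then have "\<psi> t \<le> s" "\<psi> t < s" using t by (auto simp: T_def)
    moreover have "continuous_on {t..b} \<psi>"
      using cont\<psi> by (rule continuous_on_subset) (use t in \<open>auto simp: T_def\<close>)
    ultimately obtain u where "t \<le> u" "u \<le> b" "\<psi> u = s"
      using IVT'[of \<psi> t s b] s tb by auto
    then show False using gt[of u] \<open>\<psi> t < s\<close> by (cases "t = u") auto
  qed
  have ta: "a < t" using eq s t by (auto simp: T_def intro: le_neq_trans)
  have "t \<notin> N" using s(3) eq ta tb by auto
  from der[OF ta tb this] obtain d where d: "d \<le> 0" "(\<phi> has_real_derivative d) (at t)" by blast
  then have "(\<psi> has_real_derivative (d - \<sigma>)) (at t)"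
    unfolding \<psi>_def by (auto intro!: derivative_eq_intros)
  moreover have "d - \<sigma> < 0" using d \<sigma> by simp
  ultimately obtain e where e: "e > 0" "\<And>h. h > 0 \<Longrightarrow> h < e \<Longrightarrow> \<psi> (t + h) < \<psi> t"
    using DERIV_neg_dec_right[of \<psi> "d - \<sigma>" t] by auto
  define h where "h = min (e / 2) (b - t)"
  have "0 < h" "h < e" "t + h \<le> b" using e tb by (auto simp: h_def)
  then show False using e(2)[of h] gt[of "t + h"] eq by auto
qed

section \<open>One-sided directional derivatives and Rademacher's theorem\<close>

definition dini_deriv :: "('a::real_normed_vector \<Rightarrow> real) \<Rightarrow> 'a \<Rightarrow> 'a \<Rightarrow> real \<Rightarrow> bool" where
  "dini_deriv f x e d \<longleftrightarrow> ((\<lambda>t. (f (x + t *\<^sub>R e) - f x) / t) \<longlongrightarrow> d) (at_right 0)"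

text \<open>The limit is cut into sets with explicit tolerance, scale and slope, with the
  denominator cleared. For continuous \<open>f\<close> they are closed, so countable operations with
  rational parameters stay Borel and \<open>steinhaus_closed\<close> applies to finite
  intersections.\<close>

definition dini_approx ::
    "('a::real_normed_vector \<Rightarrow> real) \<Rightarrow> real \<Rightarrow> real \<Rightarrow> 'a \<Rightarrow> real \<Rightarrow> 'a set" where
  "dini_approx f \<epsilon> \<delta> e a = {x. \<forall>t\<in>{0<..<\<delta>}. \<bar>f (x + t *\<^sub>R e) - f x - t * a\<bar> \<le> t * \<epsilon>}"

lemma dini_deriv_iff:
  "dini_deriv f x e d \<longleftrightarrow>
     (\<forall>\<epsilon>>0. \<exists>\<delta>>0. x \<in> dini_approx f \<epsilon> \<delta> e d)"
proof -
  have eq: "\<bar>f (x + t *\<^sub>R e) - f x - t * d\<bar> \<le> t * \<epsilon> \<longleftrightarrow> dist ((f (x + t *\<^sub>R e) - f x) / t) d \<le> \<epsilon>"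
    if "t > 0" for t \<epsilon>
  proof -
    have "(f (x + t *\<^sub>R e) - f x) / t - d = (f (x + t *\<^sub>R e) - f x - t * d) / t"
      using that by (simp add: field_simps)
    then show ?thesis using that by (simp add: dist_real_def abs_divide pos_divide_le_eq mult.commute)
  qed
  show ?thesis
  proof
    assume *: "dini_deriv f x e d"
    show "\<forall>\<epsilon>>0. \<exists>\<delta>>0. x \<in> dini_approx f \<epsilon> \<delta> e d"
    proof (intro allI impI)
      fix \<epsilon> :: real assume "\<epsilon> > 0"
      then have "\<forall>\<^sub>F t in at_right 0. dist ((f (x + t *\<^sub>R e) - f x) / t) d < \<epsilon>"
        using * unfolding dini_deriv_def by (rule tendstoD[rotated])
      then obtain \<delta> where "\<delta> > 0" "\<And>t. 0 < t \<Longrightarrow> t < \<delta> \<Longrightarrow> dist ((f (x + t *\<^sub>R e) - f x) / t) d < \<epsilon>"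
        unfolding eventually_at_right_field by auto
      then show "\<exists>\<delta>>0. x \<in> dini_approx f \<epsilon> \<delta> e d"
        by (intro exI[of _ \<delta>]) (auto simp: dini_approx_def eq less_imp_le)
    qed
  next
    assume *: "\<forall>\<epsilon>>0. \<exists>\<delta>>0. x \<in> dini_approx f \<epsilon> \<delta> e d"
    show "dini_deriv f x e d"
      unfolding dini_deriv_def
    proof (rule tendstoI)
      fix \<epsilon> :: real assume "\<epsilon> > 0"
      then obtain \<delta> where "\<delta> > 0" and "x \<in> dini_approx f (\<epsilon> / 2) \<delta> e d"
        using * half_gt_zero by blast
      then have *: "dist ((f (x + t *\<^sub>R e) - f x) / t) d < \<epsilon>"
        if "0 < t" "t < \<delta>" for t
        using \<open>\<epsilon> > 0\<close> eq[of t "\<epsilon> / 2"] that by (auto simp: dini_approx_def)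
      then show "\<forall>\<^sub>F t in at_right 0. dist ((f (x + t *\<^sub>R e) - f x) / t) d < \<epsilon>"
        unfolding eventually_at_right_field using \<open>0 < \<delta>\<close> by blast
    qed
  qed
qed

lemma dini_approx_mono:
  "\<lbrakk>x \<in> dini_approx f \<epsilon> \<delta> e a; \<delta>' \<le> \<delta>; \<epsilon> + \<bar>a - a'\<bar> \<le> \<epsilon>'\<rbrakk>
    \<Longrightarrow> x \<in> dini_approx f \<epsilon>' \<delta>' e a'"
proof -
  assume *: "x \<in> dini_approx f \<epsilon> \<delta> e a" "\<delta>' \<le> \<delta>" "\<epsilon> + \<bar>a - a'\<bar> \<le> \<epsilon>'"
  show ?thesis
    unfolding dini_approx_def
  proof (clarify)
    fix t assume t: "t \<in> {0<..<\<delta>'}"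
    then have "\<bar>f (x + t *\<^sub>R e) - f x - t * a\<bar> \<le> t * \<epsilon>"
      using * by (auto simp: dini_approx_def)
    moreover have "\<bar>t * a - t * a'\<bar> = t * \<bar>a - a'\<bar>"
      using t by (simp add: right_diff_distrib[symmetric] abs_mult)
    moreover have "t * \<epsilon> + t * \<bar>a - a'\<bar> \<le> t * \<epsilon>'"
      using t *(3) by (simp add: distrib_left[symmetric])
    ultimately show "\<bar>f (x + t *\<^sub>R e) - f x - t * a'\<bar> \<le> t * \<epsilon>'" by linarith
  qed
qed

lemma closed_dini_approx:
  fixes f :: "'a::real_normed_vector \<Rightarrow> real"
  assumes "continuous_on UNIV f"
  shows "closed (dini_approx f \<epsilon> \<delta> e a)"
proof -
  have "dini_approx f \<epsilon> \<delta> e a =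
      (\<Inter>t\<in>{0<..<\<delta>}. {x. \<bar>f (x + t *\<^sub>R e) - f x - t * a\<bar> \<le> t * \<epsilon>})"
    by (auto simp: dini_approx_def)
  moreover have "closed {x. \<bar>f (x + t *\<^sub>R e) - f x - t * a\<bar> \<le> t * \<epsilon>}" for t
    by (intro closed_Collect_le continuous_intros continuous_on_compose2[OF assms]) auto
  ultimately show ?thesis by auto
qed

text \<open>The slope may vary with the tolerance. Two admissible slopes can be compared at a common
  small \<open>t\<close>, so they differ by at most the sum of their tolerances; the slopes form a
  Cauchy sequence whose limit is the derivative.\<close>

lemma dini_deriv_exI:
  assumes "\<And>\<epsilon>. \<epsilon> > 0 \<Longrightarrow> \<exists>\<delta>>0. \<exists>a. x \<in> dini_approx f \<epsilon> \<delta> e a"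
  shows "\<exists>d. dini_deriv f x e d"
proof -
  have "\<forall>j::nat. \<exists>\<delta> a. \<delta> > 0 \<and> x \<in> dini_approx f (1 / (real j + 1)) \<delta> e a"
    using assms by (metis add_pos_nonneg divide_pos_pos of_nat_0_le_iff zero_less_one add.commute)
  then obtain \<delta> a where \<delta>: "\<And>j::nat. \<delta> j > 0"
      and a: "\<And>j. x \<in> dini_approx f (1 / (real j + 1)) (\<delta> j) e (a j)" by metis
  have close: "\<bar>a i - a j\<bar> \<le> 1 / (real i + 1) + 1 / (real j + 1)" for i j
  proof -
    define t where "t = min (\<delta> i) (\<delta> j) / 2"
    have t: "t > 0" "t < \<delta> i" "t < \<delta> j" using \<delta>[of i] \<delta>[of j] by (auto simp: t_def min_def)
    have "\<bar>f (x + t *\<^sub>R e) - f x - t * a i\<bar> \<le> t * (1 / (real i + 1))"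
      "\<bar>f (x + t *\<^sub>R e) - f x - t * a j\<bar> \<le> t * (1 / (real j + 1))"
      using a[of i] a[of j] t by (auto simp: dini_approx_def)
    then have "\<bar>t * a i - t * a j\<bar> \<le> t * (1 / (real i + 1)) + t * (1 / (real j + 1))" by linarith
    moreover have "\<bar>t * a i - t * a j\<bar> = t * \<bar>a i - a j\<bar>"
      using t by (simp add: right_diff_distrib[symmetric] abs_mult)
    ultimately have "t * \<bar>a i - a j\<bar> \<le> t * (1 / (real i + 1) + 1 / (real j + 1))"
      by (simp add: distrib_left)
    then show ?thesis using t(1) by simp
  qed
  have lim: "(\<lambda>j. 1 / (real j + 1)) \<longlonglongrightarrow> 0"
    using LIMSEQ_inverse_real_of_nat by (simp add: inverse_eq_divide add.commute)
  have "Cauchy a"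
  proof (rule metric_CauchyI)
    fix \<epsilon> :: real assume "\<epsilon> > 0"
    then obtain M where M: "\<And>j. j \<ge> M \<Longrightarrow> 1 / (real j + 1) < \<epsilon> / 2"
      using order_tendstoD(2)[OF lim, of "\<epsilon> / 2"] by (auto simp: eventually_sequentially)
    show "\<exists>M. \<forall>m\<ge>M. \<forall>n\<ge>M. dist (a m) (a n) < \<epsilon>"
    proof (intro exI[of _ M] allI impI)
      fix m n assume "m \<ge> M" "n \<ge> M"
      then show "dist (a m) (a n) < \<epsilon>" using M[of m] M[of n] close[of m n] by (simp add: dist_real_def)
    qed
  qed
  then obtain d where d: "a \<longlonglongrightarrow> d" using Cauchy_convergent convergent_def by blast
  have ad: "\<bar>a i - d\<bar> \<le> 1 / (real i + 1)" for i
  proof (rule tendsto_le[OF _ _ _ always_eventually])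
    show "(\<lambda>j. 1 / (real i + 1) + 1 / (real j + 1)) \<longlonglongrightarrow> 1 / (real i + 1)"
      using tendsto_add[OF tendsto_const lim] by simp
    show "(\<lambda>j. \<bar>a i - a j\<bar>) \<longlonglongrightarrow> \<bar>a i - d\<bar>" by (intro tendsto_intros d)
  qed (use close in auto)
  have "dini_deriv f x e d"
    unfolding dini_deriv_iff
  proof (intro allI impI)
    fix \<epsilon> :: real assume "\<epsilon> > 0"
    then obtain j where j: "1 / (real j + 1) < \<epsilon> / 2"
      using order_tendstoD(2)[OF lim, of "\<epsilon> / 2"] by (auto simp: eventually_sequentially)
    show "\<exists>\<delta>>0. x \<in> dini_approx f \<epsilon> \<delta> e d"
      using dini_approx_mono[OF a[of j] order_refl, of d \<epsilon>] ad[of j] j \<delta>[of j] by fastforce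
  qed
  then show ?thesis ..
qed

lemma ex_dini_deriv_ae:
  fixes f :: "'a::euclidean_space \<Rightarrow> real"
  assumes lip: "C-lipschitz_on UNIV f"
  shows "negligible {x. \<nexists>d. dini_deriv f x e d}"
proof -
  let ?E = "\<lambda>(j::nat) (k::nat) (q::rat).
      dini_approx f (1 / real (Suc j)) (1 / real (Suc k)) e (of_rat q)"
  \<comment> \<open>A Borel description of non-existence of the derivative, with rational slopes; on
    each line parallel to \<open>e\<close> it is null by the one-dimensional result.\<close>
  define N where "N = - (\<Inter>j. \<Union>k. \<Union>q. ?E j k q)"
  have contf: "continuous_on UNIV f" using lip lipschitz_on_continuous_on by blast
  have "?E j k q \<in> sets borel" for j k q
    by (intro borel_closed closed_dini_approx contf)
  then have "N \<in> sets borel"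
    unfolding N_def by (intro borel_comp sets.countable_INT' sets.countable_UN') auto
  moreover have "negligible {t. x + t *\<^sub>R e \<in> N}" for x
  proof -
    have "(C * norm e)-lipschitz_on UNIV (\<lambda>t. f (x + t *\<^sub>R e))"
    proof (rule lipschitz_onI)
      fix s t :: real
      show "dist (f (x + s *\<^sub>R e)) (f (x + t *\<^sub>R e)) \<le> C * norm e * dist s t"
        using lipschitz_onD[OF lip, of "x + s *\<^sub>R e" "x + t *\<^sub>R e"]
        by (simp add: dist_norm scaleR_diff_left[symmetric] mult_ac)
    qed (use lipschitz_on_nonneg[OF lip] in simp)
    then obtain M where M: "negligible M"
      "\<And>t. t \<notin> M \<Longrightarrow> \<exists>d. ((\<lambda>h. (f (x + (t + h) *\<^sub>R e) - f (x + t *\<^sub>R e)) / h) \<longlongrightarrow> d) (at_right 0)"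
      by (rule lipschitz_right_derivative_ae) blast
    have "{t. x + t *\<^sub>R e \<in> N} \<subseteq> M"
    proof (rule subsetI, rule ccontr)
      fix t assume t: "t \<in> {t. x + t *\<^sub>R e \<in> N}" "t \<notin> M"
      then obtain d where d: "dini_deriv f (x + t *\<^sub>R e) e d"
        using M(2)[of t] by (auto simp: dini_deriv_def scaleR_add_left add.assoc)
      have "\<exists>k q. x + t *\<^sub>R e \<in> ?E j k q" for j
      proof -
        obtain q where q: "\<bar>d - of_rat q\<bar> < 1 / real (Suc j) / 2"
        proof -
          obtain r where "r \<in> \<rat>" "d < r" "r < d + 1 / real (Suc j) / 2"
            using Rats_dense_in_real[of d "d + 1 / real (Suc j) / 2"] by auto
          moreover then obtain q where "r = of_rat q" by (auto elim: Rats_cases)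
          ultimately show ?thesis using that[of q] by simp
        qed
        obtain \<delta> where \<delta>: "\<delta> > 0" "x + t *\<^sub>R e \<in> dini_approx f (1 / real (Suc j) / 2) \<delta> e d"
          using d unfolding dini_deriv_iff by (metis half_gt_zero of_nat_0_less_iff zero_less_Suc zero_less_divide_1_iff)
        have sum: "1 / real (Suc j) / 2 + \<bar>d - of_rat q\<bar> \<le> 1 / real (Suc j)" using q by linarith
        obtain k where "1 / real (Suc k) < \<delta>" using nat_approx_posE[OF \<delta>(1)] by blast
        then show ?thesis
          using dini_approx_mono[OF \<delta>(2), of "1 / real (Suc k)" "of_rat q" "1 / real (Suc j)"] q
          sum by (intro exI[of _ k] exI[of _ q]) simp
      qed
      then show False using t(1) by (auto simp: N_def)
    qed
    then show ?thesis using M(1) negligible_subset by blast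
  qed
  ultimately have "negligible N" by (rule negligible_if_negligible_on_lines)
  moreover have "{x. \<nexists>d. dini_deriv f x e d} \<subseteq> N"
  proof (rule subsetI, rule ccontr)
    fix x assume x: "x \<in> {x. \<nexists>d. dini_deriv f x e d}" "x \<notin> N"
    have "\<exists>\<delta>>0. \<exists>a. x \<in> dini_approx f \<epsilon> \<delta> e a" if "\<epsilon> > 0" for \<epsilon>
    proof -
      obtain j where j: "1 / real (Suc j) < \<epsilon>" using nat_approx_posE[OF \<open>\<epsilon> > 0\<close>] by blast
      obtain k q where "x \<in> ?E j k q" using x(2) unfolding N_def by blast
      then show ?thesis
        using dini_approx_mono[of x f _ _ e "of_rat q" "1 / real (Suc k)" "of_rat q" \<epsilon>] j
        by (intro exI[of _ "1 / real (Suc k)"]) fastforce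
    qed
    then show False using dini_deriv_exI x(1) by blast
  qed
  ultimately show ?thesis using negligible_subset by blast
qed

text \<open>If additivity failed by a definite amount on a non-null closed set with uniform
  tolerance and scale, then \<open>steinhaus_closed\<close> would give \<open>x\<close> and
  \<open>x + t *\<^sub>R u\<close> both in the set. Going along \<open>u\<close> from
  \<open>x\<close>, then along \<open>v\<close> from the second point, reaches the endpoint of the
  step along \<open>u + v\<close>, so the slopes nearly add up.\<close>

lemma dini_deriv_add_ae:
  fixes f :: "'a::euclidean_space \<Rightarrow> real"
  assumes contf: "continuous_on UNIV f"
  shows "negligible {x. \<exists>a b c. dini_deriv f x u a \<and> dini_deriv f x v b \<and>
           dini_deriv f x (u + v) c \<and> a + b \<noteq> c}"  (is "negligible ?B")
proof -
  \<comment> \<open>Countably many pieces; the defect of the rational slopes must exceed three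
    tolerances, one for each increment compared.\<close>
  define S where "S = (\<lambda>(j::nat, k::nat, a::rat, b::rat, c::rat).
      if 3 / real (Suc j) < \<bar>of_rat a + of_rat b - of_rat c\<bar> then
      dini_approx f (1 / real (Suc j)) (1 / real (Suc k)) u (of_rat a) \<inter>
      dini_approx f (1 / real (Suc j)) (1 / real (Suc k)) v (of_rat b) \<inter>
      dini_approx f (1 / real (Suc j)) (1 / real (Suc k)) (u + v) (of_rat c) else {})"
  have "negligible (S i)" for i
  proof (rule ccontr)
    assume neg: "\<not> negligible (S i)"
    obtain j k a b c where i: "i = (j, k, a, b, c)" by (metis surj_pair)
    define \<epsilon> where "\<epsilon> = 1 / real (Suc j)"
    have gt: "3 * \<epsilon> < \<bar>of_rat a + of_rat b - of_rat c :: real\<bar>"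
    proof (rule ccontr)
      assume "\<not> ?thesis"
      then have "S i = {}" by (simp add: S_def i \<epsilon>_def)
      then show False using neg by simp
    qed
    then have Si: "S i = dini_approx f \<epsilon> (1 / real (Suc k)) u (of_rat a) \<inter>
      dini_approx f \<epsilon> (1 / real (Suc k)) v (of_rat b) \<inter>
      dini_approx f \<epsilon> (1 / real (Suc k)) (u + v) (of_rat c)"
      by (simp add: S_def i \<epsilon>_def)
    have "closed (S i)" unfolding Si by (intro closed_Int closed_dini_approx contf)
    then obtain \<delta> where \<delta>: "\<delta> > 0" "\<And>h. norm h < \<delta> \<Longrightarrow> \<exists>x\<in>S i. x + h \<in> S i"
      using steinhaus_closed neg by metis
    have "min (1 / real (Suc k)) (\<delta> / (norm u + 1)) > 0" using \<delta>(1) by (simp add: add_nonneg_pos)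
    then obtain t where t: "0 < t" "t < 1 / real (Suc k)" and "t < \<delta> / (norm u + 1)"
      using dense by (metis min_less_iff_conj)
    then have "t * (norm u + 1) < \<delta>" by (simp add: pos_less_divide_eq add_nonneg_pos)
    then have "norm (t *\<^sub>R u) < \<delta>" using t by (simp add: algebra_simps)
    then obtain x where x: "x \<in> S i" "x + t *\<^sub>R u \<in> S i" using \<delta>(2) by blast
    have "\<bar>f (x + t *\<^sub>R u) - f x - t * of_rat a\<bar> \<le> t * \<epsilon>"
      "\<bar>f (x + t *\<^sub>R u + t *\<^sub>R v) - f (x + t *\<^sub>R u) - t * of_rat b\<bar> \<le> t * \<epsilon>"
      "\<bar>f (x + t *\<^sub>R (u + v)) - f x - t * of_rat c\<bar> \<le> t * \<epsilon>"
      using x t unfolding Si by (auto simp: dini_approx_def)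
    then have "\<bar>t * of_rat a + t * of_rat b - t * of_rat c\<bar> \<le> 3 * (t * \<epsilon>)"
      by (simp add: scaleR_add_right add.assoc)
    also have "t * of_rat a + t * of_rat b - t * of_rat c = t * (of_rat a + of_rat b - of_rat c)"
      by (simp add: algebra_simps)
    finally have "t * \<bar>of_rat a + of_rat b - of_rat c\<bar> \<le> t * (3 * \<epsilon>)"
      using t by (simp add: abs_mult)
    then show False using t gt by simp
  qed
  then have "negligible (\<Union>i. S i)" by (intro negligible_countable_Union) auto
  moreover have "?B \<subseteq> (\<Union>i. S i)"
  proof clarify
    fix x a b c
    assume d: "dini_deriv f x u a" "dini_deriv f x v b"
      "dini_deriv f x (u + v) c" and neq: "a + b \<noteq> c"
    \<comment> \<open>With defect above \<open>6 * \<epsilon>\<close> and three slopes each rounded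
      by less than \<open>\<epsilon> / 2\<close>, a defect above \<open>9 / 2 * \<epsilon>\<close>,
      hence above \<open>3 * \<epsilon>\<close>, survives.\<close>
    obtain j where j: "1 / real (Suc j) < \<bar>a + b - c\<bar> / 6"
      using nat_approx_posE[of "\<bar>a + b - c\<bar> / 6"] neq by auto
    define \<epsilon> where "\<epsilon> = 1 / real (Suc j)"
    have \<epsilon>: "\<epsilon> > 0" "\<epsilon> < \<bar>a + b - c\<bar> / 6" using j by (simp_all add: \<epsilon>_def)
    have rat: "\<exists>q. \<bar>d - of_rat q\<bar> < \<epsilon> / 2" for d :: real
    proof -
      obtain r where "r \<in> \<rat>" "d < r" "r < d + \<epsilon> / 2"
        using Rats_dense_in_real[of d "d + \<epsilon> / 2"] \<epsilon> by auto
      moreover then obtain q where "r = of_rat q" by (auto elim: Rats_cases)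
      ultimately show ?thesis by (intro exI[of _ q]) simp
    qed
    obtain qa qb qc where q: "\<bar>a - of_rat qa\<bar> < \<epsilon> / 2" "\<bar>b - of_rat qb\<bar> < \<epsilon> / 2" "\<bar>c - of_rat qc\<bar> < \<epsilon> / 2"
      using rat by metis
    obtain da db dc where del: "da > 0" "x \<in> dini_approx f (\<epsilon> / 2) da u a"
      "db > 0" "x \<in> dini_approx f (\<epsilon> / 2) db v b"
      "dc > 0" "x \<in> dini_approx f (\<epsilon> / 2) dc (u + v) c"
      using d \<epsilon> unfolding dini_deriv_iff by (meson half_gt_zero)
    obtain k where k: "1 / real (Suc k) < min da (min db dc)"
      using nat_approx_posE[of "min da (min db dc)"] del by auto
    have gap: "3 * \<epsilon> < \<bar>a' + b' - c'\<bar>"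
      if "\<bar>a - a'\<bar> < \<epsilon> / 2" "\<bar>b - b'\<bar> < \<epsilon> / 2" "\<bar>c - c'\<bar> < \<epsilon> / 2" "\<epsilon> > 0" "\<epsilon> < \<bar>a + b - c\<bar> / 6"
      for a' b' c' :: real
      using that by (simp add: abs_if split: if_splits)
    have "x \<in> S (j, k, qa, qb, qc)"
    proof -
      have "3 * \<epsilon> < \<bar>of_rat qa + of_rat qb - of_rat qc :: real\<bar>" using q \<epsilon> by (intro gap)
      moreover have "x \<in> dini_approx f \<epsilon> (1 / real (Suc k)) u (of_rat qa)"
        "x \<in> dini_approx f \<epsilon> (1 / real (Suc k)) v (of_rat qb)"
        "x \<in> dini_approx f \<epsilon> (1 / real (Suc k)) (u + v) (of_rat qc)"
        using del k q by (auto intro: dini_approx_mono)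
      ultimately show ?thesis by (simp add: S_def \<epsilon>_def)
    qed
    then show "x \<in> (\<Union>i. S i)" by blast
  qed
  ultimately show ?thesis using negligible_subset by blast
qed

lemma dini_deriv_0: "dini_deriv f x 0 0"
  by (simp add: dini_deriv_def)

lemma dini_deriv_unique:
  "dini_deriv f x e c \<Longrightarrow> dini_deriv f x e d \<Longrightarrow> c = d"
  unfolding dini_deriv_def by (rule tendsto_unique[OF trivial_limit_at_right_real])

lemma dini_deriv_scale:
  assumes "dini_deriv f x e d" and "r > 0"
  shows "dini_deriv f x (r *\<^sub>R e) (r * d)"
proof -
  have "((\<lambda>t. (f (x + (r * t) *\<^sub>R e) - f x) / (r * t)) \<longlongrightarrow> d) (at_right 0)"
    using assms(1) unfolding dini_deriv_def
  proof (rule filterlim_compose)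
    show "LIM t at_right 0. r * t :> at_right 0"
      unfolding filterlim_at
    proof
      show "((\<lambda>t. r * t) \<longlongrightarrow> 0) (at_right 0)" by (auto intro!: tendsto_eq_intros)
      show "\<forall>\<^sub>F t in at_right 0. r * t \<in> {0<..} \<and> r * t \<noteq> 0"
        using eventually_at_right_less[of 0] by eventually_elim (use assms(2) in auto)
    qed
  qed
  then have "((\<lambda>t. r * ((f (x + (r * t) *\<^sub>R e) - f x) / (r * t))) \<longlongrightarrow> r * d) (at_right 0)"
    by (intro tendsto_intros)
  then show ?thesis
    using assms(2) by (simp add: dini_deriv_def mult.commute[of _ r])
qed

definition rat_vectors :: "'a::euclidean_space set" where
  "rat_vectors = {x. \<forall>b\<in>Basis. x \<bullet> b \<in> \<rat>}"

lemma countable_rat_vectors: "countable (rat_vectors :: 'a::euclidean_space set)"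
proof -
  have "inj_on (\<lambda>x. \<lambda>b\<in>Basis. x \<bullet> b) (rat_vectors :: 'a set)"
    by (rule inj_onI, rule euclidean_eqI) (metis restrict_apply')
  moreover have "(\<lambda>x. \<lambda>b\<in>Basis. x \<bullet> b) ` (rat_vectors :: 'a set) \<subseteq> (Basis :: 'a set) \<rightarrow>\<^sub>E \<rat>"
    by (auto simp: rat_vectors_def)
  moreover have "countable ((Basis :: 'a set) \<rightarrow>\<^sub>E \<rat>)"
    by (intro countable_PiE) (auto simp: countable_rat)
  ultimately show ?thesis using countable_subset countable_image_inj_on by blast
qed

lemma rat_vectors_add: "x \<in> rat_vectors \<Longrightarrow> y \<in> rat_vectors \<Longrightarrow> x + y \<in> rat_vectors"
  by (auto simp: rat_vectors_def inner_add_left)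

lemma rat_vectors_scaled_Basis:
  assumes "b \<in> Basis" "r \<in> \<rat>" shows "r *\<^sub>R b \<in> rat_vectors"
  using assms by (auto simp: rat_vectors_def inner_Basis)

lemma rat_vectors_dense:
  fixes x :: "'a::euclidean_space"
  assumes "\<epsilon> > 0"
  obtains d where "d \<in> rat_vectors" "dist d x < \<epsilon>"
proof -
  define \<eta> where "\<eta> = \<epsilon> / (DIM('a) + 1)"
  have \<eta>: "\<eta> > 0" using assms by (simp add: \<eta>_def add_nonneg_pos)
  have "\<exists>q\<in>\<rat>. \<bar>q - x \<bullet> b\<bar> < \<eta>" for b
    using Rats_dense_in_real[of "x \<bullet> b" "x \<bullet> b + \<eta>"] \<eta> by force
  then obtain q where q: "\<And>b. q b \<in> \<rat>" "\<And>b. \<bar>q b - x \<bullet> b\<bar> < \<eta>" by metis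
  define d where "d = (\<Sum>b\<in>Basis. q b *\<^sub>R b)"
  have db: "d \<bullet> b = q b" if "b \<in> Basis" for b using that by (simp add: d_def)
  have "norm (d - x) \<le> (\<Sum>b\<in>Basis. \<bar>(d - x) \<bullet> b\<bar>)" by (rule norm_le_l1)
  also have "\<dots> \<le> (\<Sum>b\<in>(Basis :: 'a set). \<eta>)"
    using q by (intro sum_mono) (simp add: db inner_diff_left less_imp_le)
  also have "\<dots> = DIM('a) * \<eta>" by simp
  also have "\<dots> < (DIM('a) + 1) * \<eta>" using \<eta> by (simp add: algebra_simps)
  also have "\<dots> = \<epsilon>" by (simp add: \<eta>_def add_nonneg_pos)
  finally show ?thesis using q db by (intro that[of d]) (auto simp: rat_vectors_def dist_norm)
qed

text \<open>Off a null set the directional derivatives exist and are additive on the countable dense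
  set \<open>rat_vectors\<close>, which forces them to agree there with a linear map. Compactness of
  the unit sphere and the Lipschitz bound make the approximation uniform over all
  directions.\<close>

lemma rademacher_real:
  fixes f :: "'a::euclidean_space \<Rightarrow> real"
  assumes lip: "C-lipschitz_on UNIV f"
  shows "negligible {x. \<not> f differentiable (at x)}"
proof -
  have contf: "continuous_on UNIV f" using lip lipschitz_on_continuous_on by blast
  define N where "N = (\<Union>e\<in>rat_vectors. {x. \<nexists>d. dini_deriv f x e d}) \<union>
    (\<Union>u\<in>rat_vectors. \<Union>v\<in>rat_vectors. {x. \<exists>a b c. dini_deriv f x u a \<and>
       dini_deriv f x v b \<and> dini_deriv f x (u + v) c \<and> a + b \<noteq> c})"
  have cR: "countable (rat_vectors :: 'a set)" by (rule countable_rat_vectors)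
  have UN: "negligible (\<Union>i\<in>I. A i)" if "countable I" "\<And>i. i \<in> I \<Longrightarrow> negligible (A i)"
    for I :: "'a set" and A :: "'a \<Rightarrow> 'a set"
    using that by (intro negligible_countable_Union) auto
  have "negligible N"
    unfolding N_def
    by (intro negligible_Un UN cR ex_dini_deriv_ae[OF lip]
      dini_deriv_add_ae[OF contf])
  moreover have "f differentiable (at x)" if x: "x \<notin> N" for x
  proof -
    have "\<forall>e\<in>rat_vectors. \<exists>d. dini_deriv f x e d" using x by (auto simp: N_def)
    then obtain g where g: "\<And>e. e \<in> rat_vectors \<Longrightarrow> dini_deriv f x e (g e)" by metis
    have add: "g (u + v) = g u + g v" if "u \<in> rat_vectors" "v \<in> rat_vectors" for u v
      using x g[OF that(1)] g[OF that(2)] g[OF rat_vectors_add[OF that]] that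
      by (fastforce simp: N_def)
    have z: "(0::'a) \<in> rat_vectors" by (simp add: rat_vectors_def)
    have g0: "g 0 = 0" using g[OF z] dini_deriv_0 dini_deriv_unique by blast
    have pos: "g (r *\<^sub>R b) = r * g b" if "b \<in> Basis" "r \<in> \<rat>" "r > 0" for r b
    proof -
      have "b \<in> rat_vectors" using rat_vectors_scaled_Basis[of b 1] that by simp
      then show ?thesis
        using dini_deriv_scale[OF g that(3)] g[OF rat_vectors_scaled_Basis[OF that(1,2)]]
          dini_deriv_unique by blast
    qed
    have scale: "g (r *\<^sub>R b) = r * g b" if "b \<in> Basis" "r \<in> \<rat>" for r b
    proof -
      consider "r > 0" | "r = 0" | "r < 0" by linarith
      then show ?thesis
      proof cases
        case 3
        have "g (r *\<^sub>R b + (- r) *\<^sub>R b) = g (r *\<^sub>R b) + g ((- r) *\<^sub>R b)"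
          using that by (intro add rat_vectors_scaled_Basis) auto
        moreover have "g ((- r) *\<^sub>R b) = - r * g b" using that 3 by (intro pos) auto
        ultimately show ?thesis using g0 by simp
      qed (use that pos g0 in auto)
    qed
    \<comment> \<open>The only candidate for the derivative. Negative multiples have just been
      reached through additivity, since one-sided derivatives scale only by positive
      factors.\<close>
    define T where "T = (\<lambda>h. \<Sum>b\<in>Basis. (h \<bullet> b) * g b)"
    have lin: "bounded_linear T"
      unfolding T_def
      by (intro bounded_linear_sum bounded_linear_mult_const bounded_linear_inner_left)
    have gT: "g d = T d" if d: "d \<in> rat_vectors" for d
    proof -
      have "(\<Sum>b\<in>B. (d \<bullet> b) *\<^sub>R b) \<in> rat_vectors \<and>
          g (\<Sum>b\<in>B. (d \<bullet> b) *\<^sub>R b) = (\<Sum>b\<in>B. (d \<bullet> b) * g b)" if "finite B" "B \<subseteq> Basis" for B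
        using that
      proof (induction B rule: finite_induct)
        case empty
        then show ?case using z g0 by simp
      next
        case (insert b B)
        then have b: "b \<in> Basis" "d \<bullet> b \<in> \<rat>" using d by (auto simp: rat_vectors_def)
        then show ?case
          using insert add rat_vectors_add[of "(d \<bullet> b) *\<^sub>R b" "\<Sum>b\<in>B. (d \<bullet> b) *\<^sub>R b"]
            rat_vectors_scaled_Basis[OF b] scale[OF b] by simp
      qed
      from this[of Basis] show ?thesis by (simp add: T_def euclidean_representation)
    qed
    obtain K where K: "K > 0" "\<And>h. norm (T h) \<le> norm h * K"
      using bounded_linear.pos_bounded[OF lin] by blast
    have C0: "C \<ge> 0" using lip lipschitz_on_nonneg by blast
    have "(f has_derivative T) (at x)"
      unfolding has_derivative_at_alt
    proof (intro conjI allI impI lin)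
      fix \<epsilon> :: real assume \<epsilon>: "\<epsilon> > 0"
      \<comment> \<open>Replacing a unit direction by a rational vector within \<open>\<rho>\<close>
        costs \<open>C * \<rho>\<close> in \<open>f\<close> and \<open>K * \<rho>\<close> in
        \<open>T\<close> per unit length, together \<open>\<epsilon> / 2\<close>.\<close>
      define \<rho> where "\<rho> = \<epsilon> / (2 * (C + K))"
      have CK: "C + K > 0" using C0 K by simp
      have \<rho>: "\<rho> > 0" "(C + K) * \<rho> = \<epsilon> / 2" using \<epsilon> CK by (simp_all add: \<rho>_def del: distrib_left_numeral)
      have "sphere (0::'a) 1 \<subseteq> (\<Union>d\<in>rat_vectors. ball d \<rho>)"
      proof
        fix y :: 'a
        obtain d where "d \<in> rat_vectors" "dist d y < \<rho>" using rat_vectors_dense[OF \<rho>(1)] by metis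
        then show "y \<in> (\<Union>d\<in>rat_vectors. ball d \<rho>)" by auto
      qed
      then obtain F where F: "F \<subseteq> rat_vectors" "finite F" "sphere (0::'a) 1 \<subseteq> (\<Union>d\<in>F. ball d \<rho>)"
        using compactE_image[OF compact_sphere[of "0::'a" 1], of rat_vectors "\<lambda>d. ball d \<rho>"] by auto
      have "\<forall>d\<in>F. \<exists>\<delta>>0. x \<in> dini_approx f (\<epsilon> / 2) \<delta> d (T d)"
      proof
        fix d assume "d \<in> F"
        then have "dini_deriv f x d (T d)" using g gT F(1) by (metis subsetD)
        then show "\<exists>\<delta>>0. x \<in> dini_approx f (\<epsilon> / 2) \<delta> d (T d)"
          using \<epsilon> unfolding dini_deriv_iff by (meson half_gt_zero)
      qed
      then obtain \<delta> where \<delta>: "\<And>d. d \<in> F \<Longrightarrow> \<delta> d > 0"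
          "\<And>d. d \<in> F \<Longrightarrow> x \<in> dini_approx f (\<epsilon> / 2) (\<delta> d) d (T d)" by metis
      define \<delta>' where "\<delta>' = Min (insert 1 (\<delta> ` F))"
      have \<delta>': "\<delta>' > 0" "\<And>d. d \<in> F \<Longrightarrow> \<delta>' \<le> \<delta> d"
        using F(2) \<delta>(1) by (auto simp: \<delta>'_def)
      show "\<exists>\<delta>>0. \<forall>y. norm (y - x) < \<delta> \<longrightarrow> norm (f y - f x - T (y - x)) \<le> \<epsilon> * norm (y - x)"
      proof (intro exI[of _ \<delta>'] conjI allI impI \<delta>'(1))
        fix y assume y: "norm (y - x) < \<delta>'"
        show "norm (f y - f x - T (y - x)) \<le> \<epsilon> * norm (y - x)"
        proof (cases "y = x")
          case True
          then show ?thesis using linear_0[OF bounded_linear.linear[OF lin]] by simp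
        next
          case False
          define t where "t = norm (y - x)"
          have t: "0 < t" "t < \<delta>'" using False y by (auto simp: t_def)
          define e where "e = (1 / t) *\<^sub>R (y - x)"
          have e: "norm e = 1" "y - x = t *\<^sub>R e" using t by (auto simp: e_def t_def)
          then obtain d where d: "d \<in> F" "dist d e < \<rho>" using F(3) by (auto simp: subset_iff)
          have y': "y = x + t *\<^sub>R e" using e(2) by (simp add: algebra_simps)
          have 1: "\<bar>f (x + t *\<^sub>R d) - f x - t * T d\<bar> \<le> t * (\<epsilon> / 2)"
            using \<delta>(2)[OF d(1)] \<delta>'(2)[OF d(1)] t by (auto simp: dini_approx_def)
          have "\<bar>f y - f (x + t *\<^sub>R d)\<bar> \<le> C * dist y (x + t *\<^sub>R d)"
            using lipschitz_onD[OF lip, of y "x + t *\<^sub>R d"] by (simp add: dist_real_def)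
          also have "dist y (x + t *\<^sub>R d) = t * dist d e"
            using t by (simp add: y' dist_norm scaleR_diff_right[symmetric] norm_minus_commute)
          also have "C * (t * dist d e) \<le> C * (t * \<rho>)" using C0 t d by (intro mult_left_mono) auto
          finally have 2: "\<bar>f y - f (x + t *\<^sub>R d)\<bar> \<le> C * (t * \<rho>)" .
          have "t * T d - T (y - x) = T (t *\<^sub>R (d - e))"
            using linear_scale[OF bounded_linear.linear[OF lin]] linear_diff[OF bounded_linear.linear[OF lin]]
            by (simp add: e(2) right_diff_distrib)
          then have "\<bar>t * T d - T (y - x)\<bar> \<le> norm (t *\<^sub>R (d - e)) * K" using K(2)[of "t *\<^sub>R (d - e)"] by simp
          also have "\<dots> = K * (t * dist d e)" using t by (simp add: dist_norm)
          also have "\<dots> \<le> K * (t * \<rho>)" using K t d by (intro mult_left_mono) auto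
          finally have 3: "\<bar>t * T d - T (y - x)\<bar> \<le> K * (t * \<rho>)" .
          have "C * (t * \<rho>) + K * (t * \<rho>) = t * ((C + K) * \<rho>)" by (simp add: algebra_simps)
          also have "\<dots> = t * (\<epsilon> / 2)" using \<rho> by simp
          finally have "\<bar>f y - f x - T (y - x)\<bar> \<le> t * (\<epsilon> / 2) + t * (\<epsilon> / 2)"
            using 1 2 3 by linarith
          then show ?thesis by (simp add: t_def algebra_simps)
        qed
      qed
    qed
    then show ?thesis by (auto simp: differentiable_def)
  qed
  ultimately show ?thesis by (auto intro: negligible_subset)
qed

lemma rademacher:
  fixes f :: "'a::euclidean_space \<Rightarrow> 'b::euclidean_space"
  assumes lip: "C-lipschitz_on UNIV f"
  shows "negligible {x. \<not> f differentiable (at x)}"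
proof -
  have "{x. \<not> f differentiable (at x)} = (\<Union>b\<in>Basis. {x. \<not> (\<lambda>x. f x \<bullet> b) differentiable (at x)})"
    using differentiable_componentwise_within[of f _ UNIV] by auto
  moreover have "negligible {x. \<not> (\<lambda>x. f x \<bullet> b) differentiable (at x)}" if "b \<in> Basis" for b
  proof (rule rademacher_real)
    show "C-lipschitz_on UNIV (\<lambda>x. f x \<bullet> b)"
    proof (rule lipschitz_onI)
      fix x y
      have "dist (f x \<bullet> b) (f y \<bullet> b) \<le> dist (f x) (f y)"
        using Basis_le_norm[OF that, of "f x - f y"] by (simp add: dist_norm inner_diff_left)
      then show "dist (f x \<bullet> b) (f y \<bullet> b) \<le> C * dist x y"
        using lipschitz_onD[OF lip, of x y] by simp
    qed (rule lipschitz_on_nonneg[OF lip])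
  qed
  ultimately show ?thesis by (auto intro!: negligible_Union)
qed

text \<open>Near each point the function is composed with the nearest-point projection onto a small
  ball. The projection is 1-Lipschitz, so the composition is globally Lipschitz and agrees with
  \<open>f\<close> inside the ball.\<close>

lemma rademacher_local:
  fixes f :: "'a::euclidean_space \<Rightarrow> 'b::euclidean_space"
  assumes "open S" and lip: "\<And>x. x \<in> S \<Longrightarrow> \<exists>r>0. \<exists>K. K-lipschitz_on (ball x r \<inter> S) f"
  shows "negligible {x\<in>S. \<not> f differentiable (at x)}"
proof (subst locally_negligible_alt, clarify)
  fix x assume x: "x \<in> S" "\<not> f differentiable (at x)"
  obtain r K where r: "r > 0" "K-lipschitz_on (ball x r \<inter> S) f" using lip[OF x(1)] by blast
  obtain r' where r': "r' > 0" "cball x r' \<subseteq> ball x r \<inter> S"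
    using open_contains_cball[of "ball x r \<inter> S"] assms(1) x(1) r(1) by (metis centre_in_ball open_Int open_ball Int_iff)
  define p where "p = closest_point (cball x r')"
  have p: "p y \<in> cball x r'" for y using closest_point_in_set[of "cball x r'" y] r' by (auto simp: p_def)
  have K: "K-lipschitz_on (cball x r') f" using r(2) r'(2) lipschitz_on_subset by blast
  have "K-lipschitz_on UNIV (\<lambda>y. f (p y))"
  proof (rule lipschitz_onI)
    fix y z
    have "dist (f (p y)) (f (p z)) \<le> K * dist (p y) (p z)" using lipschitz_onD[OF K p p] .
    also have "\<dots> \<le> K * dist y z"
      using r'(1) lipschitz_on_nonneg[OF K]
      by (intro mult_left_mono) (auto simp: p_def intro!: closest_point_lipschitz)
    finally show "dist (f (p y)) (f (p z)) \<le> K * dist y z" .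
  qed (rule lipschitz_on_nonneg[OF K])
  then have neg: "negligible {y. \<not> (\<lambda>y. f (p y)) differentiable (at y)}" by (rule rademacher)
  have "f differentiable (at y)" if y: "y \<in> ball x r'" "(\<lambda>y. f (p y)) differentiable (at y)" for y
  proof -
    obtain e where e: "e > 0" "ball y e \<subseteq> ball x r'" by (rule openE[OF open_ball y(1)])
    show ?thesis
    proof (rule differentiable_transform_within[OF y(2) e(1)])
      fix z assume "dist z y < e"
      then have "z \<in> cball x r'" using e(2) by (auto simp: dist_commute subset_iff less_imp_le)
      then show "f (p z) = f z" by (simp add: p_def closest_point_self)
    qed simp
  qed
  then have "{y\<in>S. \<not> f differentiable (at y)} \<inter> ball x r' \<subseteq> {y. \<not> (\<lambda>y. f (p y)) differentiable (at y)}"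
    by blast
  then have "negligible ({y\<in>S. \<not> f differentiable (at y)} \<inter> ball x r')"
    using neg negligible_subset by blast
  then show "\<exists>U. openin (top_of_set {x \<in> S. \<not> f differentiable at x}) U \<and> x \<in> U \<and> negligible U"
    using x r'(1) by (intro exI[of _ "{y\<in>S. \<not> f differentiable (at y)} \<inter> ball x r'"]) auto
qed

section \<open>Second-order expansions of semiconvex functions\<close>

text \<open>A global proximal subgradient; equivalently, \<open>q + l *\<^sub>R z\<close> is a
  subgradient at \<open>z\<close> of \<open>A\<close> plus \<open>l / 2\<close> times the squared
  norm. Having one at every point is how semiconvexity with constant \<open>l\<close> is expressed
  below.\<close>

definition prox_subgrad :: "real \<Rightarrow> ('a::real_inner \<Rightarrow> real) \<Rightarrow> 'a \<Rightarrow> 'a \<Rightarrow> bool" where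
  "prox_subgrad l A z q \<longleftrightarrow> (\<forall>h. A z + q \<bullet> h - l / 2 * (norm h)\<^sup>2 \<le> A (z + h))"

lemma norm_add_sq: "(norm (x + y))\<^sup>2 = (norm x)\<^sup>2 + 2 * (x \<bullet> y) + (norm (y::'a::real_inner))\<^sup>2"
  by (simp add: power2_norm_eq_inner inner_add_left inner_add_right inner_commute)

lemma norm_diff_sq: "(norm (x - y))\<^sup>2 = (norm x)\<^sup>2 - 2 * (x \<bullet> y) + (norm (y::'a::real_inner))\<^sup>2"
  by (simp add: power2_norm_eq_inner inner_diff_left inner_diff_right inner_commute)

lemma norm_add_sq_le: "(norm (x + y))\<^sup>2 \<le> 2 * (norm x)\<^sup>2 + 2 * (norm (y::'a::real_inner))\<^sup>2"
  using zero_le_power2[of "norm (x - y)"] unfolding norm_add_sq norm_diff_sq by linarith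

text \<open>The best test vector is the multiple of \<open>a\<close> of length \<open>d\<close>. It
  turns two-sided quadratic bounds on a function into Lipschitz bounds on its gradients; with
  \<open>d = 0\<close> it gives uniqueness of gradients.\<close>

lemma norm_le_if_inner_le_quadratic:
  fixes a :: "'a::real_inner"
  assumes c: "c > 0" and le: "\<And>k. a \<bullet> k \<le> c * ((norm k)\<^sup>2 + d\<^sup>2)" and "d \<ge> 0"
  shows "norm a \<le> 2 * c * d"
proof (cases "a = 0")
  case False
  show ?thesis
  proof (cases "d = 0")
    case True
    have "(norm a)\<^sup>2 / (2 * c) = a \<bullet> ((1 / (2 * c)) *\<^sub>R a)" by (simp add: power2_norm_eq_inner)
    also have "\<dots> \<le> c * (norm ((1 / (2 * c)) *\<^sub>R a))\<^sup>2" using le[of "(1 / (2 * c)) *\<^sub>R a"] True by simp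
    also have "\<dots> = (norm a)\<^sup>2 / (4 * c)"
      using c by (simp add: power_mult_distrib power2_eq_square field_simps)
    finally have "(norm a)\<^sup>2 / (2 * c) \<le> (norm a)\<^sup>2 / (4 * c)" .
    then show ?thesis using False c by (simp add: field_simps)
  next
    case d: False
    have "a \<bullet> ((d / norm a) *\<^sub>R a) = d * norm a"
      using False by (simp add: dot_square_norm power2_eq_square)
    moreover have "norm ((d / norm a) *\<^sub>R a) = d" using False \<open>d \<ge> 0\<close> by simp
    ultimately have "d * norm a \<le> c * (d\<^sup>2 + d\<^sup>2)" using le[of "(d / norm a) *\<^sub>R a"] by simp
    also have "\<dots> = d * (2 * c * d)" by (simp add: power2_eq_square)
    finally show ?thesis using d \<open>d \<ge> 0\<close> by simp
  qed
qed (use assms in simp)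

text \<open>After adding the quadratic there is an affine support at every point; averaging the
  support inequality at the convex combination cancels the linear terms.\<close>

lemma semiconvex_imp_convex:
  fixes A :: "'a::real_inner \<Rightarrow> real"
  assumes "\<And>z. \<exists>q. prox_subgrad l A z q"
  shows "convex_on UNIV (\<lambda>z. A z + l / 2 * (norm z)\<^sup>2)"
proof (rule convex_onI)
  fix t :: real and x y :: 'a
  assume t: "0 < t" "t < 1"
  let ?\<psi> = "\<lambda>z. A z + l / 2 * (norm z)\<^sup>2"
  define w where "w = (1 - t) *\<^sub>R x + t *\<^sub>R y"
  obtain q where q: "prox_subgrad l A w q" using assms by blast
  have sub: "?\<psi> w + (q + l *\<^sub>R w) \<bullet> (z - w) \<le> ?\<psi> z" for z
  proof -
    have "A w + q \<bullet> (z - w) - l / 2 * (norm (z - w))\<^sup>2 \<le> A z"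
      using q[unfolded prox_subgrad_def, rule_format, of "z - w"] by simp
    moreover have "(norm z)\<^sup>2 = (norm w)\<^sup>2 + 2 * (w \<bullet> (z - w)) + (norm (z - w))\<^sup>2"
      using norm_add_sq[of w "z - w"] by simp
    from arg_cong[OF this, of "\<lambda>x. l / 2 * x"]
    have "l / 2 * (norm z)\<^sup>2 = l / 2 * (norm w)\<^sup>2 + l * (w \<bullet> (z - w)) + l / 2 * (norm (z - w))\<^sup>2"
      by (simp add: distrib_left)
    ultimately show ?thesis unfolding inner_add_left inner_scaleR_left by linarith
  qed
  have affine: "(1 - t) * (P + X) + t * (P + Y) = P + ((1 - t) * X + t * Y)" for P X Y :: real
    by (simp add: algebra_simps)
  have "(1 - t) * (?\<psi> w + (q + l *\<^sub>R w) \<bullet> (x - w)) + t * (?\<psi> w + (q + l *\<^sub>R w) \<bullet> (y - w))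
      \<le> (1 - t) * ?\<psi> x + t * ?\<psi> y"
    by (intro add_mono mult_left_mono sub) (use t in auto)
  moreover have "(1 - t) * (?\<psi> w + (q + l *\<^sub>R w) \<bullet> (x - w)) + t * (?\<psi> w + (q + l *\<^sub>R w) \<bullet> (y - w))
      = ?\<psi> w + (q + l *\<^sub>R w) \<bullet> ((1 - t) *\<^sub>R (x - w) + t *\<^sub>R (y - w))"
    unfolding inner_add_right[of "q + l *\<^sub>R w"] inner_scaleR_right by (rule affine)
  moreover have "(1 - t) *\<^sub>R (x - w) + t *\<^sub>R (y - w) = 0" by (simp add: w_def algebra_simps)
  ultimately show "?\<psi> ((1 - t) *\<^sub>R x + t *\<^sub>R y) \<le> (1 - t) * ?\<psi> x + t * ?\<psi> y"
    by (simp add: w_def[symmetric])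
qed auto

lemma semiconvex_imp_continuous:
  fixes A :: "'a::euclidean_space \<Rightarrow> real"
  assumes "\<And>z. \<exists>q. prox_subgrad l A z q"
  shows "continuous_on UNIV A"
proof -
  have *: "continuous_on UNIV (\<lambda>z. A z + l / 2 * (norm z)\<^sup>2)"
    by (rule convex_on_continuous[OF open_UNIV semiconvex_imp_convex[OF assms]])
  have eq: "A = (\<lambda>z. (A z + l / 2 * (norm z)\<^sup>2) - l / 2 * (norm z)\<^sup>2)" by auto
  show ?thesis by (subst eq) (intro continuous_intros *)
qed

text \<open>For a convex function a lower bound with any quadratic error is already a subgradient
  inequality: applied to \<open>t *\<^sub>R h\<close>, the error is of order \<open>t\<close> after
  division by \<open>t\<close> and vanishes in the limit. Minimisation below produces the constant
  \<open>1 / \<eta>\<close>, which is thereby lowered to \<open>l\<close>.\<close>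

lemma prox_subgrad_improve:
  fixes A :: "'a::real_inner \<Rightarrow> real"
  assumes ex: "\<And>z. \<exists>q. prox_subgrad l A z q" and c: "prox_subgrad c A z q"
  shows "prox_subgrad l A z q"
  unfolding prox_subgrad_def
proof
  fix h
  let ?\<psi> = "\<lambda>z. A z + l / 2 * (norm z)\<^sup>2"
  have conv: "convex_on UNIV ?\<psi>" by (rule semiconvex_imp_convex[OF ex])
  have step: "q \<bullet> h + l * (z \<bullet> h) \<le> ?\<psi> (z + h) - ?\<psi> z + t * ((c - l) / 2 * (norm h)\<^sup>2)"
    if t: "0 < t" "t < 1" for t
  proof -
    have "?\<psi> ((1 - t) *\<^sub>R z + t *\<^sub>R (z + h)) \<le> (1 - t) * ?\<psi> z + t * ?\<psi> (z + h)"
      using convex_onD[OF conv, of t z "z + h"] t by simp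
    also have "(1 - t) *\<^sub>R z + t *\<^sub>R (z + h) = z + t *\<^sub>R h" by (simp add: algebra_simps)
    finally have 1: "?\<psi> (z + t *\<^sub>R h) \<le> (1 - t) * ?\<psi> z + t * ?\<psi> (z + h)" .
    have 2: "A z + t * (q \<bullet> h) - c / 2 * (t\<^sup>2 * (norm h)\<^sup>2) \<le> A (z + t *\<^sub>R h)"
      using c[unfolded prox_subgrad_def, rule_format, of "t *\<^sub>R h"] by (simp add: power_mult_distrib)
    have 3: "(norm (z + t *\<^sub>R h))\<^sup>2 = (norm z)\<^sup>2 + 2 * t * (z \<bullet> h) + t\<^sup>2 * (norm h)\<^sup>2"
      by (simp add: norm_add_sq power_mult_distrib)
    have "t * (q \<bullet> h + l * (z \<bullet> h)) \<le> t * (?\<psi> (z + h) - ?\<psi> z + t * ((c - l) / 2 * (norm h)\<^sup>2))"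
      using 1 2 unfolding 3 by (simp add: algebra_simps power2_eq_square add_divide_distrib diff_divide_distrib)
    then show ?thesis using t by simp
  qed
  have "((\<lambda>t. ?\<psi> (z + h) - ?\<psi> z + t * ((c - l) / 2 * (norm h)\<^sup>2)) \<longlongrightarrow>
      ?\<psi> (z + h) - ?\<psi> z + 0 * ((c - l) / 2 * (norm h)\<^sup>2)) (at_right 0)"
    by (intro tendsto_intros)
  moreover have "\<forall>\<^sub>F t in at_right 0. q \<bullet> h + l * (z \<bullet> h) \<le> ?\<psi> (z + h) - ?\<psi> z + t * ((c - l) / 2 * (norm h)\<^sup>2)"
    unfolding eventually_at_right_field by (intro exI[of _ 1]) (use step in auto)
  ultimately have "q \<bullet> h + l * (z \<bullet> h) \<le> ?\<psi> (z + h) - ?\<psi> z + 0 * ((c - l) / 2 * (norm h)\<^sup>2)"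
    by (rule tendsto_lowerbound) simp
  then show "A z + q \<bullet> h - l / 2 * (norm h)\<^sup>2 \<le> A (z + h)"
    by (simp add: norm_add_sq inner_commute algebra_simps)
qed

section \<open>Resolvent and Moreau envelope\<close>

lemma continuous_coercive_attains_inf:
  fixes f :: "'a::euclidean_space \<Rightarrow> real"
  assumes cont: "continuous_on UNIV f" and "c > 0"
    and le: "\<And>z. f 0 + c * (norm z)\<^sup>2 - b * norm z - d \<le> f z"
  obtains z where "\<And>z'. f z \<le> f z'"
proof -
  define r where "r = (\<bar>b\<bar> + \<bar>d\<bar>) / c + 1"
  have r: "r \<ge> 1" "c * r \<ge> \<bar>b\<bar> + \<bar>d\<bar>" using \<open>c > 0\<close> by (auto simp: r_def field_simps)
  have ne: "cball (0::'a) r \<noteq> {}" using r by auto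
  have "continuous_on (cball 0 r) f" using cont continuous_on_subset by blast
  then obtain z where z: "\<And>z'. z' \<in> cball 0 r \<Longrightarrow> f z \<le> f z'"
    using continuous_attains_inf[OF compact_cball ne] by blast
  have "f z \<le> f z'" for z'
  proof (cases "norm z' \<le> r")
    case False
    define n where "n = norm z'"
    have n: "n \<ge> r" "n \<ge> 1" using False r by (auto simp: n_def)
    have "c * n \<ge> \<bar>b\<bar> + \<bar>d\<bar>" using r(2) n(1) \<open>c > 0\<close> by (smt (verit) mult_left_mono)
    then have "c * n - b \<ge> \<bar>d\<bar>" by linarith
    then have "n * (c * n - b) \<ge> 1 * \<bar>d\<bar>" using n by (intro mult_mono) auto
    then have "c * n\<^sup>2 - b * n \<ge> d" by (simp add: power2_eq_square algebra_simps)
    then have "f 0 \<le> f z'" using le[of z'] by (simp add: n_def)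
    moreover have "f z \<le> f 0" using z r by simp
    ultimately show ?thesis by linarith
  qed (use z in auto)
  then show ?thesis by (rule that)
qed

text \<open>\<open>J\<close> is the resolvent of \<open>A\<close>, \<open>H\<close> its Moreau envelope and \<open>G\<close> the gradient of \<open>H\<close>.\<close>
locale moreau =
  fixes A :: "'a::euclidean_space \<Rightarrow> real" and l \<eta> :: real
  assumes ex: "\<And>z. \<exists>q. prox_subgrad l A z q" and l: "l > 0" and \<eta>: "\<eta> > 0" "l * \<eta> \<le> 1 / 2"
begin

lemma prox_subgrad_monotone:
  assumes "prox_subgrad l A x p" "prox_subgrad l A y q"
  shows "(p - q) \<bullet> (x - y) \<ge> - l * (norm (x - y))\<^sup>2"
proof -
  have "A x + p \<bullet> (y - x) - l / 2 * (norm (y - x))\<^sup>2 \<le> A y"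
    using assms(1)[unfolded prox_subgrad_def, rule_format, of "y - x"] by simp
  moreover have "A y + q \<bullet> (x - y) - l / 2 * (norm (x - y))\<^sup>2 \<le> A x"
    using assms(2)[unfolded prox_subgrad_def, rule_format, of "x - y"] by simp
  ultimately show ?thesis
    by (simp add: norm_minus_commute inner_diff_left inner_diff_right algebra_simps)
qed

text \<open>Multiplying the monotonicity inequality by \<open>\<eta>\<close> gives
  \<open>(1 - l * \<eta>) * |x - y|^2\<close> at most the inner product of \<open>a - b\<close> and
  \<open>x - y\<close>; the bound \<open>l * \<eta> \<le> 1 / 2\<close> turns this into the factor
  2.\<close>

lemma resolvent_lipschitz:
  assumes "prox_subgrad l A x ((a - x) /\<^sub>R \<eta>)" "prox_subgrad l A y ((b - y) /\<^sub>R \<eta>)"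
  shows "norm (x - y) \<le> 2 * norm (a - b)"
proof -
  have "((a - x) /\<^sub>R \<eta> - (b - y) /\<^sub>R \<eta>) \<bullet> (x - y) \<ge> - l * (norm (x - y))\<^sup>2"
    using prox_subgrad_monotone[OF assms] .
  then have "\<eta> * (((a - x) /\<^sub>R \<eta> - (b - y) /\<^sub>R \<eta>) \<bullet> (x - y)) \<ge> \<eta> * (- l * (norm (x - y))\<^sup>2)"
    using \<eta> by (intro mult_left_mono) auto
  moreover have "\<eta> * (((a - x) /\<^sub>R \<eta> - (b - y) /\<^sub>R \<eta>) \<bullet> (x - y)) = ((a - b) - (x - y)) \<bullet> (x - y)"
  proof -
    have "(a - x) /\<^sub>R \<eta> - (b - y) /\<^sub>R \<eta> = ((a - b) - (x - y)) /\<^sub>R \<eta>"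
      by (simp add: scaleR_diff_right)
    then show ?thesis using \<eta> by simp
  qed
  ultimately have "(norm (x - y))\<^sup>2 - (l * \<eta>) * (norm (x - y))\<^sup>2 \<le> (a - b) \<bullet> (x - y)"
    by (simp add: inner_diff_left[of "a - b"] power2_norm_eq_inner algebra_simps)
  moreover have "(l * \<eta>) * (norm (x - y))\<^sup>2 \<le> 1 / 2 * (norm (x - y))\<^sup>2"
    using \<eta> by (intro mult_right_mono) auto
  ultimately have "1 / 2 * (norm (x - y))\<^sup>2 \<le> norm (a - b) * norm (x - y)"
    using norm_cauchy_schwarz[of "a - b" "x - y"] by linarith
  then have "norm (x - y) * norm (x - y) \<le> norm (x - y) * (2 * norm (a - b))"
    by (simp add: power2_eq_square algebra_simps)
  then show ?thesis by (cases "norm (x - y) = 0") (auto simp: mult_le_cancel_left)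
qed

text \<open>A minimiser of \<open>A\<close> plus the squared distance to \<open>y\<close> over
  \<open>2 * \<eta>\<close> solves the resolvent equation; coercivity holds because
  \<open>1 / \<eta>\<close> exceeds the semiconvexity constant.\<close>

lemma resolvent_exists: "\<exists>z. prox_subgrad l A z ((y - z) /\<^sub>R \<eta>)"
proof -
  define f where "f = (\<lambda>z. A z + (norm (z - y))\<^sup>2 / (2 * \<eta>))"
  obtain q where q: "prox_subgrad l A 0 q" using ex by blast
  define c where "c = 1 / (2 * \<eta>) - l / 2"
  have c: "c > 0" using \<eta> l by (simp add: c_def field_simps)
  have "continuous_on UNIV f"
    unfolding f_def using \<eta> by (intro continuous_intros semiconvex_imp_continuous[OF ex]) auto
  moreover have "f 0 + c * (norm z)\<^sup>2 - (norm q + norm y / \<eta>) * norm z - 0 \<le> f z" for z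
  proof -
    have 1: "A 0 + q \<bullet> z - l / 2 * (norm z)\<^sup>2 \<le> A z"
      using q[unfolded prox_subgrad_def, rule_format, of z] by simp
    have "- (norm q * norm z) \<le> q \<bullet> z"
      using Cauchy_Schwarz_ineq2[of q z] by linarith
    moreover have "(norm (z - y))\<^sup>2 / (2 * \<eta>) = (norm z)\<^sup>2 / (2 * \<eta>) - (z \<bullet> y) / \<eta> + (norm y)\<^sup>2 / (2 * \<eta>)"
      by (simp add: norm_diff_sq add_divide_distrib diff_divide_distrib)
    moreover have "(z \<bullet> y) / \<eta> \<le> norm z * norm y / \<eta>"
      using \<eta> norm_cauchy_schwarz[of z y] by (intro divide_right_mono) auto
    ultimately show ?thesis using 1 by (simp add: f_def c_def algebra_simps)
  qed
  ultimately obtain z where z: "\<And>z'. f z \<le> f z'"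
    using continuous_coercive_attains_inf[OF _ c] by metis
  have "prox_subgrad (1 / \<eta>) A z ((y - z) /\<^sub>R \<eta>)"
    unfolding prox_subgrad_def
  proof
    fix h
    have "(norm (z + h - y))\<^sup>2 = (norm (z - y))\<^sup>2 + 2 * ((z - y) \<bullet> h) + (norm h)\<^sup>2"
      using norm_add_sq[of "z - y" h] by (simp add: algebra_simps)
    then have "(norm (z + h - y))\<^sup>2 / (2 * \<eta>) = (norm (z - y))\<^sup>2 / (2 * \<eta>) + ((z - y) \<bullet> h) / \<eta> + (norm h)\<^sup>2 / (2 * \<eta>)"
      by (simp add: add_divide_distrib)
    moreover have "((y - z) /\<^sub>R \<eta>) \<bullet> h = - (((z - y) \<bullet> h) / \<eta>)"
      using \<eta> by (simp add: inner_diff_left field_simps)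
    ultimately show "A z + ((y - z) /\<^sub>R \<eta>) \<bullet> h - 1 / \<eta> / 2 * (norm h)\<^sup>2 \<le> A (z + h)"
      using z[of "z + h"] by (simp add: f_def)
  qed
  then show ?thesis using prox_subgrad_improve[OF ex] by blast
qed

definition J :: "'a \<Rightarrow> 'a" where "J y = (SOME z. prox_subgrad l A z ((y - z) /\<^sub>R \<eta>))"

definition G :: "'a \<Rightarrow> 'a" where "G y = (y - J y) /\<^sub>R \<eta>"

definition H :: "'a \<Rightarrow> real" where "H y = A (J y) + (norm (J y - y))\<^sup>2 / (2 * \<eta>)"

lemma J: "prox_subgrad l A (J y) (G y)"
  unfolding G_def J_def by (rule someI_ex[OF resolvent_exists])

text \<open>Uniqueness is \<open>resolvent_lipschitz\<close> with equal data. The single point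
  \<open>z + \<eta> *\<^sub>R q\<close> thus encodes both the point and its subgradient, which is
  what lets the envelope see \<open>A\<close> near \<open>z\<close>.\<close>

lemma J_eq:
  assumes "prox_subgrad l A z q" shows "J (z + \<eta> *\<^sub>R q) = z" "G (z + \<eta> *\<^sub>R q) = q"
proof -
  have "prox_subgrad l A z ((z + \<eta> *\<^sub>R q - z) /\<^sub>R \<eta>)" using assms \<eta> by simp
  from resolvent_lipschitz[OF this J[unfolded G_def]] show 1: "J (z + \<eta> *\<^sub>R q) = z"
    by (metis norm_le_zero_iff right_minus_eq mult_zero_right norm_zero)
  show "G (z + \<eta> *\<^sub>R q) = q" using \<eta> by (simp add: G_def 1)
qed

lemma J_lipschitz: "2-lipschitz_on UNIV J"
  using resolvent_lipschitz[OF J[unfolded G_def] J[unfolded G_def]]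
  by (intro lipschitz_onI) (auto simp: dist_norm)

text \<open>The proximal inequality at \<open>J y\<close> shows that \<open>J y\<close> minimises
  the right-hand side over \<open>z\<close>, because \<open>l \<le> 1 / \<eta>\<close>.\<close>

lemma H_le: "H y \<le> A z + (norm (z - y))\<^sup>2 / (2 * \<eta>)"
proof -
  define h where "h = z - J y"
  have z: "z = J y + h" by (simp add: h_def)
  have 1: "A (J y) + G y \<bullet> h - l / 2 * (norm h)\<^sup>2 \<le> A z"
    using J[of y] by (simp add: prox_subgrad_def z)
  have "(norm (z - y))\<^sup>2 = (norm (J y - y))\<^sup>2 + 2 * ((J y - y) \<bullet> h) + (norm h)\<^sup>2"
    using norm_add_sq[of "J y - y" h] by (simp add: z algebra_simps)
  then have 2: "(norm (z - y))\<^sup>2 / (2 * \<eta>) = (norm (J y - y))\<^sup>2 / (2 * \<eta>) + ((J y - y) \<bullet> h) / \<eta> + (norm h)\<^sup>2 / (2 * \<eta>)"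
    by (simp add: add_divide_distrib)
  have 3: "G y \<bullet> h = - (((J y - y) \<bullet> h) / \<eta>)"
    using \<eta> by (simp add: G_def inner_diff_left field_simps)
  have "l / 2 * (norm h)\<^sup>2 \<le> 1 / (2 * \<eta>) * (norm h)\<^sup>2"
    using \<eta> l by (intro mult_right_mono) (auto simp: field_simps)
  then show ?thesis using 1 2 3 by (simp add: H_def)
qed

text \<open>The competitor \<open>J y\<close> is kept while \<open>y\<close> moves. Used at
  \<open>y + k\<close> with increment \<open>- k\<close>, the same bound also gives the lower
  estimate needed for differentiability.\<close>

lemma H_upper: "H (y + k) \<le> H y + G y \<bullet> k + (norm k)\<^sup>2 / (2 * \<eta>)"
proof -
  have "(norm (J y - (y + k)))\<^sup>2 = (norm (J y - y))\<^sup>2 - 2 * ((J y - y) \<bullet> k) + (norm k)\<^sup>2"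
    using norm_diff_sq[of "J y - y" k] by (simp add: algebra_simps)
  then have "(norm (J y - (y + k)))\<^sup>2 / (2 * \<eta>) = (norm (J y - y))\<^sup>2 / (2 * \<eta>) - ((J y - y) \<bullet> k) / \<eta> + (norm k)\<^sup>2 / (2 * \<eta>)"
    by (simp add: add_divide_distrib diff_divide_distrib)
  moreover have "G y \<bullet> k = - (((J y - y) \<bullet> k) / \<eta>)"
    using \<eta> by (simp add: G_def inner_diff_left field_simps)
  ultimately show ?thesis using H_le[of "y + k" "J y"] by (simp add: H_def)
qed

lemma G_lipschitz: "norm (G x - G y) \<le> 3 / \<eta> * norm (x - y)"
proof -
  have "G x - G y = ((x - y) - (J x - J y)) /\<^sub>R \<eta>" by (simp add: G_def scaleR_diff_right)
  moreover have "norm (v /\<^sub>R \<eta>) = norm v / \<eta>" for v :: 'a using \<eta> by (simp add: field_simps)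
  ultimately have "norm (G x - G y) = norm ((x - y) - (J x - J y)) / \<eta>" by (simp only:)
  also have "norm ((x - y) - (J x - J y)) \<le> norm (x - y) + norm (J x - J y)" by (rule norm_triangle_ineq4)
  also have "norm (J x - J y) \<le> 2 * norm (x - y)"
    using lipschitz_onD[OF J_lipschitz, of x y] by (simp add: dist_norm)
  finally show ?thesis using \<eta> by (simp add: divide_right_mono)
qed

lemma H_has_derivative: "(H has_derivative (\<lambda>h. G y \<bullet> h)) (at y)"
  unfolding has_derivative_at_alt
proof (intro conjI allI impI)
  show "bounded_linear (\<lambda>h. G y \<bullet> h)" by (rule bounded_linear_inner_right)
  fix e :: real assume e: "e > 0"
  have *: "\<bar>H (y + k) - H y - G y \<bullet> k\<bar> \<le> 4 / \<eta> * (norm k)\<^sup>2" for k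
  proof -
    have "H y \<le> H (y + k) - G (y + k) \<bullet> k + (norm k)\<^sup>2 / (2 * \<eta>)"
      using H_upper[of "y + k" "- k"] by simp
    moreover have "\<bar>(G (y + k) - G y) \<bullet> k\<bar> \<le> norm (G (y + k) - G y) * norm k"
      by (rule Cauchy_Schwarz_ineq2)
    moreover have "norm (G (y + k) - G y) * norm k \<le> (3 / \<eta> * norm k) * norm k"
      using G_lipschitz[of "y + k" y] by (intro mult_right_mono) auto
    moreover have "(norm k)\<^sup>2 / (2 * \<eta>) \<le> (norm k)\<^sup>2 / \<eta>" using \<eta> by (intro divide_left_mono) auto
    moreover have "4 / \<eta> * (norm k)\<^sup>2 = (3 / \<eta> * norm k) * norm k + (norm k)\<^sup>2 / \<eta>"
      by (simp add: power2_eq_square algebra_simps)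
    moreover have "(3 / \<eta> * norm k) * norm k \<ge> 0" using \<eta> by simp
    ultimately show ?thesis using H_upper[of y k] by (simp add: inner_diff_left abs_le_iff)
  qed
  show "\<exists>d>0. \<forall>x. norm (x - y) < d \<longrightarrow> norm (H x - H y - G y \<bullet> (x - y)) \<le> e * norm (x - y)"
  proof (intro exI[of _ "e * \<eta> / 4"] conjI allI impI)
    show "e * \<eta> / 4 > 0" using e \<eta> by simp
    fix x assume x: "norm (x - y) < e * \<eta> / 4"
    have "norm (H x - H y - G y \<bullet> (x - y)) \<le> (4 / \<eta> * norm (x - y)) * norm (x - y)"
      using *[of "x - y"] by (simp add: power2_eq_square algebra_simps)
    also have "\<dots> \<le> e * norm (x - y)"
      using x \<eta> by (intro mult_right_mono) (auto simp: field_simps)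
    finally show "norm (H x - H y - G y \<bullet> (x - y)) \<le> e * norm (x - y)" .
  qed
qed

end

section \<open>Transfer of second-order expansions from the envelope to the function\<close>

text \<open>\<open>G\<close> is differentiable at the single point \<open>y\<close> only, so the
  mean value theorem is applied along the ray to \<open>H\<close> minus its quadratic model; the
  derivative of that difference is exactly the remainder of \<open>G\<close>. Symmetry of
  \<open>D\<close> does not enter.\<close>

lemma second_order_taylor:
  fixes H :: "'a::real_inner \<Rightarrow> real"
  assumes H: "\<And>y. (H has_derivative (\<lambda>h. G y \<bullet> h)) (at y)"
    and D: "(G has_derivative D) (at y)" and "\<kappa> > 0"
  obtains r where "r > 0"
    and "\<And>k. norm k < r \<Longrightarrow> \<bar>H (y + k) - H y - G y \<bullet> k - (k \<bullet> D k) / 2\<bar> \<le> \<kappa> * (norm k)\<^sup>2"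
proof -
  have lin: "bounded_linear D" using D has_derivative_bounded_linear by blast
  obtain r where r: "r > 0" "\<And>x. norm (x - y) < r \<Longrightarrow> norm (G x - G y - D (x - y)) \<le> \<kappa> * norm (x - y)"
    using D \<open>\<kappa> > 0\<close> unfolding has_derivative_at_alt by blast
  show ?thesis
  proof (rule that[OF r(1)])
    fix k :: 'a assume k: "norm k < r"
    define \<phi> where "\<phi> = (\<lambda>t. H (y + t *\<^sub>R k) - t * (G y \<bullet> k) - t\<^sup>2 * ((k \<bullet> D k) / 2))"
    have der: "(\<phi> has_real_derivative (G (y + t *\<^sub>R k) - G y - D (t *\<^sub>R k)) \<bullet> k) (at t)" for t
    proof -
      have "((\<lambda>t. y + t *\<^sub>R k) has_derivative (\<lambda>s. s *\<^sub>R k)) (at t)"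
        by (auto intro!: derivative_eq_intros)
      from has_derivative_compose[OF this H]
      have "((\<lambda>t. H (y + t *\<^sub>R k)) has_real_derivative (G (y + t *\<^sub>R k) \<bullet> k)) (at t)"
        unfolding has_field_derivative_def by (rule has_derivative_eq_rhs) (auto simp: fun_eq_iff)
      moreover have "D (t *\<^sub>R k) = t *\<^sub>R D k" using linear_scale[OF bounded_linear.linear[OF lin]] .
      ultimately show ?thesis
        unfolding \<phi>_def by (auto intro!: derivative_eq_intros simp: inner_diff_left inner_diff_right inner_commute)
    qed
    obtain \<xi> where \<xi>: "0 < \<xi>" "\<xi> < 1" "\<phi> 1 - \<phi> 0 = (1 - 0) * ((G (y + \<xi> *\<^sub>R k) - G y - D (\<xi> *\<^sub>R k)) \<bullet> k)"
      using MVT2[of 0 1 \<phi>, OF _ der] by auto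
    have "norm (\<xi> *\<^sub>R k) \<le> norm k" using \<xi> by (simp add: mult_left_le_one_le)
    then have "norm (G (y + \<xi> *\<^sub>R k) - G y - D (\<xi> *\<^sub>R k)) \<le> \<kappa> * norm k"
      using r(2)[of "y + \<xi> *\<^sub>R k"] k \<open>\<kappa> > 0\<close>
      by (smt (verit) add_diff_cancel_left' mult_left_mono)
    then have "norm (G (y + \<xi> *\<^sub>R k) - G y - D (\<xi> *\<^sub>R k)) * norm k \<le> (\<kappa> * norm k) * norm k"
      by (intro mult_right_mono) auto
    then have "\<bar>(G (y + \<xi> *\<^sub>R k) - G y - D (\<xi> *\<^sub>R k)) \<bullet> k\<bar> \<le> \<kappa> * (norm k)\<^sup>2"
      using Cauchy_Schwarz_ineq2[of "G (y + \<xi> *\<^sub>R k) - G y - D (\<xi> *\<^sub>R k)" k]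
      by (simp add: power2_eq_square algebra_simps)
    then show "\<bar>H (y + k) - H y - G y \<bullet> k - (k \<bullet> D k) / 2\<bar> \<le> \<kappa> * (norm k)\<^sup>2"
      using \<xi>(3) by (simp add: \<phi>_def algebra_simps)
  qed
qed

lemma quadratic_form_le_if_locally_le:
  fixes D :: "'a::real_inner \<Rightarrow> 'a"
  assumes lin: "linear D"
    and le: "\<And>\<kappa>. \<kappa> > 0 \<Longrightarrow> \<exists>r>0. \<forall>k. norm k < r \<longrightarrow> k \<bullet> D k \<le> (c + \<kappa>) * (norm k)\<^sup>2"
  shows "k \<bullet> D k \<le> c * (norm k)\<^sup>2"
proof (rule field_le_epsilon)
  fix e :: real assume e: "e > 0"
  define \<kappa> where "\<kappa> = e / ((norm k)\<^sup>2 + 1)"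
  have n1: "(norm k)\<^sup>2 + 1 > 0" by (simp add: add_nonneg_pos)
  have \<kappa>: "\<kappa> > 0" using e n1 by (simp add: \<kappa>_def)
  then obtain r where r: "r > 0" "\<And>k. norm k < r \<Longrightarrow> k \<bullet> D k \<le> (c + \<kappa>) * (norm k)\<^sup>2" using le by blast
  define n where "n = norm k + 1"
  have n: "n > 0" by (simp add: n_def add_nonneg_pos)
  define t where "t = r / n / 2"
  have t: "t > 0" using r(1) n by (simp add: t_def)
  have "t * norm k < r"
  proof -
    have "t * norm k \<le> t * n" using t by (intro mult_left_mono) (auto simp: n_def)
    also have "\<dots> = r / 2" using n by (simp add: t_def)
    finally show ?thesis using r(1) by linarith
  qed
  then have "(t *\<^sub>R k) \<bullet> D (t *\<^sub>R k) \<le> (c + \<kappa>) * (norm (t *\<^sub>R k))\<^sup>2"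
    using t by (intro r(2)) simp
  then have "t\<^sup>2 * (k \<bullet> D k) \<le> t\<^sup>2 * ((c + \<kappa>) * (norm k)\<^sup>2)"
    using linear_scale[OF lin, of t k] by (simp add: power2_eq_square algebra_simps)
  then have "k \<bullet> D k \<le> (c + \<kappa>) * (norm k)\<^sup>2" using t by simp
  also have "\<dots> = c * (norm k)\<^sup>2 + \<kappa> * (norm k)\<^sup>2" by (simp add: distrib_right)
  also have "\<kappa> * (norm k)\<^sup>2 \<le> \<kappa> * ((norm k)\<^sup>2 + 1)" using \<kappa> by (intro mult_left_mono) auto
  also have "\<dots> = e" using n1 by (simp add: \<kappa>_def)
  finally show "k \<bullet> D k \<le> c * (norm k)\<^sup>2 + e" by simp
qed

text \<open>A form bounded below by \<open>- 2 l\<close> and above by \<open>l\<close> changes by \<open>O(s)\<close> under relative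
  perturbations of size \<open>s\<close>; shifting by \<open>2 l\<close> makes it non-negative, so that Young's inequality applies.\<close>
lemma quadratic_form_perturb:
  fixes D :: "'a::real_inner \<Rightarrow> 'a"
  assumes lin: "linear D" and low: "\<And>k. - 2 * l * (norm k)\<^sup>2 \<le> k \<bullet> D k"
    and up: "\<And>k. k \<bullet> D k \<le> l * (norm k)\<^sup>2"
    and l: "l > 0" and s: "0 < s" "s \<le> 1" and d: "norm d \<le> 3 * s * norm h"
  shows "(h + d) \<bullet> D (h + d) \<le> h \<bullet> D h + 69 * l * s * (norm h)\<^sup>2"
proof -
  define P where "P = (\<lambda>x. x \<bullet> D x + 2 * l * (norm x)\<^sup>2)"
  have P0: "P x \<ge> 0" for x using low[of x] by (simp add: P_def)
  have P3: "P x \<le> 3 * l * (norm x)\<^sup>2" for x using up[of x] by (simp add: P_def)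
  define B where "B = h \<bullet> D d + d \<bullet> D h + 4 * l * (h \<bullet> d)"
  have Padd: "P (a *\<^sub>R h + b *\<^sub>R d) = a\<^sup>2 * P h + a * b * B + b\<^sup>2 * P d" for a b
    unfolding P_def B_def norm_add_sq linear_add[OF lin] linear_scale[OF lin]
    by (simp add: inner_add_left inner_add_right power_mult_distrib power2_eq_square[of a]
        power2_eq_square[of b] algebra_simps)
  \<comment> \<open>The weight \<open>s\<close> balances Young's inequality: \<open>d\<close> has
    relative size \<open>s\<close>, so \<open>P d\<close> is of order \<open>s\<^sup>2\<close> and
    the cross term \<open>B\<close> is of order \<open>s\<close>.\<close>
  have "0 \<le> P (s *\<^sub>R h + (- 1) *\<^sub>R d)" by (rule P0)
  then have "s * B \<le> s\<^sup>2 * P h + P d" unfolding Padd by simp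
  moreover have "P d \<le> 27 * l * s\<^sup>2 * (norm h)\<^sup>2"
  proof -
    have "P d \<le> 3 * l * (norm d)\<^sup>2" by (rule P3)
    also have "\<dots> \<le> 3 * l * (3 * s * norm h)\<^sup>2"
      using l d by (intro mult_left_mono power_mono) auto
    finally show ?thesis by (simp add: power_mult_distrib)
  qed
  moreover have "s\<^sup>2 * P h \<le> s\<^sup>2 * (3 * l * (norm h)\<^sup>2)" by (intro mult_left_mono P3) auto
  ultimately have "s * B \<le> s * (30 * l * s * (norm h)\<^sup>2)" by (simp add: power2_eq_square algebra_simps)
  then have B: "B \<le> 30 * l * s * (norm h)\<^sup>2" using s by simp
  have "27 * l * s\<^sup>2 * (norm h)\<^sup>2 \<le> 27 * l * s * (norm h)\<^sup>2"
    using l s by (intro mult_right_mono mult_left_mono) (auto simp: power2_eq_square mult_left_le)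
  then have Pd: "P d \<le> 27 * l * s * (norm h)\<^sup>2" using \<open>P d \<le> 27 * l * s\<^sup>2 * (norm h)\<^sup>2\<close> by linarith
  have "- (norm h * norm d) \<le> h \<bullet> d" using Cauchy_Schwarz_ineq2[of h d] by linarith
  moreover have "norm h * norm d \<le> norm h * (3 * s * norm h)" using d by (intro mult_left_mono) auto
  ultimately have "- (3 * s * (norm h)\<^sup>2) \<le> h \<bullet> d" by (simp add: power2_eq_square algebra_simps)
  then have "4 * l * (- (3 * s * (norm h)\<^sup>2)) \<le> 4 * l * (h \<bullet> d)" using l by (intro mult_left_mono) auto
  moreover have "(norm (h + d))\<^sup>2 \<ge> (norm h)\<^sup>2 + 2 * (h \<bullet> d)" by (simp add: norm_add_sq)
  then have "2 * l * (norm (h + d))\<^sup>2 \<ge> 2 * l * ((norm h)\<^sup>2 + 2 * (h \<bullet> d))" using l by (intro mult_left_mono) auto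
  moreover have "P (h + d) = P h + B + P d" using Padd[of 1 1] by simp
  moreover have "(h + d) \<bullet> D (h + d) = P (h + d) - 2 * l * (norm (h + d))\<^sup>2" by (simp add: P_def)
  moreover have "P h = h \<bullet> D h + 2 * l * (norm h)\<^sup>2" by (simp add: P_def)
  \<comment> \<open>The 69 is 30 from the cross term, 27 from \<open>P d\<close> and 12 from undoing
    the shift by \<open>2 * l\<close>.\<close>
  ultimately show ?thesis using B Pd unfolding distrib_left by linarith
qed

context moreau
begin

lemma G_has_derivative:
  assumes "J differentiable (at y)" obtains D where "(G has_derivative D) (at y)"
proof -
  obtain J' where "(J has_derivative J') (at y)" using assms by (auto simp: differentiable_def)
  then have "((\<lambda>y. (y - J y) /\<^sub>R \<eta>) has_derivative (\<lambda>h. (h - J' h) /\<^sub>R \<eta>)) (at y)"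
    by (auto intro!: derivative_eq_intros)
  moreover have "(\<lambda>y. (y - J y) /\<^sub>R \<eta>) = G" by (auto simp: G_def)
  ultimately show ?thesis using that by simp
qed

text \<open>The envelope is twice differentiable at \<open>z + \<eta> *\<^sub>R q\<close>. Moving
  \<open>z\<close> and this point by the same \<open>h\<close> gives the lower bound for
  \<open>A\<close>. For the upper bound the envelope must be evaluated where its resolvent is
  \<open>z + h\<close>; that increment differs from \<open>h\<close> by a relative error of order
  \<open>l * \<eta>\<close>, because the contact from above and below makes the subgradients
  Lipschitz at \<open>z\<close>.\<close>

lemma second_order_expansion_at_contact:
  assumes q: "prox_subgrad l A z q"
    and touch: "\<And>h. A (z + h) \<le> A z + q \<bullet> h + l / 2 * (norm h)\<^sup>2"
    and diff: "J differentiable (at (z + \<eta> *\<^sub>R q))" and \<kappa>: "\<kappa> > 0"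
  obtains D r where "linear D" "r > 0"
    "\<And>h. norm h < r \<Longrightarrow> A z + q \<bullet> h + (h \<bullet> D h) / 2 - \<kappa> * (norm h)\<^sup>2 \<le> A (z + h)"
    "\<And>h. norm h < r \<Longrightarrow> A (z + h) \<le> A z + q \<bullet> h + (h \<bullet> D h) / 2 + (35 * l * (l * \<eta>) + \<kappa>) * (norm h)\<^sup>2"
proof -
  define y where "y = z + \<eta> *\<^sub>R q"
  have Jy: "J y = z" and Gy: "G y = q" using J_eq[OF q] by (simp_all add: y_def)
  have Hy: "H y = A z + \<eta> * (norm q)\<^sup>2 / 2"
    using \<eta> by (simp add: H_def Jy) (simp add: y_def power_mult_distrib power2_eq_square)
  obtain D where D: "(G has_derivative D) (at y)" using G_has_derivative diff by (auto simp: y_def)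
  have lin: "linear D" using D has_derivative_linear by blast
  have taylor: "\<exists>r>0. \<forall>k. norm k < r \<longrightarrow> \<bar>H (y + k) - H y - q \<bullet> k - (k \<bullet> D k) / 2\<bar> \<le> e * (norm k)\<^sup>2"
    if "e > 0" for e
    using second_order_taylor[OF H_has_derivative D that] Gy by metis
  have nle: "(norm (z - (y + k)))\<^sup>2 / (2 * \<eta>) = \<eta> * (norm q)\<^sup>2 / 2 + q \<bullet> k + (norm k)\<^sup>2 / (2 * \<eta>)" for k
  proof -
    have "norm (z - (y + k)) = norm (\<eta> *\<^sub>R q + k)"
      by (metis (no_types, opaque_lifting) add.assoc add_diff_cancel_left' norm_minus_commute y_def)
    then have "(norm (z - (y + k)))\<^sup>2 = \<eta>\<^sup>2 * (norm q)\<^sup>2 + 2 * \<eta> * (q \<bullet> k) + (norm k)\<^sup>2"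
      by (simp add: norm_add_sq power_mult_distrib)
    then show ?thesis using \<eta> by (simp add: add_divide_distrib power2_eq_square)
  qed
  have shifted: "H (y + h) \<le> A (z + h) + \<eta> * (norm q)\<^sup>2 / 2" for h
  proof -
    have "(norm (z + h - (y + h)))\<^sup>2 / (2 * \<eta>) = \<eta> * (norm q)\<^sup>2 / 2"
      using nle[of 0] by simp
    then show ?thesis using H_le[of "y + h" "z + h"] by simp
  qed
  have up: "k \<bullet> D k \<le> l * (norm k)\<^sup>2" for k
  proof (rule quadratic_form_le_if_locally_le[OF lin])
    fix e :: real assume "e > 0"
    then obtain r where r: "r > 0" "\<And>k. norm k < r \<Longrightarrow> \<bar>H (y + k) - H y - q \<bullet> k - (k \<bullet> D k) / 2\<bar> \<le> e / 2 * (norm k)\<^sup>2"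
      using taylor[of "e / 2"] by auto
    have "k \<bullet> D k \<le> (l + e) * (norm k)\<^sup>2" if "norm k < r" for k
      using r(2)[OF that] shifted[of k] touch[of k] Hy unfolding abs_le_iff distrib_right by linarith
    then show "\<exists>r>0. \<forall>k. norm k < r \<longrightarrow> k \<bullet> D k \<le> (l + e) * (norm k)\<^sup>2" using r(1) by blast
  qed
  \<comment> \<open>Passing to the envelope loses a factor 2 in the lower quadratic bound; the
    penalty absorbs the rest since \<open>l \<le> 1 / (2 * \<eta>)\<close>.\<close>
  have H_low: "H y + q \<bullet> k - l * (norm k)\<^sup>2 \<le> H (y + k)" for k
  proof -
    define h where "h = J (y + k) - z"
    have 1: "A z + q \<bullet> h - l / 2 * (norm h)\<^sup>2 \<le> A (J (y + k))"
      using q[unfolded prox_subgrad_def, rule_format, of h] by (simp add: h_def)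
    have "J (y + k) - (y + k) = z - (y + (k - h))" by (simp add: h_def)
    then have 2: "(norm (J (y + k) - (y + k)))\<^sup>2 / (2 * \<eta>)
        = \<eta> * (norm q)\<^sup>2 / 2 + q \<bullet> (k - h) + (norm (k - h))\<^sup>2 / (2 * \<eta>)"
      using nle[of "k - h"] by (simp only:)
    have "(norm h)\<^sup>2 \<le> 2 * (norm k)\<^sup>2 + 2 * (norm (k - h))\<^sup>2"
      using norm_add_sq_le[of k "h - k"] by (simp add: norm_minus_commute)
    then have "l / 2 * (norm h)\<^sup>2 \<le> l / 2 * (2 * (norm k)\<^sup>2 + 2 * (norm (k - h))\<^sup>2)"
      using l by (intro mult_left_mono) auto
    moreover have "l * (norm (k - h))\<^sup>2 \<le> 1 / (2 * \<eta>) * (norm (k - h))\<^sup>2"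
      using \<eta> l by (intro mult_right_mono) (auto simp: field_simps)
    then have "l * (norm (k - h))\<^sup>2 \<le> (norm (k - h))\<^sup>2 / (2 * \<eta>)" by simp
    ultimately show ?thesis using 1 2 unfolding H_def[of "y + k"] Hy inner_diff_right distrib_left by linarith
  qed
  have low: "- 2 * l * (norm k)\<^sup>2 \<le> k \<bullet> D k" for k
  proof -
    have "k \<bullet> (- D k) \<le> (2 * l) * (norm k)\<^sup>2"
    proof (rule quadratic_form_le_if_locally_le)
      show "linear (\<lambda>k. - D k)" using lin by (rule linear_compose_neg)
      fix e :: real assume "e > 0"
      then obtain r where r: "r > 0" "\<And>k. norm k < r \<Longrightarrow> \<bar>H (y + k) - H y - q \<bullet> k - (k \<bullet> D k) / 2\<bar> \<le> e / 2 * (norm k)\<^sup>2"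
        using taylor[of "e / 2"] by auto
      have "k \<bullet> (- D k) \<le> (2 * l + e) * (norm k)\<^sup>2" if "norm k < r" for k
        using r(2)[OF that] H_low[of k] unfolding abs_le_iff distrib_right inner_minus_right by linarith
      then show "\<exists>r>0. \<forall>k. norm k < r \<longrightarrow> k \<bullet> (- D k) \<le> (2 * l + e) * (norm k)\<^sup>2" using r(1) by blast
    qed
    then show ?thesis by simp
  qed
  have le1: "l * \<eta> \<le> 1" using \<eta> by linarith
  \<comment> \<open>The increment \<open>k\<close> used below satisfies
    \<open>|k| \<le> 4 * |h|\<close>, hence the 16 here and the radius \<open>r / 4\<close>.\<close>
  obtain r where r: "r > 0" "\<And>k. norm k < r \<Longrightarrow> \<bar>H (y + k) - H y - q \<bullet> k - (k \<bullet> D k) / 2\<bar> \<le> \<kappa> / 16 * (norm k)\<^sup>2"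
    using taylor[of "\<kappa> / 16"] \<kappa> by auto
  show ?thesis
  proof (rule that[OF lin, of "r / 4"])
    show "r / 4 > 0" using r by simp
    fix h :: 'a assume h: "norm h < r / 4"
    have "\<kappa> / 16 * (norm h)\<^sup>2 \<le> \<kappa> * (norm h)\<^sup>2" using \<kappa> by (intro mult_right_mono) auto
    moreover have "\<bar>H (y + h) - H y - q \<bullet> h - (h \<bullet> D h) / 2\<bar> \<le> \<kappa> / 16 * (norm h)\<^sup>2"
      using h r by (intro r(2)) auto
    ultimately show "A z + q \<bullet> h + (h \<bullet> D h) / 2 - \<kappa> * (norm h)\<^sup>2 \<le> A (z + h)"
      using shifted[of h] Hy unfolding abs_le_iff by linarith
    obtain q' where q': "prox_subgrad l A (z + h) q'" using ex by blast
    \<comment> \<open>Chosen so that \<open>y + k\<close> is the point encoding \<open>z + h\<close>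
      together with \<open>q'\<close>; there the envelope equals \<open>A (z + h)\<close> plus an
      explicit term.\<close>
    define k where "k = h + \<eta> *\<^sub>R (q' - q)"
    have yk: "y + k = z + h + \<eta> *\<^sub>R q'" by (simp add: y_def k_def algebra_simps)
    have "norm (q' - q) \<le> 2 * (3 * l / 2) * norm h"
    proof (rule norm_le_if_inner_le_quadratic)
      fix x
      have "A (z + h) + q' \<bullet> x - l / 2 * (norm x)\<^sup>2 \<le> A (z + h + x)"
        using q' by (simp add: prox_subgrad_def)
      moreover have "A (z + h + x) \<le> A z + q \<bullet> (h + x) + l / 2 * (norm (h + x))\<^sup>2"
        using touch[of "h + x"] by (simp add: add.assoc)
      moreover have "A z + q \<bullet> h - l / 2 * (norm h)\<^sup>2 \<le> A (z + h)" using q by (simp add: prox_subgrad_def)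
      moreover have "l / 2 * (norm (h + x))\<^sup>2 \<le> l / 2 * (2 * (norm h)\<^sup>2 + 2 * (norm x)\<^sup>2)"
        using l by (intro mult_left_mono norm_add_sq_le) auto
      ultimately show "(q' - q) \<bullet> x \<le> 3 * l / 2 * ((norm x)\<^sup>2 + (norm h)\<^sup>2)"
        by (simp add: inner_diff_left inner_add_right algebra_simps)
    qed (use l in auto)
    then have "\<eta> * norm (q' - q) \<le> \<eta> * (3 * l * norm h)" using \<eta> by (intro mult_left_mono) auto
    moreover have "norm (\<eta> *\<^sub>R (q' - q)) = \<eta> * norm (q' - q)" using \<eta> by simp
    ultimately have d: "norm (\<eta> *\<^sub>R (q' - q)) \<le> 3 * (l * \<eta>) * norm h"
      by (simp only: mult_ac)
    have "3 * (l * \<eta>) * norm h \<le> 3 * norm h" using le1 by (intro mult_right_mono) auto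
    then have nk: "norm k \<le> 4 * norm h"
      using d norm_triangle_ineq[of h "\<eta> *\<^sub>R (q' - q)"] unfolding k_def by linarith
    have Dk: "k \<bullet> D k \<le> h \<bullet> D h + 69 * l * (l * \<eta>) * (norm h)\<^sup>2"
      unfolding k_def by (rule quadratic_form_perturb[OF lin low up l _ le1 d]) (use l \<eta> in auto)
    have "\<bar>H (y + k) - H y - q \<bullet> k - (k \<bullet> D k) / 2\<bar> \<le> \<kappa> / 16 * (norm k)\<^sup>2"
      using nk h by (intro r(2)) auto
    also have "\<dots> \<le> \<kappa> / 16 * (4 * norm h)\<^sup>2" using nk \<kappa> by (intro mult_left_mono power_mono) auto
    also have "\<dots> = \<kappa> * (norm h)\<^sup>2" by (simp add: power_mult_distrib)
    finally have Hk: "H (y + k) \<le> H y + q \<bullet> k + (k \<bullet> D k) / 2 + \<kappa> * (norm h)\<^sup>2" by (simp add: abs_le_iff)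
    have Hyk: "H (y + k) = A (z + h) + \<eta> * (norm q')\<^sup>2 / 2"
      using J_eq[OF q'] \<eta> unfolding yk H_def by (simp add: power_mult_distrib power2_eq_square)
    have "(norm q')\<^sup>2 \<ge> (norm q)\<^sup>2 + 2 * (q \<bullet> (q' - q))"
      using norm_add_sq[of q "q' - q"] by simp
    then have "\<eta> / 2 * (norm q')\<^sup>2 \<ge> \<eta> / 2 * ((norm q)\<^sup>2 + 2 * (q \<bullet> (q' - q)))"
      using \<eta> by (intro mult_left_mono) auto
    then have "\<eta> * (norm q')\<^sup>2 / 2 \<ge> \<eta> * (norm q)\<^sup>2 / 2 + \<eta> * (q \<bullet> (q' - q))" by (simp add: algebra_simps)
    moreover have "q \<bullet> k = q \<bullet> h + \<eta> * (q \<bullet> (q' - q))" by (simp add: k_def inner_add_right)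
    \<comment> \<open>Half of the 69 of \<open>quadratic_form_perturb\<close>, rounded up.\<close>
    moreover have "34.5 * l * (l * \<eta>) * (norm h)\<^sup>2 \<le> 35 * l * (l * \<eta>) * (norm h)\<^sup>2"
      using l \<eta> by (intro mult_right_mono) auto
    ultimately show "A (z + h) \<le> A z + q \<bullet> h + (h \<bullet> D h) / 2 + (35 * l * (l * \<eta>) + \<kappa>) * (norm h)\<^sup>2"
      using Hk Hyk Hy Dk unfolding distrib_right by linarith
  qed
qed

end

text \<open>A quantitative substitute for the lemmas of Aleksandrov and Jensen: the resolvent turns the
  set of contact points into a set of positive measure on which the Lipschitz map \<open>J\<close> must be
  differentiable somewhere.\<close>
lemma semiconvex_sum_max_principle:
  fixes A B :: "'a::euclidean_space \<Rightarrow> real"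
  assumes exA: "\<And>z. \<exists>q. prox_subgrad l A z q" and exB: "\<And>z. \<exists>q. prox_subgrad l B z q"
    and l: "l > 0" and \<delta>: "\<delta> > 0" and \<kappa>: "\<kappa> > 0"
    and max: "\<And>p. norm p < \<delta> \<Longrightarrow> \<exists>z. \<forall>z'. A z' + B z' - p \<bullet> z' \<le> A z + B z - p \<bullet> z"
  obtains p z q D r where "norm p < \<delta>" "\<And>z'. A z' + B z' - p \<bullet> z' \<le> A z + B z - p \<bullet> z"
    "linear D" "r > 0"
    "\<And>h. norm h < r \<Longrightarrow> A (z + h) \<le> A z + q \<bullet> h + (h \<bullet> D h) / 2 + \<kappa> * (norm h)\<^sup>2"
    "\<And>h. norm h < r \<Longrightarrow> B (z + h) \<le> B z + (p - q) \<bullet> h - (h \<bullet> D h) / 2 + \<kappa> * (norm h)\<^sup>2"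
proof -
  \<comment> \<open>The first bound makes the resolvent 2-Lipschitz, the second brings the error
    \<open>35 * l * (l * \<eta>)\<close> below \<open>\<kappa> / 2\<close>.\<close>
  define \<eta> where "\<eta> = min (1 / (2 * l)) (\<kappa> / (70 * l\<^sup>2))"
  have \<eta>: "\<eta> > 0" "l * \<eta> \<le> 1 / 2" and \<eta>35: "35 * l * (l * \<eta>) \<le> \<kappa> / 2"
  proof -
    show "\<eta> > 0" using l \<kappa> by (simp add: \<eta>_def)
    have "l * \<eta> \<le> l * (1 / (2 * l))" using l by (intro mult_left_mono) (auto simp: \<eta>_def)
    then show "l * \<eta> \<le> 1 / 2" using l by simp
    have "35 * l\<^sup>2 * \<eta> \<le> 35 * l\<^sup>2 * (\<kappa> / (70 * l\<^sup>2))" by (intro mult_left_mono) (auto simp: \<eta>_def)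
    then show "35 * l * (l * \<eta>) \<le> \<kappa> / 2" using l by (simp add: power2_eq_square algebra_simps)
  qed
  interpret moreau A l \<eta> by standard (use exA l \<eta> in auto)
  define Z where "Z p = (SOME z. \<forall>z'. A z' + B z' - p \<bullet> z' \<le> A z + B z - p \<bullet> z)" for p
  have Z: "A z' + B z' - p \<bullet> z' \<le> A (Z p) + B (Z p) - p \<bullet> Z p" if "norm p < \<delta>" for p z'
    using someI_ex[OF max[OF that]] by (auto simp: Z_def)
  define qa where "qa p = (SOME q. prox_subgrad l A (Z p) q)" for p
  define qb where "qb p = (SOME q. prox_subgrad l B (Z p) q)" for p
  have qa: "prox_subgrad l A (Z p) (qa p)" and qb: "prox_subgrad l B (Z p) (qb p)" for p
    using exA exB by (auto simp: qa_def qb_def intro: someI_ex)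
  have u_up: "A (Z p + h) + B (Z p + h) \<le> A (Z p) + B (Z p) + p \<bullet> h" if "norm p < \<delta>" for p h
    using Z[OF that, of "Z p + h"] by (simp add: inner_add_right)
  have u_low: "A (Z p) + B (Z p) + (qa p + qb p) \<bullet> h - l * (norm h)\<^sup>2 \<le> A (Z p + h) + B (Z p + h)" for p h
    using qa[of p, unfolded prox_subgrad_def, rule_format, of h]
      qb[of p, unfolded prox_subgrad_def, rule_format, of h] by (simp add: inner_add_left)
  \<comment> \<open>At a maximum the sum lies below an affine function of slope \<open>p\<close> and
    above a paraboloid of slope \<open>qa p + qb p\<close>; the slopes must coincide.\<close>
  have sum: "qa p + qb p = p" if "norm p < \<delta>" for p
  proof -
    have "(qa p + qb p - p) \<bullet> k \<le> l * ((norm k)\<^sup>2 + 0\<^sup>2)" for k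
      using u_up[OF that, of k] u_low[of p k] by (simp add: inner_diff_left)
    then have "norm (qa p + qb p - p) \<le> 2 * l * 0"
      by (rule norm_le_if_inner_le_quadratic[OF l]) simp
    then show ?thesis by simp
  qed
  have touch: "A (Z p + h) \<le> A (Z p) + qa p \<bullet> h + l / 2 * (norm h)\<^sup>2" if "norm p < \<delta>" for p h
  proof -
    have "qa p \<bullet> h = p \<bullet> h - qb p \<bullet> h" using sum[OF that] by (metis add_diff_cancel_right' inner_diff_left)
    then show ?thesis
      using u_up[OF that, of h] qb[of p, unfolded prox_subgrad_def, rule_format, of h] by linarith
  qed
  define Y where "Y p = Z p + \<eta> *\<^sub>R qa p" for p
  have JY: "J (Y p) = Z p" for p using J_eq[OF qa] by (simp add: Y_def)
  \<comment> \<open>The tilt is the gradient of the sum at the contact point, so two-sided quadratic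
    bounds make it Lipschitz there with constant \<open>2 * l\<close>; the resolvent contributes
    another 2.\<close>
  have lipY: "norm (p - p') \<le> 4 * l * norm (Y p - Y p')" if p: "norm p < \<delta>" "norm p' < \<delta>" for p p'
  proof -
    have "norm (p' - p) \<le> 2 * l * norm (Z p' - Z p)"
    proof (rule norm_le_if_inner_le_quadratic[OF l])
      fix k
      define d where "d = Z p' - Z p"
      have "A (Z p' + k) + B (Z p' + k) \<le> A (Z p) + B (Z p) + p \<bullet> (d + k)"
        using u_up[OF p(1), of "d + k"] by (simp add: d_def)
      moreover have "A (Z p') + B (Z p') + p' \<bullet> k - l * (norm k)\<^sup>2 \<le> A (Z p' + k) + B (Z p' + k)"
        using u_low[of p' k] sum[OF p(2)] by simp
      moreover have "A (Z p) + B (Z p) + p \<bullet> d - l * (norm d)\<^sup>2 \<le> A (Z p') + B (Z p')"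
        using u_low[of p d] sum[OF p(1)] by (simp add: d_def)
      ultimately have "(p' - p) \<bullet> k \<le> l * (norm k)\<^sup>2 + l * (norm d)\<^sup>2"
        by (simp add: inner_diff_left inner_add_right)
      then show "(p' - p) \<bullet> k \<le> l * ((norm k)\<^sup>2 + (norm (Z p' - Z p))\<^sup>2)"
        by (simp add: d_def distrib_left)
    qed simp
    also have "norm (Z p' - Z p) \<le> 2 * norm (Y p' - Y p)"
      using lipschitz_onD[OF J_lipschitz, of "Y p'" "Y p"] by (simp add: JY dist_norm)
    finally show ?thesis using l by (simp add: norm_minus_commute)
  qed
  have "\<exists>p. norm p < \<delta> \<and> J differentiable (at (Y p))"
  proof (rule ccontr)
    assume "\<not> ?thesis"
    then have "Y ` ball 0 \<delta> \<subseteq> {y. \<not> J differentiable (at y)}" by auto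
    then have neg: "negligible (Y ` ball 0 \<delta>)" using rademacher[OF J_lipschitz] negligible_subset by blast
    have inj: "inj_on Y (ball 0 \<delta>)"
      using lipY by (intro inj_onI) (fastforce simp: mem_ball_0)
    define P where "P = inv_into (ball 0 \<delta>) Y"
    have P: "P (Y p) = p" if "norm p < \<delta>" for p using that inj by (simp add: P_def)
    have "negligible (P ` Y ` ball 0 \<delta>)"
    proof (rule negligible_locally_Lipschitz_image[OF _ neg])
      fix x assume "x \<in> Y ` ball 0 \<delta>"
      then show "\<exists>T B. open T \<and> x \<in> T \<and> (\<forall>y\<in>Y ` ball 0 \<delta> \<inter> T. norm (P y - P x) \<le> B * norm (y - x))"
        using lipY by (intro exI[of _ UNIV] exI[of _ "4 * l"]) (auto simp: P)
    qed simp
    moreover have "P ` Y ` ball 0 \<delta> = ball 0 \<delta>" by (force simp: image_image P)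
    ultimately show False using open_not_negligible[of "ball (0::'a) \<delta>"] \<delta> by simp
  qed
  then obtain p where p: "norm p < \<delta>" "J differentiable (at (Z p + \<eta> *\<^sub>R qa p))" by (auto simp: Y_def)
  have "\<kappa> / 2 > 0" using \<kappa> by simp
  from second_order_expansion_at_contact[OF qa touch[OF p(1)] p(2) this]
  obtain D r where D: "linear D" "r > 0"
    "\<And>h. norm h < r \<Longrightarrow> A (Z p) + qa p \<bullet> h + (h \<bullet> D h) / 2 - \<kappa> / 2 * (norm h)\<^sup>2 \<le> A (Z p + h)"
    "\<And>h. norm h < r \<Longrightarrow> A (Z p + h) \<le> A (Z p) + qa p \<bullet> h + (h \<bullet> D h) / 2 + (35 * l * (l * \<eta>) + \<kappa> / 2) * (norm h)\<^sup>2"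
    by blast
  show ?thesis
  proof (rule that[OF p(1) Z[OF p(1)] D(1,2)])
    fix h :: 'a assume h: "norm h < r"
    have "(35 * l * (l * \<eta>) + \<kappa> / 2) * (norm h)\<^sup>2 \<le> \<kappa> * (norm h)\<^sup>2"
      using \<eta>35 by (intro mult_right_mono) auto
    then show "A (Z p + h) \<le> A (Z p) + qa p \<bullet> h + (h \<bullet> D h) / 2 + \<kappa> * (norm h)\<^sup>2"
      using D(4)[OF h] by linarith
    \<comment> \<open>Differentiability is used for \<open>A\<close> alone: the maximum bounds
      \<open>A + B\<close> from above, so the lower expansion of \<open>A\<close> becomes the upper
      one of \<open>B\<close>, with the opposite quadratic form.\<close>
    have "\<kappa> / 2 * (norm h)\<^sup>2 \<le> \<kappa> * (norm h)\<^sup>2" using \<kappa> by (intro mult_right_mono) auto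
    then show "B (Z p + h) \<le> B (Z p) + (p - qa p) \<bullet> h - (h \<bullet> D h) / 2 + \<kappa> * (norm h)\<^sup>2"
      using D(3)[OF h] u_up[OF p(1), of h] by (simp add: inner_diff_left)
  qed
qed

section \<open>Sup-convolutions and doubling of variables\<close>

text \<open>Superlevel sets are required to be closed in the whole space; for closed
  \<open>D\<close> this is upper semicontinuity on \<open>D\<close>, in a form that works directly
  with compactness.\<close>

definition usc_on :: "'a::topological_space set \<Rightarrow> ('a \<Rightarrow> real) \<Rightarrow> bool" where
  "usc_on D a \<longleftrightarrow> (\<forall>c. closed {x\<in>D. c \<le> a x})"

lemma usc_on_eventually_less:
  assumes "usc_on D a" "\<And>n. s n \<in> D" "s \<longlonglongrightarrow> x" "x \<in> D" "e > 0"
  shows "\<forall>\<^sub>F n in sequentially. a (s n) < a x + e"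
proof -
  have "open (- {y\<in>D. a x + e \<le> a y})" using assms(1) by (simp add: usc_on_def open_Compl)
  moreover have "x \<in> - {y\<in>D. a x + e \<le> a y}" using \<open>e > 0\<close> by simp
  ultimately have "\<forall>\<^sub>F n in sequentially. s n \<in> - {y\<in>D. a x + e \<le> a y}"
    using assms(3) topological_tendstoD by blast
  then show ?thesis by eventually_elim (use assms(2) in auto)
qed

lemma usc_on_subset:
  assumes "usc_on D a" "E \<subseteq> D" "closed E"
  shows "usc_on E a"
proof -
  have "{x\<in>E. c \<le> a x} = E \<inter> {x\<in>D. c \<le> a x}" for c using assms(2) by auto
  then show ?thesis using assms by (auto simp: usc_on_def)
qed

lemma usc_on_add:
  fixes D :: "'a::metric_space set"
  assumes a: "usc_on D a" and b: "usc_on D b" and "closed D"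
  shows "usc_on D (\<lambda>x. a x + b x)"
  unfolding usc_on_def closed_sequential_limits
proof (intro allI impI, elim conjE)
  fix c s x assume s: "\<forall>n. s n \<in> {x \<in> D. c \<le> a x + b x}" "s \<longlonglongrightarrow> x"
  then have xD: "x \<in> D" using \<open>closed D\<close> unfolding closed_sequential_limits by blast
  have "c \<le> a x + b x"
  proof (rule field_le_epsilon)
    fix e :: real assume e: "e > 0"
    have "\<forall>\<^sub>F n in sequentially. a (s n) < a x + e / 2" "\<forall>\<^sub>F n in sequentially. b (s n) < b x + e / 2"
      using s xD e by (auto intro!: usc_on_eventually_less[OF a] usc_on_eventually_less[OF b])
    then have "\<forall>\<^sub>F n in sequentially. c \<le> a x + b x + e"
    proof eventually_elim
      case (elim n)
      then show ?case using s(1)[rule_format, of n] by simp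
    qed
    then show "c \<le> a x + b x + e" by simp
  qed
  then show "x \<in> {x \<in> D. c \<le> a x + b x}" using xD by simp
qed

lemma usc_on_add_continuous:
  fixes D :: "'a::metric_space set"
  assumes "usc_on D a" "closed D" "continuous_on UNIV f"
  shows "usc_on D (\<lambda>x. a x + f x)"
proof (rule usc_on_add[OF assms(1) _ assms(2)])
  have "{x\<in>D. c \<le> f x} = D \<inter> {x. c \<le> f x}" for c by auto
  then show "usc_on D f"
    using assms(2,3) by (auto simp: usc_on_def intro!: closed_Int closed_Collect_le continuous_intros)
qed

lemma usc_on_attains_sup:
  fixes D :: "'a::t2_space set"
  assumes usc: "usc_on D a" and "compact D" "D \<noteq> {}"
  obtains x where "x \<in> D" "\<And>y. y \<in> D \<Longrightarrow> a y \<le> a x"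
proof -
  have "\<exists>x\<in>D. \<forall>y\<in>D. a y \<le> a x"
  proof (rule ccontr)
    assume neg: "\<not> ?thesis"
    have "D \<subseteq> (\<Union>y\<in>D. - {x\<in>D. a y \<le> a x})"
    proof
      fix x assume "x \<in> D"
      then obtain y where "y \<in> D" "\<not> a y \<le> a x" using neg by blast
      then show "x \<in> (\<Union>y\<in>D. - {x\<in>D. a y \<le> a x})" by auto
    qed
    moreover have "open (- {x\<in>D. a y \<le> a x})" for y using usc by (simp add: usc_on_def open_Compl)
    ultimately obtain C where C: "C \<subseteq> D" "finite C" "D \<subseteq> (\<Union>y\<in>C. - {x\<in>D. a y \<le> a x})"
      using compactE_image[OF \<open>compact D\<close>, of D "\<lambda>y. - {x\<in>D. a y \<le> a x}"] by auto
    have "C \<noteq> {}" using C(3) \<open>D \<noteq> {}\<close> by auto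
    then have "Max (a ` C) \<in> a ` C" using C(2) by (intro Max_in) auto
    then obtain y where "y \<in> C" "a y = Max (a ` C)" by force
    then have y: "y \<in> C" "\<And>z. z \<in> C \<Longrightarrow> a z \<le> a y" using C(2) by auto
    then have "y \<in> (\<Union>z\<in>C. - {x\<in>D. a z \<le> a x})" using C by blast
    then show False using y C(1) by auto
  qed
  then show ?thesis using that by blast
qed

section \<open>Sup-convolutions\<close>

text \<open>The supremum is attained on a compact set, so a maximiser is chosen first and the value
  read off from it; the maximiser is the point of the original function to which expansions are
  transferred.\<close>

definition supconv_arg :: "real \<Rightarrow> 'a::euclidean_space set \<Rightarrow> ('a \<Rightarrow> real) \<Rightarrow> 'a \<Rightarrow> 'a" where
  "supconv_arg \<epsilon> D a z = (SOME x. x \<in> D \<and>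
     (\<forall>y\<in>D. a y - (norm (y - z))\<^sup>2 / (2 * \<epsilon>) \<le> a x - (norm (x - z))\<^sup>2 / (2 * \<epsilon>)))"

definition supconv :: "real \<Rightarrow> 'a::euclidean_space set \<Rightarrow> ('a \<Rightarrow> real) \<Rightarrow> 'a \<Rightarrow> real" where
  "supconv \<epsilon> D a z = a (supconv_arg \<epsilon> D a z) - (norm (supconv_arg \<epsilon> D a z - z))\<^sup>2 / (2 * \<epsilon>)"

locale supconv_setup =
  fixes \<epsilon> :: real and D :: "'a::euclidean_space set" and a :: "'a \<Rightarrow> real"
  assumes \<epsilon>: "\<epsilon> > 0" and D: "compact D" "D \<noteq> {}" and usc: "usc_on D a"
begin

lemma supconv_arg:
  "supconv_arg \<epsilon> D a z \<in> D \<and> (\<forall>y\<in>D. a y - (norm (y - z))\<^sup>2 / (2 * \<epsilon>) \<le> supconv \<epsilon> D a z)"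
  unfolding supconv_def supconv_arg_def
proof (rule someI_ex)
  have "usc_on D (\<lambda>x. a x + - ((norm (x - z))\<^sup>2 / (2 * \<epsilon>)))"
    using \<epsilon> by (intro usc_on_add_continuous usc compact_imp_closed D continuous_intros) auto
  from usc_on_attains_sup[OF this D] show "\<exists>x. x \<in> D \<and>
     (\<forall>y\<in>D. a y - (norm (y - z))\<^sup>2 / (2 * \<epsilon>) \<le> a x - (norm (x - z))\<^sup>2 / (2 * \<epsilon>))"
    by (metis uminus_add_conv_diff add.commute)
qed

lemma supconv_arg_in: "supconv_arg \<epsilon> D a z \<in> D"
  using supconv_arg by blast

lemma supconv_ge: "x \<in> D \<Longrightarrow> a x - (norm (x - z))\<^sup>2 / (2 * \<epsilon>) \<le> supconv \<epsilon> D a z"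
  using supconv_arg by blast

text \<open>Freezing the maximiser gives a paraboloid of opening \<open>1 / \<epsilon>\<close> that
  touches the sup-convolution from below at \<open>z\<close>.\<close>

lemma supconv_prox_subgrad: "\<exists>q. prox_subgrad (1 / \<epsilon>) (supconv \<epsilon> D a) z q"
proof -
  define x where "x = supconv_arg \<epsilon> D a z"
  have "prox_subgrad (1 / \<epsilon>) (supconv \<epsilon> D a) z ((x - z) /\<^sub>R \<epsilon>)"
    unfolding prox_subgrad_def
  proof
    fix h
    have "a x - (norm (x - (z + h)))\<^sup>2 / (2 * \<epsilon>) \<le> supconv \<epsilon> D a (z + h)"
      unfolding x_def by (intro supconv_ge supconv_arg_in)
    moreover have "(norm (x - (z + h)))\<^sup>2 = (norm (x - z))\<^sup>2 - 2 * ((x - z) \<bullet> h) + (norm h)\<^sup>2"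
      using norm_diff_sq[of "x - z" h] by (simp add: algebra_simps)
    then have "(norm (x - (z + h)))\<^sup>2 / (2 * \<epsilon>) = (norm (x - z))\<^sup>2 / (2 * \<epsilon>) - ((x - z) \<bullet> h) / \<epsilon> + (norm h)\<^sup>2 / (2 * \<epsilon>)"
      by (simp add: add_divide_distrib diff_divide_distrib)
    moreover have "((x - z) /\<^sub>R \<epsilon>) \<bullet> h = ((x - z) \<bullet> h) / \<epsilon>" using \<epsilon> by (simp add: divide_inverse mult.commute)
    moreover have "supconv \<epsilon> D a z = a x - (norm (x - z))\<^sup>2 / (2 * \<epsilon>)" by (simp add: supconv_def x_def)
    ultimately show "supconv \<epsilon> D a z + ((x - z) /\<^sub>R \<epsilon>) \<bullet> h - 1 / \<epsilon> / 2 * (norm h)\<^sup>2 \<le> supconv \<epsilon> D a (z + h)"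
      by simp
  qed
  then show ?thesis by blast
qed

lemma supconv_le:
  obtains M b where "\<And>z. supconv \<epsilon> D a z \<le> M + b * norm z - (norm z)\<^sup>2 / (2 * \<epsilon>)"
proof -
  obtain M where M: "\<And>x. x \<in> D \<Longrightarrow> a x \<le> M" using usc_on_attains_sup[OF usc D] by metis
  obtain \<rho> where \<rho>: "\<And>x. x \<in> D \<Longrightarrow> norm x \<le> \<rho>" using compact_imp_bounded[OF D(1)] by (auto simp: bounded_iff)
  have "supconv \<epsilon> D a z \<le> M + (\<rho> / \<epsilon>) * norm z - (norm z)\<^sup>2 / (2 * \<epsilon>)" for z
  proof -
    define x where "x = supconv_arg \<epsilon> D a z"
    have x: "x \<in> D" unfolding x_def by (rule supconv_arg_in)
    have "x \<bullet> z \<le> norm x * norm z" by (rule norm_cauchy_schwarz)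
    also have "\<dots> \<le> \<rho> * norm z" using \<rho>[OF x] by (intro mult_right_mono) auto
    finally have "(norm z)\<^sup>2 - 2 * (\<rho> * norm z) \<le> (norm (x - z))\<^sup>2"
      using zero_le_power2[of "norm x"] unfolding norm_diff_sq by linarith
    then have "((norm z)\<^sup>2 - 2 * (\<rho> * norm z)) / (2 * \<epsilon>) \<le> (norm (x - z))\<^sup>2 / (2 * \<epsilon>)"
      using \<epsilon> by (intro divide_right_mono) auto
    then have "(norm z)\<^sup>2 / (2 * \<epsilon>) - (\<rho> / \<epsilon>) * norm z \<le> (norm (x - z))\<^sup>2 / (2 * \<epsilon>)"
      by (simp add: diff_divide_distrib)
    then show ?thesis using M[OF x] by (simp add: supconv_def x_def)
  qed
  then show ?thesis by (rule that)
qed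

text \<open>Translating the maximiser and \<open>z\<close> together leaves the penalty unchanged, so
  an upper expansion at \<open>z\<close> passes to \<open>a\<close> at the maximiser with the same
  linear and quadratic parts.\<close>

lemma supconv_touch:
  assumes le: "\<And>h. norm h < r \<Longrightarrow> supconv \<epsilon> D a (z + h) \<le> supconv \<epsilon> D a z + g h"
    and "norm h < r" "supconv_arg \<epsilon> D a z + h \<in> D"
  shows "a (supconv_arg \<epsilon> D a z + h) \<le> a (supconv_arg \<epsilon> D a z) + g h"
  using supconv_ge[OF assms(3), of "z + h"] le[OF assms(2)] by (simp add: supconv_def)

end

text \<open>The two variables are coupled through a third point \<open>z\<close>: maximising over it
  makes both sup-convolutions depend on one variable, and for \<open>p = 0\<close> eliminating
  \<open>z\<close> gives the usual penalty \<open>|x - y|^2 / (4 * \<epsilon>)\<close>. One form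
  \<open>T\<close> then serves both functions with opposite signs, which replaces the matrix
  inequality of the usual doubling argument.\<close>

lemma sum_max_principle:
  fixes a b :: "'a::euclidean_space \<Rightarrow> real"
  assumes D1: "compact D1" "D1 \<noteq> {}" "usc_on D1 a" and D2: "compact D2" "D2 \<noteq> {}" "usc_on D2 b"
    and \<epsilon>: "\<epsilon> > 0" and \<delta>: "\<delta> > 0" and \<kappa>: "\<kappa> > 0"
  obtains p z x y q T r where "norm p < \<delta>" "x \<in> D1" "y \<in> D2"
    "\<And>x' y' z'. x' \<in> D1 \<Longrightarrow> y' \<in> D2 \<Longrightarrow>
       a x' + b y' - ((norm (x' - z'))\<^sup>2 + (norm (y' - z'))\<^sup>2) / (2 * \<epsilon>) - p \<bullet> z'
       \<le> a x + b y - ((norm (x - z))\<^sup>2 + (norm (y - z))\<^sup>2) / (2 * \<epsilon>) - p \<bullet> z"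
    "linear T" "r > 0"
    "\<And>h. norm h < r \<Longrightarrow> x + h \<in> D1 \<Longrightarrow> a (x + h) \<le> a x + q \<bullet> h + (h \<bullet> T h) / 2 + \<kappa> * (norm h)\<^sup>2"
    "\<And>h. norm h < r \<Longrightarrow> y + h \<in> D2 \<Longrightarrow> b (y + h) \<le> b y + (p - q) \<bullet> h - (h \<bullet> T h) / 2 + \<kappa> * (norm h)\<^sup>2"
proof -
  interpret A: supconv_setup \<epsilon> D1 a by standard (use D1 \<epsilon> in auto)
  interpret B: supconv_setup \<epsilon> D2 b by standard (use D2 \<epsilon> in auto)
  let ?A = "supconv \<epsilon> D1 a" and ?B = "supconv \<epsilon> D2 b"
  have max: "\<exists>z. \<forall>z'. ?A z' + ?B z' - p \<bullet> z' \<le> ?A z + ?B z - p \<bullet> z" for p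
  proof -
    define f where "f = (\<lambda>z. - (?A z + ?B z - p \<bullet> z))"
    have cont: "continuous_on UNIV f"
      unfolding f_def
      by (intro continuous_intros semiconvex_imp_continuous[OF A.supconv_prox_subgrad]
        semiconvex_imp_continuous[OF B.supconv_prox_subgrad])
    obtain MA bA where A: "\<And>z. ?A z \<le> MA + bA * norm z - (norm z)\<^sup>2 / (2 * \<epsilon>)" using A.supconv_le by blast
    obtain MB bB where B: "\<And>z. ?B z \<le> MB + bB * norm z - (norm z)\<^sup>2 / (2 * \<epsilon>)" using B.supconv_le by blast
    have "f 0 + (1 / \<epsilon>) * (norm z)\<^sup>2 - (bA + bB + norm p) * norm z - (f 0 + MA + MB) \<le> f z" for z
    proof -
      have "- (norm p * norm z) \<le> p \<bullet> z" using Cauchy_Schwarz_ineq2[of p z] by linarith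
      then show ?thesis using A[of z] B[of z] by (simp add: f_def algebra_simps)
    qed
    then obtain z where z: "\<And>z'. f z \<le> f z'"
      using continuous_coercive_attains_inf[OF cont, of "1 / \<epsilon>"] \<epsilon> by (metis zero_less_divide_1_iff)
    have "?A z' + ?B z' - p \<bullet> z' \<le> ?A z + ?B z - p \<bullet> z" for z'
      using z[of z'] unfolding f_def by linarith
    then show ?thesis by blast
  qed
  obtain p z q T r where *: "norm p < \<delta>" "\<And>z'. ?A z' + ?B z' - p \<bullet> z' \<le> ?A z + ?B z - p \<bullet> z"
    "linear T" "r > 0"
    "\<And>h. norm h < r \<Longrightarrow> ?A (z + h) \<le> ?A z + q \<bullet> h + (h \<bullet> T h) / 2 + \<kappa> * (norm h)\<^sup>2"
    "\<And>h. norm h < r \<Longrightarrow> ?B (z + h) \<le> ?B z + (p - q) \<bullet> h - (h \<bullet> T h) / 2 + \<kappa> * (norm h)\<^sup>2"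
    by (rule semiconvex_sum_max_principle[OF A.supconv_prox_subgrad B.supconv_prox_subgrad _ \<delta> \<kappa> max])
      (use \<epsilon> in simp, blast)
  let ?x = "supconv_arg \<epsilon> D1 a z" and ?y = "supconv_arg \<epsilon> D2 b z"
  show ?thesis
  proof (rule that[OF *(1) A.supconv_arg_in[of z] B.supconv_arg_in[of z] _ *(3,4)])
    fix x' y' z' assume "x' \<in> D1" "y' \<in> D2"
    then show "a x' + b y' - ((norm (x' - z'))\<^sup>2 + (norm (y' - z'))\<^sup>2) / (2 * \<epsilon>) - p \<bullet> z'
       \<le> a (?x) + b (?y)
        - ((norm (?x - z))\<^sup>2 + (norm (?y - z))\<^sup>2) / (2 * \<epsilon>) - p \<bullet> z"
      using A.supconv_ge[of x' z'] B.supconv_ge[of y' z'] *(2)[of z']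
      by (simp add: supconv_def add_divide_distrib)
  next
    fix h assume "norm h < r" "?x + h \<in> D1"
    from A.supconv_touch[OF _ this, of "\<lambda>h. q \<bullet> h + (h \<bullet> T h) / 2 + \<kappa> * (norm h)\<^sup>2"]
    show "a (?x + h) \<le> a (?x) + q \<bullet> h + (h \<bullet> T h) / 2 + \<kappa> * (norm h)\<^sup>2"
      using *(5) by (simp add: add.assoc)
  next
    fix h assume "norm h < r" "?y + h \<in> D2"
    from B.supconv_touch[OF _ this, of "\<lambda>h. (p - q) \<bullet> h - (h \<bullet> T h) / 2 + \<kappa> * (norm h)\<^sup>2"]
    show "b (?y + h) \<le> b (?y) + (p - q) \<bullet> h - (h \<bullet> T h) / 2 + \<kappa> * (norm h)\<^sup>2"
      using *(6) by (simp add: algebra_simps)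
  qed
qed

text \<open>Penalty parameter, tilt and second-order error tend to 0 together along
  \<open>e n\<close>. Comparison with the diagonal point \<open>x0\<close> bounds the penalty, so
  the doubled points merge; upper semicontinuity controls their values in the limit.\<close>

lemma doubling_limit:
  fixes a b :: "'a::euclidean_space \<Rightarrow> real"
  assumes D1: "compact D1" "usc_on D1 a" and D2: "compact D2" "usc_on D2 b"
    and x0: "x0 \<in> D1" "x0 \<in> D2"
  obtains x1 where "x1 \<in> D1" "x1 \<in> D2" "a x0 + b x0 \<le> a x1 + b x1"
    "\<And>\<rho>. \<rho> > 0 \<Longrightarrow> \<exists>p x y q T r. norm p < \<rho> \<and> x \<in> D1 \<and> y \<in> D2 \<and> norm (x - x1) < \<rho> \<and> norm (y - x1) < \<rho> \<and>
      a x < a x1 + \<rho> \<and> b y < b x1 + \<rho> \<and> a x0 + b x0 - \<rho> < a x + b y \<and> linear T \<and> r > 0 \<and>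
      (\<forall>h. norm h < r \<longrightarrow> x + h \<in> D1 \<longrightarrow> a (x + h) \<le> a x + q \<bullet> h + (h \<bullet> T h) / 2 + \<rho> * (norm h)\<^sup>2) \<and>
      (\<forall>h. norm h < r \<longrightarrow> y + h \<in> D2 \<longrightarrow> b (y + h) \<le> b y + (p - q) \<bullet> h - (h \<bullet> T h) / 2 + \<rho> * (norm h)\<^sup>2)"
proof -
  define e where "e n = 1 / real (Suc n)" for n
  have e: "e n > 0" "e n \<le> 1" for n by (auto simp: e_def)
  have e0: "e \<longlonglongrightarrow> 0" unfolding e_def by (rule LIMSEQ_Suc[OF lim_1_over_n, unfolded])
  have ne: "D1 \<noteq> {}" "D2 \<noteq> {}" using x0 by auto
  define Q where "Q n p z x y q T r \<longleftrightarrow> norm p < e n \<and> x \<in> D1 \<and> y \<in> D2 \<and>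
    (\<forall>x'\<in>D1. \<forall>y'\<in>D2. \<forall>z'. 
       a x' + b y' - ((norm (x' - z'))\<^sup>2 + (norm (y' - z'))\<^sup>2) / (2 * e n) - p \<bullet> z'
       \<le> a x + b y - ((norm (x - z))\<^sup>2 + (norm (y - z))\<^sup>2) / (2 * e n) - p \<bullet> z) \<and> linear T \<and> r > 0 \<and>
      (\<forall>h. norm h < r \<longrightarrow> x + h \<in> D1 \<longrightarrow> a (x + h) \<le> a x + q \<bullet> h + (h \<bullet> T h) / 2 + e n * (norm h)\<^sup>2) \<and>
      (\<forall>h. norm h < r \<longrightarrow> y + h \<in> D2 \<longrightarrow> b (y + h) \<le> b y + (p - q) \<bullet> h - (h \<bullet> T h) / 2 + e n * (norm h)\<^sup>2)"
    for n p z x y q T and r :: real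
  have "\<exists>p z x y q T r. Q n p z x y q T r" for n
    using sum_max_principle[OF D1(1) ne(1) D1(2) D2(1) ne(2) D2(2) e(1) e(1) e(1), of n n n]
    unfolding Q_def by (metis (no_types, lifting))
  then obtain p z x y q T r where Q: "\<And>n. Q n (p n) (z n) (x n) (y n) (q n) (T n) (r n)" by metis
  have xy: "x n \<in> D1" "y n \<in> D2" "norm (p n) < e n" for n using Q[of n] by (auto simp: Q_def)
  obtain MA where MA: "\<And>x. x \<in> D1 \<Longrightarrow> a x \<le> MA" using usc_on_attains_sup[OF D1(2,1) ne(1)] by metis
  obtain MB where MB: "\<And>x. x \<in> D2 \<Longrightarrow> b x \<le> MB" using usc_on_attains_sup[OF D2(2,1) ne(2)] by metis
  obtain d where d: "\<And>x. x \<in> D1 \<Longrightarrow> norm (x0 - x) \<le> d"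
    using compact_imp_bounded[OF D1(1)] bounded_minus[of "{x0}" D1] unfolding bounded_iff by fastforce
  have d0: "d \<ge> 0" using d[OF x0(1)] by simp
  \<comment> \<open>The constant that results when the tilt term in the bound for the squared
    distances is absorbed by Young's inequality, half of these squares moving to the left.\<close>
  define K where "K = 4 * (MA + MB - a x0 - b x0 + d) + 4"
  have M0: "MA + MB - a x0 - b x0 \<ge> 0" using MA[OF x0(1)] MB[OF x0(2)] by simp
  have K: "K \<ge> 4" using M0 d0 by (simp add: K_def)
  \<comment> \<open>The competitor is \<open>x0\<close> in all three places, where the penalty
    vanishes.\<close>
  have key: "a x0 + b x0 + ((norm (x n - z n))\<^sup>2 + (norm (y n - z n))\<^sup>2) / (2 * e n) - norm (p n) * norm (x0 - z n) \<le> a (x n) + b (y n)" for n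
  proof -
    have "a x0 + b x0 - p n \<bullet> x0 \<le> a (x n) + b (y n) - ((norm (x n - z n))\<^sup>2 + (norm (y n - z n))\<^sup>2) / (2 * e n) - p n \<bullet> z n"
      using Q[of n] x0 unfolding Q_def by (elim conjE) (drule bspec[OF _ x0(1)], drule bspec[OF _ x0(2)], drule spec[of _ x0], simp)
    moreover have "p n \<bullet> (x0 - z n) \<le> norm (p n) * norm (x0 - z n)" by (rule norm_cauchy_schwarz)
    ultimately show ?thesis by (simp add: inner_diff_right)
  qed
  have px: "norm (p n) * norm (x0 - z n) \<le> e n * (d + norm (x n - z n))" for n
  proof (intro mult_mono)
    show "norm (x0 - z n) \<le> d + norm (x n - z n)"
      using norm_triangle_ineq[of "x0 - x n" "x n - z n"] d[OF xy(1)[of n]] by simp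
  qed (use xy[of n] e[of n] in auto)
  have sq: "(norm (x n - z n))\<^sup>2 + (norm (y n - z n))\<^sup>2 \<le> e n * K" for n
  proof -
    define t where "t = norm (x n - z n)"
    define s where "s = (norm (x n - z n))\<^sup>2 + (norm (y n - z n))\<^sup>2"
    have ts: "t\<^sup>2 \<le> s" by (simp add: t_def s_def)
    have "s / (2 * e n) \<le> MA + MB - a x0 - b x0 + e n * (d + t)"
      using key[of n] px[of n] MA[OF xy(1)[of n]] MB[OF xy(2)[of n]] by (simp add: s_def t_def)
    also have "e n * (d + t) \<le> d + e n * t" using e[of n] d0 by (simp add: distrib_left mult_left_le_one_le)
    finally have "s / (2 * e n) * (2 * e n) \<le> (MA + MB - a x0 - b x0 + (d + e n * t)) * (2 * e n)"
      using e[of n] by (intro mult_right_mono) auto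
    then have 1: "s \<le> 2 * e n * (MA + MB - a x0 - b x0 + d) + 2 * (e n)\<^sup>2 * t"
      using e[of n] by (simp add: power2_eq_square algebra_simps)
    have "2 * (e n)\<^sup>2 * t \<le> 2 * e n * t"
      using e[of n] by (intro mult_right_mono) (auto simp: t_def power2_eq_square mult_left_le_one_le)
    moreover have "4 * (t * e n) \<le> t\<^sup>2 + 4 * (e n)\<^sup>2"
      using zero_le_power2[of "t - 2 * e n"] by (simp add: power2_diff power_mult_distrib)
    moreover have "4 * (t * e n) = 2 * (2 * e n * t)" by simp
    moreover have "(e n)\<^sup>2 \<le> e n" using e[of n] by (simp add: power2_eq_square mult_left_le_one_le)
    ultimately have "s / 2 \<le> 2 * e n * (MA + MB - a x0 - b x0 + d) + 2 * e n" using 1 ts by linarith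
    then have "s \<le> e n * K" unfolding K_def by (simp add: algebra_simps)
    then show ?thesis by (simp add: s_def)
  qed
  have lim: "(\<lambda>n. sqrt (e n * K)) \<longlonglongrightarrow> 0"
    using tendsto_real_sqrt[OF tendsto_mult[OF e0 tendsto_const[of K]]] by simp
  have nx: "norm (x n - z n) \<le> sqrt (e n * K)" and ny: "norm (y n - z n) \<le> sqrt (e n * K)" for n
  proof -
    have "(norm (x n - z n))\<^sup>2 \<le> e n * K" "(norm (y n - z n))\<^sup>2 \<le> e n * K"
      using sq[of n] zero_le_power2[of "norm (x n - z n)"] zero_le_power2[of "norm (y n - z n)"] by linarith+
    then show "norm (x n - z n) \<le> sqrt (e n * K)" "norm (y n - z n) \<le> sqrt (e n * K)"
      using real_le_rsqrt by blast+
  qed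
  obtain x1 \<sigma> where x1: "x1 \<in> D1" "strict_mono \<sigma>" "(x \<circ> \<sigma>) \<longlonglongrightarrow> x1"
    using D1(1) xy(1) unfolding compact_def by blast
  have lim\<sigma>: "(\<lambda>n. sqrt (e (\<sigma> n) * K)) \<longlonglongrightarrow> 0"
    using LIMSEQ_subseq_LIMSEQ[OF lim x1(2)] by (simp add: o_def)
  have e\<sigma>: "(\<lambda>n. e (\<sigma> n)) \<longlonglongrightarrow> 0"
    using LIMSEQ_subseq_LIMSEQ[OF e0 x1(2)] by (simp add: o_def)
  have xs: "(\<lambda>n. x (\<sigma> n)) \<longlonglongrightarrow> x1" using x1(3) by (simp add: o_def)
  have "(\<lambda>n. y (\<sigma> n) - x (\<sigma> n)) \<longlonglongrightarrow> 0"
  proof (rule Lim_null_comparison)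
    have "norm (y n - x n) \<le> 2 * sqrt (e n * K)" for n
      using norm_triangle_ineq4[of "y n - z n" "x n - z n"] nx[of n] ny[of n] by simp
    then show "\<forall>\<^sub>F n in sequentially. norm (y (\<sigma> n) - x (\<sigma> n)) \<le> 2 * sqrt (e (\<sigma> n) * K)" by simp
    show "(\<lambda>n. 2 * sqrt (e (\<sigma> n) * K)) \<longlonglongrightarrow> 0" using tendsto_mult[OF tendsto_const lim\<sigma>, of 2] by simp
  qed
  from tendsto_add[OF this xs] have ys: "(\<lambda>n. y (\<sigma> n)) \<longlonglongrightarrow> x1" by simp
  have x1D2: "x1 \<in> D2"
    using closed_sequentially[OF compact_imp_closed[OF D2(1)] _ ys] xy(2) by simp
  have small: "\<forall>\<^sub>F n in sequentially. norm (p (\<sigma> n)) * norm (x0 - z (\<sigma> n)) < \<rho>" if "\<rho> > 0" for \<rho>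
  proof -
    have "(\<lambda>n. e (\<sigma> n) * (d + sqrt (e (\<sigma> n) * K))) \<longlonglongrightarrow> 0 * (d + 0)"
      by (intro tendsto_intros e\<sigma> lim\<sigma>)
    then have "\<forall>\<^sub>F n in sequentially. e (\<sigma> n) * (d + sqrt (e (\<sigma> n) * K)) < \<rho>"
      using order_tendstoD(2) that by fastforce
    then show ?thesis
    proof eventually_elim
      case (elim n)
      have "e (\<sigma> n) * (d + norm (x (\<sigma> n) - z (\<sigma> n))) \<le> e (\<sigma> n) * (d + sqrt (e (\<sigma> n) * K))"
        using nx[of "\<sigma> n"] e[of "\<sigma> n"] by (intro mult_left_mono) auto
      then show ?case using px[of "\<sigma> n"] elim by linarith
    qed
  qed
  have lower: "\<forall>\<^sub>F n in sequentially. a x0 + b x0 - \<rho> < a (x (\<sigma> n)) + b (y (\<sigma> n))" if "\<rho> > 0" for \<rho>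
    using small[OF that]
  proof eventually_elim
    case (elim n)
    have "((norm (x (\<sigma> n) - z (\<sigma> n)))\<^sup>2 + (norm (y (\<sigma> n) - z (\<sigma> n)))\<^sup>2) / (2 * e (\<sigma> n)) \<ge> 0"
      using e[of "\<sigma> n"] by simp
    then show ?case using key[of "\<sigma> n"] elim by linarith
  qed
  have ua: "\<forall>\<^sub>F n in sequentially. a (x (\<sigma> n)) < a x1 + \<rho>" if "\<rho> > 0" for \<rho>
    using usc_on_eventually_less[OF D1(2) _ xs x1(1) that] xy by blast
  have ub: "\<forall>\<^sub>F n in sequentially. b (y (\<sigma> n)) < b x1 + \<rho>" if "\<rho> > 0" for \<rho>
    using usc_on_eventually_less[OF D2(2) _ ys x1D2 that] xy by blast
  show ?thesis
  proof (rule that[OF x1(1) x1D2])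
    show "a x0 + b x0 \<le> a x1 + b x1"
    proof (rule field_le_epsilon)
      fix \<rho> :: real assume "\<rho> > 0"
      then have \<rho>3: "\<rho> / 3 > 0" by simp
      have "\<forall>\<^sub>F n in sequentially. a x0 + b x0 \<le> a x1 + b x1 + \<rho>"
        using lower[OF \<rho>3] ua[OF \<rho>3] ub[OF \<rho>3] by eventually_elim linarith
      then show "a x0 + b x0 \<le> a x1 + b x1 + \<rho>" by simp
    qed
    fix \<rho> :: real assume \<rho>: "\<rho> > 0"
    have "\<forall>\<^sub>F n in sequentially. norm (x (\<sigma> n) - x1) < \<rho>" "\<forall>\<^sub>F n in sequentially. norm (y (\<sigma> n) - x1) < \<rho>"
      using tendstoD[OF xs \<rho>] tendstoD[OF ys \<rho>] by (simp_all add: dist_norm)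
    moreover have "\<forall>\<^sub>F n in sequentially. e (\<sigma> n) < \<rho>" using order_tendstoD(2)[OF e\<sigma> \<rho>] .
    ultimately have "\<forall>\<^sub>F n in sequentially. norm (x (\<sigma> n) - x1) < \<rho> \<and> norm (y (\<sigma> n) - x1) < \<rho> \<and> e (\<sigma> n) < \<rho> \<and>
       a (x (\<sigma> n)) < a x1 + \<rho> \<and> b (y (\<sigma> n)) < b x1 + \<rho> \<and> a x0 + b x0 - \<rho> < a (x (\<sigma> n)) + b (y (\<sigma> n))"
      using lower[OF \<rho>] ua[OF \<rho>] ub[OF \<rho>] by eventually_elim simp
    then obtain n where n: "norm (x (\<sigma> n) - x1) < \<rho>" "norm (y (\<sigma> n) - x1) < \<rho>" "e (\<sigma> n) < \<rho>"
       "a (x (\<sigma> n)) < a x1 + \<rho>" "b (y (\<sigma> n)) < b x1 + \<rho>" "a x0 + b x0 - \<rho> < a (x (\<sigma> n)) + b (y (\<sigma> n))"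
      by (auto dest: eventually_happens)
    have em: "e (\<sigma> n) * (norm h)\<^sup>2 \<le> \<rho> * (norm h)\<^sup>2" for h :: 'a
      using n(3) by (intro mult_right_mono) auto
    have "norm (p (\<sigma> n)) < \<rho>" using xy(3)[of "\<sigma> n"] n(3) by linarith
    moreover have "a (x (\<sigma> n) + h) \<le> a (x (\<sigma> n)) + q (\<sigma> n) \<bullet> h + (h \<bullet> T (\<sigma> n) h) / 2 + \<rho> * (norm h)\<^sup>2"
      if "norm h < r (\<sigma> n)" "x (\<sigma> n) + h \<in> D1" for h
      using Q[of "\<sigma> n"] em[of h] that unfolding Q_def by (meson add_left_mono order_trans)
    moreover have "b (y (\<sigma> n) + h) \<le> b (y (\<sigma> n)) + (p (\<sigma> n) - q (\<sigma> n)) \<bullet> h - (h \<bullet> T (\<sigma> n) h) / 2 + \<rho> * (norm h)\<^sup>2"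
      if "norm h < r (\<sigma> n)" "y (\<sigma> n) + h \<in> D2" for h
      using Q[of "\<sigma> n"] em[of h] that unfolding Q_def by (meson add_left_mono order_trans)
    moreover have "linear (T (\<sigma> n))" "r (\<sigma> n) > 0" using Q[of "\<sigma> n"] by (auto simp: Q_def)
    ultimately show "\<exists>p x y q T r. norm p < \<rho> \<and> x \<in> D1 \<and> y \<in> D2 \<and> norm (x - x1) < \<rho> \<and> norm (y - x1) < \<rho> \<and>
      a x < a x1 + \<rho> \<and> b y < b x1 + \<rho> \<and> a x0 + b x0 - \<rho> < a x + b y \<and> linear T \<and> r > 0 \<and>
      (\<forall>h. norm h < r \<longrightarrow> x + h \<in> D1 \<longrightarrow> a (x + h) \<le> a x + q \<bullet> h + (h \<bullet> T h) / 2 + \<rho> * (norm h)\<^sup>2) \<and>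
      (\<forall>h. norm h < r \<longrightarrow> y + h \<in> D2 \<longrightarrow> b (y + h) \<le> b y + (p - q) \<bullet> h - (h \<bullet> T h) / 2 + \<rho> * (norm h)\<^sup>2)"
      using n xy by (intro exI[of _ "p (\<sigma> n)"] exI[of _ "x (\<sigma> n)"] exI[of _ "y (\<sigma> n)"] exI[of _ "q (\<sigma> n)"]
        exI[of _ "T (\<sigma> n)"] exI[of _ "r (\<sigma> n)"]) auto
  qed
qed

section \<open>Consequences of the structure conditions\<close>

lemma locally_lipschitz_on_compact:
  fixes f :: "'a::metric_space \<Rightarrow> 'b::metric_space"
  assumes ll: "locally_lipschitz_on S f" and "compact X" "X \<subseteq> S"
  obtains K where "K-lipschitz_on X f"
proof -
  \<comment> \<open>A time-dependent notion, used with the single time 0.\<close>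
  have "local_lipschitz {0::real} X (\<lambda>_. f)"
    unfolding local_lipschitz_def
  proof (intro ballI)
    fix x and t :: real assume "x \<in> X" "t \<in> {0}"
    then obtain r K where r: "r > 0" "K-lipschitz_on (ball x r \<inter> S) f"
      using ll \<open>X \<subseteq> S\<close> unfolding locally_lipschitz_on_def by blast
    have "K-lipschitz_on (cball x (r / 2) \<inter> X) f"
      by (rule lipschitz_on_subset[OF r(2)]) (use r(1) \<open>X \<subseteq> S\<close> in auto)
    then show "\<exists>u>0. \<exists>L. \<forall>t\<in>cball t u \<inter> {0}. L-lipschitz_on (cball x u \<inter> X) f"
      using r(1) by (intro exI[of _ "r / 2"]) auto
  qed
  then obtain L where "\<And>t. t \<in> {0::real} \<Longrightarrow> L-lipschitz_on X f"
    by (rule local_lipschitz_compact_implies_lipschitz) (use \<open>compact X\<close> in auto)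
  then show ?thesis using that by blast
qed

lemma locally_lipschitz_on_compose_path:
  fixes f :: "'a::metric_space \<Rightarrow> 'b::metric_space" and \<gamma> :: "real \<Rightarrow> 'a"
  assumes ll: "locally_lipschitz_on S f" and \<gamma>: "C-lipschitz_on {a..b} \<gamma>" "\<gamma> ` {a..b} \<subseteq> S"
  obtains K where "K-lipschitz_on {a..b} (\<lambda>t. f (\<gamma> t))"
proof -
  have "compact (\<gamma> ` {a..b})"
    by (intro compact_continuous_image lipschitz_on_continuous_on[OF \<gamma>(1)] compact_Icc)
  then obtain K where "K-lipschitz_on (\<gamma> ` {a..b}) f"
    using locally_lipschitz_on_compact[OF ll _ \<gamma>(2)] by blast
  then show ?thesis using lipschitz_on_compose2[OF \<gamma>(1)] that by blast
qed

lemma lipschitz_on_mult_compact: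
  fixes f g :: "real \<Rightarrow> real"
  assumes f: "C-lipschitz_on {a..b} f" and g: "D-lipschitz_on {a..b} g"
  obtains K where "K-lipschitz_on {a..b} (\<lambda>t. f t * g t)"
proof -
  have "bounded (f ` {a..b})" "bounded (g ` {a..b})"
    by (intro compact_imp_bounded compact_continuous_image lipschitz_on_continuous_on[OF f]
        lipschitz_on_continuous_on[OF g] compact_Icc)+
  then obtain M N where M: "M > 0" "\<And>t. t \<in> {a..b} \<Longrightarrow> \<bar>f t\<bar> \<le> M"
      and N: "N > 0" "\<And>t. t \<in> {a..b} \<Longrightarrow> \<bar>g t\<bar> \<le> N"
    by (auto simp: bounded_pos)
  have CD: "C \<ge> 0" "D \<ge> 0" using f g lipschitz_on_nonneg by blast+
  have "(M * D + N * C)-lipschitz_on {a..b} (\<lambda>t. f t * g t)"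
  proof (rule lipschitz_onI)
    fix s t assume st: "s \<in> {a..b}" "t \<in> {a..b}"
    have "f s * g s - f t * g t = f s * (g s - g t) + g t * (f s - f t)" by (simp add: algebra_simps)
    then have "\<bar>f s * g s - f t * g t\<bar> \<le> \<bar>f s\<bar> * \<bar>g s - g t\<bar> + \<bar>g t\<bar> * \<bar>f s - f t\<bar>"
      by (metis abs_mult abs_triangle_ineq)
    also have "\<dots> \<le> M * (D * \<bar>s - t\<bar>) + N * (C * \<bar>s - t\<bar>)"
      using M N CD st lipschitz_onD[OF f st] lipschitz_onD[OF g st]
      by (intro add_mono mult_mono) (auto simp: dist_real_def)
    finally show "dist (f s * g s) (f t * g t) \<le> (M * D + N * C) * dist s t"
      by (simp add: dist_real_def algebra_simps)
  qed (use M N CD in simp)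
  then show ?thesis by (rule that)
qed

lemma le_if_le_ae:
  fixes f g :: "'a::euclidean_space \<Rightarrow> real"
  assumes "negligible N" "open S" "x \<in> S" "continuous_on S f" "continuous_on S g"
    and le: "\<And>y. y \<in> S \<Longrightarrow> y \<notin> N \<Longrightarrow> f y \<le> g y"
  shows "f x \<le> g x"
proof (rule ccontr)
  assume neg: "\<not> ?thesis"
  define V where "V = {y \<in> S. g y < f y}"
  have "open V"
  proof -
    have "V = S \<inter> (\<lambda>y. f y - g y) -` {0<..}" by (auto simp: V_def)
    then show ?thesis
      using continuous_open_preimage[of S "\<lambda>y. f y - g y" "{0<..}"] assms by (auto intro: continuous_intros)
  qed
  moreover have "x \<in> V" using neg assms(3) by (simp add: V_def)
  ultimately have "\<not> negligible V" using open_not_negligible by blast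
  moreover have "V \<subseteq> N" using le by (force simp: V_def)
  ultimately show False using assms(1) negligible_subset by blast
qed

lemma locally_lipschitz_on_imp_continuous_on:
  fixes f :: "'a::metric_space \<Rightarrow> 'b::metric_space"
  assumes "locally_lipschitz_on S f" "open S"
  shows "continuous_on S f"
proof -
  have "isCont f x" if x: "x \<in> S" for x
  proof -
    obtain r K where r: "r > 0" "K-lipschitz_on (ball x r \<inter> S) f"
      using bspec[OF assms(1)[unfolded locally_lipschitz_on_def] x] by blast
    have "continuous_on (ball x r \<inter> S) f" using r(2) by (rule lipschitz_on_continuous_on)
    moreover have "x \<in> ball x r \<inter> S" using r(1) x by simp
    ultimately show ?thesis
      using continuous_on_eq_continuous_at[OF open_Int[OF open_ball \<open>open S\<close>]] by blast
  qed
  then show ?thesis by (simp add: continuous_at_imp_continuous_on)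
qed

text \<open>The segment itself may lie in the exceptional set, but for almost every shift
  \<open>k\<close> the shifted segment meets it in a null set of parameters. The one-dimensional
  lemma applies there, and continuity carries the estimate to \<open>k = 0\<close>.\<close>

lemma increment_le_if_gradient_bound_ae:
  fixes f :: "'a::euclidean_space \<Rightarrow> real"
  assumes S: "open S" "convex S" and ll: "locally_lipschitz_on S f" and N: "negligible N"
    and der: "\<And>z. z \<in> S \<Longrightarrow> z \<notin> N \<Longrightarrow> \<exists>f'. (f has_derivative f') (at z) \<and> (\<forall>h. f' h \<le> K * norm h)"
    and xy: "x \<in> S" "y \<in> S"
  shows "f y - f x \<le> K * norm (y - x)"
proof -
  define \<gamma> where "\<gamma> = (\<lambda>t. x + t *\<^sub>R (y - x))"
  obtain M where M: "negligible M" "\<And>k. k \<notin> M \<Longrightarrow> negligible {t. (1::real) \<noteq> 0 \<and> \<gamma> t + 1 *\<^sub>R k \<in> N}"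
    by (rule negligible_along_shifted_curves[OF N, of \<gamma> "\<lambda>_. 1"]) (auto simp: \<gamma>_def intro!: continuous_intros)
  define V where "V = {k. x + k \<in> S \<and> y + k \<in> S}"
  have Veq: "V = (+) (- x) ` S \<inter> (+) (- y) ` S"
    by (auto simp: V_def image_iff algebra_simps intro: bexI[where x = "x + _"] bexI[where x = "y + _"])
  have "open V" unfolding Veq using S(1) by (intro open_Int open_translation)
  have contf: "continuous_on S f" using locally_lipschitz_on_imp_continuous_on[OF ll S(1)] .
  have "(\<lambda>k. f (y + k) - f (x + k)) 0 \<le> (\<lambda>_. K * norm (y - x)) 0"
  proof (rule le_if_le_ae[OF M(1) \<open>open V\<close>, where f = "\<lambda>k. f (y + k) - f (x + k)" and g = "\<lambda>_. K * norm (y - x)"])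
    show "0 \<in> V" using xy by (simp add: V_def)
    show "continuous_on V (\<lambda>k. f (y + k) - f (x + k))"
      by (intro continuous_intros continuous_on_compose2[OF contf]) (auto simp: V_def)
    fix k assume k: "k \<in> V" "k \<notin> M"
    define \<phi> where "\<phi> = (\<lambda>t. f (\<gamma> t + k) - t * (K * norm (y - x)))"
    have inS: "\<gamma> t + k \<in> S" if "t \<in> {0..1}" for t
    proof -
      have "\<gamma> t + k = (1 - t) *\<^sub>R (x + k) + t *\<^sub>R (y + k)" by (simp add: \<gamma>_def algebra_simps)
      then show ?thesis using convexD_alt[OF S(2), of "x + k" "y + k" t] k(1) that by (simp add: V_def)
    qed
    have "(norm (y - x))-lipschitz_on {0..1} (\<lambda>t. \<gamma> t + k)"
      by (intro lipschitz_onI) (auto simp: \<gamma>_def dist_norm scaleR_diff_left[symmetric] mult.commute)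
    then obtain C where "C-lipschitz_on {0..1} (\<lambda>t. f (\<gamma> t + k))"
      by (rule locally_lipschitz_on_compose_path[OF ll]) (use inS in auto)
    moreover have "\<bar>K * norm (y - x)\<bar>-lipschitz_on {0..1::real} (\<lambda>t. t * (K * norm (y - x)))"
      by (intro lipschitz_onI) (auto simp: dist_real_def left_diff_distrib[symmetric] abs_mult mult_ac)
    ultimately have "(C + \<bar>K * norm (y - x)\<bar>)-lipschitz_on {0..1} \<phi>"
      unfolding \<phi>_def by (rule lipschitz_on_diff)
    then have "\<phi> 1 \<le> \<phi> 0"
    proof (rule lipschitz_nonincreasing_if_deriv_nonpos_ae[OF _ _ M(2)[OF k(2)], rotated])
      fix t :: real assume t: "0 < t" "t < 1" "t \<notin> {t. (1::real) \<noteq> 0 \<and> \<gamma> t + 1 *\<^sub>R k \<in> N}"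
      then obtain f' where f': "(f has_derivative f') (at (\<gamma> t + k))" "\<And>h. f' h \<le> K * norm h"
        using der[of "\<gamma> t + k"] inS[of t] by auto
      have "((\<lambda>t. \<gamma> t + k) has_derivative (\<lambda>s. s *\<^sub>R (y - x))) (at t)"
        unfolding \<gamma>_def by (auto intro!: derivative_eq_intros)
      from has_derivative_compose[OF this f'(1)]
      have "((\<lambda>t. f (\<gamma> t + k)) has_derivative (\<lambda>s. f' (s *\<^sub>R (y - x)))) (at t)" .
      then have "((\<lambda>t. f (\<gamma> t + k)) has_real_derivative f' (y - x)) (at t)"
        unfolding has_field_derivative_def
        by (rule has_derivative_eq_rhs)
          (use linear_scale[OF has_derivative_linear[OF f'(1)]] in \<open>auto simp: fun_eq_iff\<close>)
      then have "(\<phi> has_real_derivative (f' (y - x) - K * norm (y - x))) (at t)"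
        unfolding \<phi>_def by (auto intro!: derivative_eq_intros)
      then show "\<exists>d\<le>0. (\<phi> has_real_derivative d) (at t)" using f'(2)[of "y - x"] by (intro exI conjI) auto
    qed simp
    then show "f (y + k) - f (x + k) \<le> K * norm (y - x)" by (simp add: \<phi>_def \<gamma>_def)
  qed (intro continuous_intros)
  then show ?thesis by simp
qed

section \<open>Matrix inequalities tested on a fixed vector\<close>

lemma norm_matrix_vector_mult_le:
  fixes M :: "real ^ 'n ^ 'm"
  shows "norm (M *v x) \<le> norm M * norm x"
proof -
  have "norm (M *v x) = L2_set (\<lambda>i. \<bar>(M $ i) \<bullet> x\<bar>) UNIV"
    by (simp add: norm_vec_def matrix_mult_dot)
  also have "\<dots> \<le> L2_set (\<lambda>i. norm (M $ i) * norm x) UNIV"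
    by (intro L2_set_mono Cauchy_Schwarz_ineq2) auto
  also have "\<dots> = norm M * norm x"
    by (simp add: norm_vec_def[of M] L2_set_left_distrib)
  finally show ?thesis .
qed

lemma abs_quadratic_form_le:
  fixes M :: "real ^ 'n ^ 'n"
  shows "\<bar>\<xi> \<bullet> (M *v \<xi>)\<bar> \<le> norm M * (norm \<xi>)\<^sup>2"
proof -
  have "\<bar>\<xi> \<bullet> (M *v \<xi>)\<bar> \<le> norm \<xi> * norm (M *v \<xi>)" by (rule Cauchy_Schwarz_ineq2)
  also have "\<dots> \<le> norm \<xi> * (norm M * norm \<xi>)"
    by (intro mult_left_mono norm_matrix_vector_mult_le) auto
  finally show ?thesis by (simp add: power2_eq_square mult_ac)
qed

lemma norm_sum_scaleR_le:
  fixes v :: "real ^ 'n" and M :: "'a::real_normed_vector ^ 'n"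
  shows "norm (\<Sum>k\<in>UNIV. v $ k *\<^sub>R M $ k) \<le> norm v * norm M"
proof -
  have "norm (\<Sum>k\<in>UNIV. v $ k *\<^sub>R M $ k) \<le> (\<Sum>k\<in>UNIV. norm (v $ k *\<^sub>R M $ k))" by (rule norm_sum)
  also have "\<dots> = (\<Sum>k\<in>UNIV. \<bar>norm (v $ k)\<bar> * \<bar>norm (M $ k)\<bar>)" by simp
  also have "\<dots> \<le> L2_set (\<lambda>k. norm (v $ k)) UNIV * L2_set (\<lambda>k. norm (M $ k)) UNIV" by (rule L2_set_mult_ineq)
  also have "\<dots> = norm v * norm M" by (simp add: norm_vec_def)
  finally show ?thesis .
qed

lemma has_derivative_grad:
  fixes f :: "real ^ 'n \<Rightarrow> 'a::real_normed_vector"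
  assumes "f differentiable (at x)"
  shows "(f has_derivative (\<lambda>h. \<Sum>k\<in>UNIV. h $ k *\<^sub>R grad f x $ k)) (at x)"
proof -
  let ?D = "frechet_derivative f (at x)"
  have D: "(f has_derivative ?D) (at x)" using assms by (simp add: frechet_derivative_works)
  have lin: "linear ?D" using has_derivative_linear[OF D] .
  have "?D h = (\<Sum>k\<in>UNIV. h $ k *\<^sub>R grad f x $ k)" for h
  proof -
    have "h = (\<Sum>k\<in>UNIV. h $ k *\<^sub>R axis k 1)"
      using basis_expansion[of h] by (simp add: scalar_mult_eq_scaleR)
    from arg_cong[OF this] have "?D h = ?D (\<Sum>k\<in>UNIV. h $ k *\<^sub>R axis k 1)" .
    also have "\<dots> = (\<Sum>k\<in>UNIV. h $ k *\<^sub>R grad f x $ k)"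
      by (simp add: linear_sum[OF lin] linear_scale[OF lin] grad_def)
    finally show ?thesis .
  qed
  then show ?thesis by (intro has_derivative_eq_rhs[OF D] ext)
qed

lemma bounded_linear_quadratic_form:
  "bounded_linear (\<lambda>M :: real ^ 'n ^ 'n. \<xi> \<bullet> (M *v \<xi>))"
proof -
  have "linear (\<lambda>M :: real ^ 'n ^ 'n. \<xi> \<bullet> (M *v \<xi>))"
    by (intro linearI) (simp_all add: matrix_vector_mult_add_rdistrib inner_add_right scaleR_matrix_vector_assoc[symmetric])
  then show ?thesis by (rule linear_conv_bounded_linear[THEN iffD1])
qed

lemma quadratic_form_tensor: "\<xi> \<bullet> ((p \<otimes> p) *v \<xi>) = (p \<bullet> \<xi>)\<^sup>2"
proof -
  have "(p \<otimes> p) *v \<xi> = (p \<bullet> \<xi>) *\<^sub>R p"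
    by (simp add: vec_eq_iff matrix_vector_mult_def tensor_def inner_vec_def sum_distrib_left sum_distrib_right mult_ac)
  then show ?thesis by (simp add: power2_eq_square inner_commute)
qed

lemma quadratic_form_mat_1: "\<xi> \<bullet> ((c *\<^sub>R mat 1) *v \<xi>) = c * (norm (\<xi> :: real ^ 'n))\<^sup>2"
  by (simp add: scaleR_matrix_vector_assoc[symmetric] power2_norm_eq_inner)

lemma mat_le_quadratic_form: "M \<preceq> N \<Longrightarrow> \<xi> \<bullet> (M *v \<xi>) \<le> \<xi> \<bullet> (N *v \<xi>)"
  by (simp add: mat_le_def nonneg_definite_def matrix_vector_mult_diff_rdistrib inner_diff_right)

lemma locally_lipschitz_on_compose_nonexpansive:
  assumes ll: "locally_lipschitz_on S f" and g: "\<And>a b. dist (g a) (g b) \<le> dist a b"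
    and T: "\<And>a. a \<in> T \<Longrightarrow> g a \<in> S"
  shows "locally_lipschitz_on T (\<lambda>a. f (g a))"
  unfolding locally_lipschitz_on_def
proof
  fix a assume "a \<in> T"
  then obtain r K where r: "r > 0" "K-lipschitz_on (ball (g a) r \<inter> S) f"
    using ll T unfolding locally_lipschitz_on_def by blast
  have "K-lipschitz_on (ball a r \<inter> T) (\<lambda>a. f (g a))"
  proof (rule lipschitz_onI)
    fix b c assume bc: "b \<in> ball a r \<inter> T" "c \<in> ball a r \<inter> T"
    then have "g b \<in> ball (g a) r \<inter> S" "g c \<in> ball (g a) r \<inter> S"
      using g[of a b] g[of a c] T by auto
    then have "dist (f (g b)) (f (g c)) \<le> K * dist (g b) (g c)" by (rule lipschitz_onD[OF r(2)])
    also have "\<dots> \<le> K * dist b c"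
      by (intro mult_left_mono g lipschitz_on_nonneg[OF r(2)])
    finally show "dist (f (g b)) (f (g c)) \<le> K * dist b c" .
  qed (rule lipschitz_on_nonneg[OF r(2)])
  then show "\<exists>r>0. \<exists>K. K-lipschitz_on (ball a r \<inter> T) (\<lambda>a. f (g a))" using r(1) by blast
qed

lemma locally_lipschitz_on_bounded_linear:
  assumes ll: "locally_lipschitz_on S f" and B: "bounded_linear B"
  shows "locally_lipschitz_on S (\<lambda>a. B (f a))"
  unfolding locally_lipschitz_on_def
proof
  fix a assume "a \<in> S"
  then obtain r K where r: "r > 0" "K-lipschitz_on (ball a r \<inter> S) f"
    using ll unfolding locally_lipschitz_on_def by blast
  obtain M where "M-lipschitz_on (f ` (ball a r \<inter> S)) B"
    by (rule bounded_linear.lipschitz_boundE[OF B])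
  then show "\<exists>r>0. \<exists>K. K-lipschitz_on (ball a r \<inter> S) (\<lambda>a. B (f a))"
    using lipschitz_on_compose2[OF r(2)] r(1) by blast
qed

lemma locally_lipschitz_on_slices:
  assumes "locally_lipschitz_on (\<Omega> \<times> UNIV \<times> UNIV) (\<lambda>(x, s, p). L x s p)"
  shows "locally_lipschitz_on \<Omega> (\<lambda>y. L y s p)"
    and "x \<in> \<Omega> \<Longrightarrow> locally_lipschitz_on UNIV (\<lambda>q. L x s q)"
  using locally_lipschitz_on_compose_nonexpansive[OF assms, of "\<lambda>y. (y, s, p)" \<Omega>]
    locally_lipschitz_on_compose_nonexpansive[OF assms, of "\<lambda>q. (x, s, q)" UNIV]
  by (auto simp: dist_Pair_Pair)

lemma negligible_not_differentiable:
  fixes f :: "'a::euclidean_space \<Rightarrow> 'b::euclidean_space"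
  assumes "locally_lipschitz_on S f" "open S"
  shows "negligible {x\<in>S. \<not> f differentiable (at x)}"
  using rademacher_local[OF assms(2)] assms(1) unfolding locally_lipschitz_on_def by blast

lemma quadratic_form_has_derivative:
  fixes M :: "real ^ 'n \<Rightarrow> real ^ 'm ^ 'm"
  assumes "M differentiable (at x)"
  shows "((\<lambda>y. \<xi> \<bullet> (M y *v \<xi>)) has_derivative
           (\<lambda>h. \<xi> \<bullet> ((\<Sum>k\<in>UNIV. h $ k *\<^sub>R grad M x $ k) *v \<xi>))) (at x)"
  using bounded_linear.has_derivative[OF bounded_linear_quadratic_form has_derivative_grad[OF assms]] .

lemma quadratic_form_gradient_le:
  fixes G :: "(real ^ 'm ^ 'm) ^ 'n"
  shows "\<xi> \<bullet> ((\<Sum>k\<in>UNIV. h $ k *\<^sub>R G $ k) *v \<xi>) \<le> norm h * norm G * (norm \<xi>)\<^sup>2"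
proof -
  have "\<xi> \<bullet> ((\<Sum>k\<in>UNIV. h $ k *\<^sub>R G $ k) *v \<xi>) \<le> norm (\<Sum>k\<in>UNIV. h $ k *\<^sub>R G $ k) * (norm \<xi>)\<^sup>2"
    using abs_quadratic_form_le abs_le_D1 by blast
  also have "\<dots> \<le> norm h * norm G * (norm \<xi>)\<^sup>2"
    by (intro mult_right_mono norm_sum_scaleR_le) auto
  finally show ?thesis .
qed

text \<open>Testing with a fixed \<open>\<xi>\<close> turns the matrix estimate into a scalar one,
  to which the almost-everywhere gradient bound applies.\<close>

lemma quadratic_form_increment_le:
  fixes M :: "real ^ 'n \<Rightarrow> real ^ 'm ^ 'm"
  assumes S: "open S" "convex S" and ll: "locally_lipschitz_on S M"
    and bound: "\<And>z. z \<in> S \<Longrightarrow> M differentiable (at z) \<Longrightarrow> norm (grad M z) \<le> K"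
    and xy: "x \<in> S" "y \<in> S"
  shows "\<xi> \<bullet> (M y *v \<xi>) - \<xi> \<bullet> (M x *v \<xi>) \<le> K * norm (y - x) * (norm \<xi>)\<^sup>2"
proof -
  have "\<xi> \<bullet> (M y *v \<xi>) - \<xi> \<bullet> (M x *v \<xi>) \<le> (K * (norm \<xi>)\<^sup>2) * norm (y - x)"
  proof (rule increment_le_if_gradient_bound_ae[OF S _ negligible_not_differentiable[OF ll S(1)] _ xy])
    show "locally_lipschitz_on S (\<lambda>y. \<xi> \<bullet> (M y *v \<xi>))"
      by (rule locally_lipschitz_on_bounded_linear[OF ll bounded_linear_quadratic_form])
    fix z assume z: "z \<in> S" "z \<notin> {x \<in> S. \<not> M differentiable at x}"
    have "norm h * norm (grad M z) * (norm \<xi>)\<^sup>2 \<le> K * (norm \<xi>)\<^sup>2 * norm h" for h :: "real ^ 'n"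
      using mult_left_mono[OF bound[of z], of "norm h * (norm \<xi>)\<^sup>2"] z by (simp add: mult_ac)
    then show "\<exists>f'. ((\<lambda>y. \<xi> \<bullet> (M y *v \<xi>)) has_derivative f') (at z) \<and> (\<forall>h. f' h \<le> K * (norm \<xi>)\<^sup>2 * norm h)"
      using quadratic_form_has_derivative[of M z] quadratic_form_gradient_le z
      by (intro exI conjI allI) (blast intro: order_trans)+
  qed
  then show ?thesis by (simp add: mult_ac)
qed

lemma powr_le_of_le_add:
  fixes a b t m :: real
  assumes "0 \<le> a" "0 \<le> b" "0 \<le> t" "t \<le> 2 * a + 2 * b" "m > 0"
  shows "t powr m \<le> 4 powr m * (a powr m + b powr m)"
proof -
  have "t powr m \<le> (4 * max a b) powr m" using assms by (intro powr_mono2) auto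
  also have "\<dots> = 4 powr m * max a b powr m" using assms by (simp add: powr_mult)
  also have "\<dots> \<le> 4 powr m * (a powr m + b powr m)"
    by (intro mult_left_mono) (auto simp: max_def)
  finally show ?thesis .
qed

text \<open>The hypothesis bounds the derivative of \<open>M(r(\<tau>)) / \<tau>\<close> along
  \<open>r(\<tau>) = \<tau> q + ((\<tau> - 1) / \<mu>) e\<close>, which runs from \<open>q\<close> at \<open>\<tau> = 1\<close> to \<open>(1 + \<mu>) q + e\<close> at
  \<open>\<tau> = 1 + \<mu>\<close>; for almost every \<open>q\<close> almost every point of this path is a point of differentiability.\<close>
lemma dilation_inequality:
  fixes M :: "real ^ 'n \<Rightarrow> real ^ 'n ^ 'n"
  assumes ll: "locally_lipschitz_on UNIV M" and C: "C > 0" and m: "m > 0"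
    and str: "\<And>p. M differentiable (at p) \<Longrightarrow>
       (\<Sum>k\<in>UNIV. p $ k *\<^sub>R grad M p $ k) - M p + (\<theta> * \<Lambda> * norm (grad M p)) *\<^sub>R mat 1 - \<theta> *\<^sub>R mat 1
         \<preceq> C *\<^sub>R (p \<otimes> p) - (1 / C * norm p powr m) *\<^sub>R mat 1"
    and \<mu>: "0 < \<mu>" "\<mu> \<le> 1" and e: "norm e \<le> \<mu> * \<theta> * \<Lambda>"
  shows "\<xi> \<bullet> (M ((1 + \<mu>) *\<^sub>R q + e) *v \<xi>) \<le> (1 + \<mu>) * (\<xi> \<bullet> (M q *v \<xi>)) +
     \<mu> * (8 * C * (q \<bullet> \<xi>)\<^sup>2 + (2 * C * (norm e)\<^sup>2 + norm e powr m / C + \<theta>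
            - norm ((1 + \<mu>) *\<^sub>R q + e) powr m / (4 powr m * C)) * (norm \<xi>)\<^sup>2)"
    (is "?lhs q \<le> ?rhs q")
proof -
  define N where "N = {q \<in> UNIV. \<not> M differentiable (at q)}"
  have N: "negligible N" unfolding N_def by (rule negligible_not_differentiable[OF ll open_UNIV])
  obtain V where V: "negligible V"
      "\<And>k. k \<notin> V \<Longrightarrow> negligible {t. t \<noteq> 0 \<and> ((t - 1) / \<mu>) *\<^sub>R e + t *\<^sub>R k \<in> N}"
    by (rule negligible_along_shifted_curves[OF N, of "\<lambda>t. ((t - 1) / \<mu>) *\<^sub>R e" "\<lambda>t. t"])
      (use \<mu> in \<open>auto intro!: continuous_intros\<close>)
  have contM: "continuous_on UNIV M" by (rule locally_lipschitz_on_imp_continuous_on[OF ll open_UNIV])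
  have contQ: "continuous_on UNIV (\<lambda>q. \<xi> \<bullet> (M (g q) *v \<xi>))" if "continuous_on UNIV g" for g
    using bounded_linear.continuous_on[OF bounded_linear_quadratic_form continuous_on_compose2[OF contM that]] by simp
  show ?thesis
  proof (rule le_if_le_ae[OF V(1) open_UNIV UNIV_I, where f = ?lhs and g = ?rhs])
    show "continuous_on UNIV ?lhs" by (rule contQ) (intro continuous_intros)
    have cp: "continuous_on UNIV (\<lambda>q. norm ((1 + \<mu>) *\<^sub>R q + e) powr m)"
      using m by (intro continuous_on_powr' continuous_intros) auto
    have "continuous_on UNIV (\<lambda>q. (1 + \<mu>) * u q + \<mu> * (8 * C * (q \<bullet> \<xi>)\<^sup>2 + (c - v q / d) * n))"
      if "continuous_on UNIV u" "continuous_on UNIV v" "d \<noteq> 0" for u v :: "real ^ 'n \<Rightarrow> real" and c d n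
      using that by (intro continuous_intros) auto
    from this[OF contQ[OF continuous_on_id] cp, of "4 powr m * C"]
    show "continuous_on UNIV ?rhs" using C by simp
    fix q assume q: "q \<notin> V"
    \<comment> \<open>Chosen independent of \<open>t\<close> and so large that
      \<open>(G t + B) / t\<close> is non-increasing; its values at 1 and \<open>\<kappa>\<close>
      give \<open>G \<kappa> \<le> \<kappa> * G 1 + \<mu> * B\<close>.\<close>
    define B where "B = 8 * C * (q \<bullet> \<xi>)\<^sup>2 + (2 * C * (norm e)\<^sup>2 + norm e powr m / C + \<theta>
            - norm ((1 + \<mu>) *\<^sub>R q + e) powr m / (4 powr m * C)) * (norm \<xi>)\<^sup>2"
    define \<kappa> where "\<kappa> = 1 + \<mu>"
    define \<gamma> where "\<gamma> = (\<lambda>t. ((t - 1) / \<mu>) *\<^sub>R e + t *\<^sub>R q)"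
    define G where "G = (\<lambda>t. \<xi> \<bullet> (M (\<gamma> t) *v \<xi>))"
    have "(norm (e /\<^sub>R \<mu> + q))-lipschitz_on {1..\<kappa>} \<gamma>"
    proof (rule lipschitz_onI)
      fix s t
      have "\<gamma> s - \<gamma> t = (s - t) *\<^sub>R (e /\<^sub>R \<mu> + q)"
        by (simp add: \<gamma>_def divide_inverse algebra_simps)
      then show "dist (\<gamma> s) (\<gamma> t) \<le> norm (e /\<^sub>R \<mu> + q) * dist s t" by (simp add: dist_norm)
    qed simp
    then obtain K where "K-lipschitz_on {1..\<kappa>} (\<lambda>t. M (\<gamma> t))"
      by (rule locally_lipschitz_on_compose_path[OF ll]) auto
    moreover obtain K' where "K'-lipschitz_on ((\<lambda>t. M (\<gamma> t)) ` {1..\<kappa>}) (\<lambda>A. \<xi> \<bullet> (A *v \<xi>))"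
      by (rule bounded_linear.lipschitz_boundE[OF bounded_linear_quadratic_form])
    ultimately have "(K' * K)-lipschitz_on {1..\<kappa>} (\<lambda>t. \<xi> \<bullet> (M (\<gamma> t) *v \<xi>))" by (rule lipschitz_on_compose2)
    then have "(K' * K + 0)-lipschitz_on {1..\<kappa>} (\<lambda>t. G t + B)"
      unfolding G_def by (intro lipschitz_on_add) (auto simp: lipschitz_on_constant)
    moreover have "1-lipschitz_on {1..\<kappa>} (\<lambda>t. 1 / t)"
    proof (rule lipschitz_onI)
      fix s t assume st: "s \<in> {1..\<kappa>}" "t \<in> {1..\<kappa>}"
      then have "1 / s - 1 / t = (t - s) / (s * t)" by (simp add: field_simps)
      then have "\<bar>1 / s - 1 / t\<bar> = \<bar>s - t\<bar> / (s * t)" using st by (simp add: abs_mult abs_minus_commute)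
      also have "\<dots> \<le> \<bar>s - t\<bar> / 1"
        using st mult_mono[of 1 s 1 t] by (intro divide_left_mono) auto
      finally show "dist (1 / s) (1 / t) \<le> 1 * dist s t" by (simp add: dist_real_def)
    qed simp
    ultimately obtain K2 where lip: "K2-lipschitz_on {1..\<kappa>} (\<lambda>t. (G t + B) * (1 / t))"
      using lipschitz_on_mult_compact by blast
    have "(G \<kappa> + B) * (1 / \<kappa>) \<le> (G 1 + B) * (1 / 1)"
    proof (rule lipschitz_nonincreasing_if_deriv_nonpos_ae[OF _ lip V(2)[OF q]])
      show "1 \<le> \<kappa>" using \<mu> by (simp add: \<kappa>_def)
      fix t assume t: "1 < t" "t < \<kappa>" "t \<notin> {t. t \<noteq> 0 \<and> ((t - 1) / \<mu>) *\<^sub>R e + t *\<^sub>R q \<in> N}"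
      define r where "r = \<gamma> t"
      have dM: "M differentiable (at r)" using t by (simp add: N_def r_def \<gamma>_def)
      define Q where "Q = (\<lambda>h. \<xi> \<bullet> ((\<Sum>k\<in>UNIV. h $ k *\<^sub>R grad M r $ k) *v \<xi>))"
      have dQ: "((\<lambda>y. \<xi> \<bullet> (M y *v \<xi>)) has_derivative Q) (at r)"
        unfolding Q_def by (rule quadratic_form_has_derivative[OF dM])
      have linQ: "linear Q" using has_derivative_linear[OF dQ] .
      have "(\<gamma> has_derivative (\<lambda>s. s *\<^sub>R (e /\<^sub>R \<mu> + q))) (at t)"
        unfolding \<gamma>_def using \<mu> by (auto intro!: derivative_eq_intros simp: divide_inverse algebra_simps)
      from has_derivative_compose[OF this dQ[unfolded r_def]]
      have dG: "(G has_real_derivative Q (e /\<^sub>R \<mu> + q)) (at t)"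
        unfolding has_field_derivative_def G_def
        by (rule has_derivative_eq_rhs) (simp add: linear_scale[OF linQ] fun_eq_iff)
      have der: "((\<lambda>t. (G t + B) * (1 / t)) has_real_derivative (t * Q (e /\<^sub>R \<mu> + q) - G t - B) / t\<^sup>2) (at t)"
        using t by (auto intro!: derivative_eq_intros dG simp: field_simps power2_eq_square)
      \<comment> \<open>This is \<open>t\<close> times the velocity of the path. The part along
        \<open>r\<close> produces the radial derivative of the structure condition, and the rest, of
        length at most \<open>\<theta> * \<Lambda>\<close>, is paid for by its gradient
        term.\<close>
      have "t *\<^sub>R (e /\<^sub>R \<mu> + q) = r + e /\<^sub>R \<mu>"
        by (simp add: r_def \<gamma>_def divide_inverse algebra_simps)
      then have tQ: "t * Q (e /\<^sub>R \<mu> + q) = Q r + Q (e /\<^sub>R \<mu>)"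
        by (metis linear_add[OF linQ] linear_scale[OF linQ] real_scaleR_def)
      have "Q (e /\<^sub>R \<mu>) \<le> norm (e /\<^sub>R \<mu>) * norm (grad M r) * (norm \<xi>)\<^sup>2"
        unfolding Q_def by (rule quadratic_form_gradient_le)
      also have "\<dots> \<le> (\<theta> * \<Lambda>) * norm (grad M r) * (norm \<xi>)\<^sup>2"
      proof (intro mult_right_mono)
        have "norm (e /\<^sub>R \<mu>) = norm e / \<mu>" using \<mu> by (simp add: field_simps)
        also have "\<dots> \<le> \<theta> * \<Lambda>" using e \<mu> by (simp add: field_simps)
        finally show "norm (e /\<^sub>R \<mu>) \<le> \<theta> * \<Lambda>" .
      qed auto
      finally have Qe: "Q (e /\<^sub>R \<mu>) \<le> \<theta> * \<Lambda> * norm (grad M r) * (norm \<xi>)\<^sup>2" .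
      have "\<xi> \<bullet> (((\<Sum>k\<in>UNIV. r $ k *\<^sub>R grad M r $ k) - M r + (\<theta> * \<Lambda> * norm (grad M r)) *\<^sub>R mat 1 - \<theta> *\<^sub>R mat 1) *v \<xi>)
          \<le> \<xi> \<bullet> ((C *\<^sub>R (r \<otimes> r) - (1 / C * norm r powr m) *\<^sub>R mat 1) *v \<xi>)"
        by (rule mat_le_quadratic_form[OF str[OF dM]])
      then have "Q r - G t + \<theta> * \<Lambda> * norm (grad M r) * (norm \<xi>)\<^sup>2 - \<theta> * (norm \<xi>)\<^sup>2
          \<le> C * (r \<bullet> \<xi>)\<^sup>2 - 1 / C * norm r powr m * (norm \<xi>)\<^sup>2"
        unfolding matrix_vector_mult_diff_rdistrib matrix_vector_mult_add_rdistrib inner_diff_right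
          inner_add_right quadratic_form_mat_1 scaleR_matrix_vector_assoc[symmetric] inner_scaleR_right
          quadratic_form_tensor
        by (simp add: Q_def G_def r_def power2_norm_eq_inner)
      then have main: "t * Q (e /\<^sub>R \<mu> + q) - G t \<le> C * (r \<bullet> \<xi>)\<^sup>2 + (\<theta> - 1 / C * norm r powr m) * (norm \<xi>)\<^sup>2"
        using tQ Qe by (simp add: left_diff_distrib)
      define c where "c = (t - 1) / \<mu>"
      have c: "0 \<le> c" "c \<le> 1" using t \<mu> by (auto simp: c_def \<kappa>_def)
      have req: "r = c *\<^sub>R e + t *\<^sub>R q" by (simp add: r_def \<gamma>_def c_def)
      have t2: "0 < t" "t \<le> 2" using t \<mu> by (auto simp: \<kappa>_def)
      \<comment> \<open>Origin of the 8: a factor 2 from splitting the square, and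
        \<open>t\<^sup>2 \<le> 4\<close>.\<close>
      have "(r \<bullet> \<xi>)\<^sup>2 \<le> 2 * (c * (e \<bullet> \<xi>))\<^sup>2 + 2 * (t * (q \<bullet> \<xi>))\<^sup>2"
        using norm_add_sq_le[of "c * (e \<bullet> \<xi>)" "t * (q \<bullet> \<xi>)"] by (simp add: req inner_add_left)
      also have "(c * (e \<bullet> \<xi>))\<^sup>2 \<le> (norm e)\<^sup>2 * (norm \<xi>)\<^sup>2"
      proof -
        have "\<bar>c * (e \<bullet> \<xi>)\<bar> \<le> 1 * (norm e * norm \<xi>)"
          unfolding abs_mult using c Cauchy_Schwarz_ineq2[of e \<xi>] by (intro mult_mono) auto
        then have "\<bar>c * (e \<bullet> \<xi>)\<bar>\<^sup>2 \<le> (norm e * norm \<xi>)\<^sup>2" by (intro power_mono) auto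
        then show ?thesis by (simp add: power_mult_distrib)
      qed
      also have "(t * (q \<bullet> \<xi>))\<^sup>2 \<le> 4 * (q \<bullet> \<xi>)\<^sup>2"
      proof -
        have "t\<^sup>2 \<le> 2\<^sup>2" using t2 by (intro power_mono) auto
        then show ?thesis by (simp add: power_mult_distrib mult_right_mono)
      qed
      finally have rx: "(r \<bullet> \<xi>)\<^sup>2 \<le> 8 * (q \<bullet> \<xi>)\<^sup>2 + 2 * (norm e)\<^sup>2 * (norm \<xi>)\<^sup>2" by simp
      define p where "p = (1 + \<mu>) *\<^sub>R q + e"
      have "norm p \<le> 2 * norm r + 2 * norm e"
      proof -
        \<comment> \<open>The endpoint \<open>p\<close> is expressed through the current point
          \<open>r\<close> with coefficient at most 2. Thus the negative term in
          \<open>|r|^m\<close> controls a fixed fraction of \<open>|p|^m\<close>, uniformly along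
          the path.\<close>
        define l where "l = \<kappa> / t"
        have "l * t = \<kappa>" using t2 by (simp add: l_def)
        then have peq: "p = l *\<^sub>R r + (1 - l * c) *\<^sub>R e"
          by (simp add: p_def req \<kappa>_def[symmetric] scaleR_add_right scaleR_left_diff_distrib)
        have l: "0 \<le> l" "l \<le> 2"
          using t \<mu> by (auto simp: l_def \<kappa>_def field_simps)
        have "l * c \<ge> 0" using l c by simp
        moreover have "l * c \<le> 1"
        proof -
          have "\<kappa> * (t - 1) \<le> t * \<mu>" using t \<mu> by (simp add: \<kappa>_def algebra_simps)
          then show ?thesis using t2 \<mu> by (simp add: l_def c_def field_simps)
        qed
        ultimately have "norm ((1 - l * c) *\<^sub>R e) \<le> 1 * norm e"
          unfolding norm_scaleR by (intro mult_right_mono) auto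
        moreover have "norm (l *\<^sub>R r) \<le> 2 * norm r" using l by (simp add: mult_right_mono)
        ultimately show ?thesis unfolding peq using norm_triangle_ineq[of "l *\<^sub>R r" "(1 - l * c) *\<^sub>R e"] norm_ge_zero[of e]
          by linarith
      qed
      then have "norm p powr m \<le> 4 powr m * (norm r powr m + norm e powr m)"
        using m by (intro powr_le_of_le_add) auto
      then have "norm p powr m / (4 powr m * C) \<le> (norm r powr m + norm e powr m) / C"
        using C by (simp add: field_simps)
      then have rp: "\<theta> - 1 / C * norm r powr m \<le> \<theta> + norm e powr m / C - norm p powr m / (4 powr m * C)"
        by (simp add: add_divide_distrib)
      have "t * Q (e /\<^sub>R \<mu> + q) - G t \<le> C * (8 * (q \<bullet> \<xi>)\<^sup>2 + 2 * (norm e)\<^sup>2 * (norm \<xi>)\<^sup>2)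
          + (\<theta> + norm e powr m / C - norm p powr m / (4 powr m * C)) * (norm \<xi>)\<^sup>2"
        using main mult_left_mono[OF rx less_imp_le[OF C]]
          mult_right_mono[OF rp zero_le_power2[of "norm \<xi>"]] by linarith
      also have "\<dots> = B" by (simp add: B_def p_def algebra_simps)
      finally have "(t * Q (e /\<^sub>R \<mu> + q) - G t - B) / t\<^sup>2 \<le> 0"
        by (intro divide_nonpos_nonneg) auto
      then show "\<exists>d\<le>0. ((\<lambda>t. (G t + B) * (1 / t)) has_real_derivative d) (at t)" using der by blast
    qed
    then have "G \<kappa> + B \<le> \<kappa> * (G 1 + B)" using \<mu> by (simp add: \<kappa>_def field_simps)
    moreover have "\<gamma> \<kappa> = (1 + \<mu>) *\<^sub>R q + e" "\<gamma> 1 = q" using \<mu> by (simp_all add: \<gamma>_def \<kappa>_def)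
    ultimately have "\<xi> \<bullet> (M ((1 + \<mu>) *\<^sub>R q + e) *v \<xi>) \<le> (1 + \<mu>) * (\<xi> \<bullet> (M q *v \<xi>)) + \<mu> * B"
      by (simp only: G_def) (simp add: \<kappa>_def distrib_left distrib_right)
    then show "?lhs q \<le> ?rhs q" unfolding B_def .
  qed
qed

section \<open>Viscosity jets and the comparison argument\<close>

lemma sym_mats_iff: "A \<in> sym_mats \<longleftrightarrow> (\<forall>i j. A $ i $ j = A $ j $ i)"
  by (auto simp: sym_mats_def transpose_def vec_eq_iff)

lemma sym_mats_add: "A \<in> sym_mats \<Longrightarrow> B \<in> sym_mats \<Longrightarrow> A + B \<in> sym_mats"
  and sym_mats_diff: "A \<in> sym_mats \<Longrightarrow> B \<in> sym_mats \<Longrightarrow> A - B \<in> sym_mats"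
  and sym_mats_scaleR: "A \<in> sym_mats \<Longrightarrow> c *\<^sub>R A \<in> sym_mats"
  and sym_mats_mat_1: "mat 1 \<in> sym_mats"
  and sym_mats_tensor: "p \<otimes> p \<in> sym_mats"
  by (auto simp: sym_mats_iff mat_def tensor_def)

lemma sym_mats_inner: "X \<in> sym_mats \<Longrightarrow> a \<bullet> (X *v b) = (X *v a) \<bullet> b"
  using dot_lmul_matrix[of a X b] transpose_matrix_vector[of X a] by (simp add: sym_mats_def)

text \<open>The derivative of the envelope's gradient was not shown to be symmetric, while Hessians
  of test functions must be; only the quadratic form matters, so the matrix is symmetrised.\<close>

lemma linear_quadratic_form_matrix:
  fixes T :: "real ^ 'n \<Rightarrow> real ^ 'n"
  assumes "linear T"
  obtains X where "X \<in> sym_mats" "\<And>h. h \<bullet> (X *v h) = h \<bullet> T h"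
proof (rule that)
  define A where "A = matrix T"
  have A: "A *v h = T h" for h using assms by (simp add: A_def matrix_works)
  show "(1 / 2) *\<^sub>R (A + transpose A) \<in> sym_mats" by (auto simp: sym_mats_iff transpose_def)
  fix h
  have "h \<bullet> (transpose A *v h) = h \<bullet> (A *v h)"
    using dot_lmul_matrix[of h A h] transpose_matrix_vector[of A h] by (simp add: inner_commute)
  then show "h \<bullet> (((1 / 2) *\<^sub>R (A + transpose A)) *v h) = h \<bullet> T h"
    by (simp add: scaleR_matrix_vector_assoc[symmetric] matrix_vector_mult_add_rdistrib inner_add_right A)
qed

lemma grad_eqI: "(f has_derivative D) (at x) \<Longrightarrow> grad f x = (\<chi> k. D (axis k 1))"
  unfolding grad_def by (drule frechet_derivative_at) simp

lemma quadratic_has_derivative: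
  fixes X :: "real ^ 'n ^ 'n"
  assumes X: "X \<in> sym_mats"
  shows "((\<lambda>x. c + g \<bullet> (x - x0) + ((x - x0) \<bullet> (X *v (x - x0))) / 2) has_derivative
    (\<lambda>h. (g + X *v (x - x0)) \<bullet> h)) (at x)"
proof -
  have lin: "((\<lambda>x. X *v (x - x0)) has_derivative (\<lambda>h. X *v h)) (at x)"
    by (rule bounded_linear.has_derivative[OF matrix_vector_mul_bounded_linear])
      (auto intro!: derivative_eq_intros)
  have "((\<lambda>x. c + g \<bullet> (x - x0) + ((x - x0) \<bullet> (X *v (x - x0))) / 2) has_derivative
    (\<lambda>h. g \<bullet> h + ((x - x0) \<bullet> (X *v h) + h \<bullet> (X *v (x - x0))) / 2)) (at x)"
    by (auto intro!: derivative_eq_intros lin)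
  moreover have "(x - x0) \<bullet> (X *v h) = h \<bullet> (X *v (x - x0))" for h
    using sym_mats_inner[OF X, of "x - x0" h] by (simp add: inner_commute)
  ultimately show ?thesis
    by (simp add: inner_add_left inner_commute[of _ "X *v (x - x0)"])
qed

lemma quadratic_test_function:
  fixes X :: "real ^ 'n ^ 'n" and g a :: "real ^ 'n" and c :: real
  assumes X: "X \<in> sym_mats"
  defines "\<phi> \<equiv> \<lambda>x. c + g \<bullet> (x - a) + ((x - a) \<bullet> (X *v (x - a))) / 2"
  shows "C2_on S \<phi>" "grad \<phi> a = g" "hessian \<phi> x = X"
proof -
  have d: "(\<phi> has_derivative (\<lambda>h. (g + X *v (x - a)) \<bullet> h)) (at x)" for x
    unfolding \<phi>_def by (rule quadratic_has_derivative[OF X])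
  have gr: "grad \<phi> = (\<lambda>x. g + X *v (x - a))"
    by (rule ext) (simp add: grad_eqI[OF d] vec_eq_iff inner_axis)
  have dg: "(grad \<phi> has_derivative (\<lambda>h. X *v h)) (at x)" for x
  proof -
    have "((\<lambda>x. X *v (x - a)) has_derivative (\<lambda>h. X *v h)) (at x)"
      by (rule bounded_linear.has_derivative[OF matrix_vector_mul_bounded_linear])
        (auto intro!: derivative_eq_intros)
    then show ?thesis unfolding gr by (auto intro!: derivative_eq_intros)
  qed
  have hs: "hessian \<phi> x = X" for x
    using X by (simp add: hessian_def grad_eqI[OF dg] matrix_vector_mult_basis column_def vec_eq_iff sym_mats_iff)
  then have "hessian \<phi> = (\<lambda>_. X)" by auto
  then show "C2_on S \<phi>" using d dg by (auto simp: C2_on_def differentiable_def)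
  show "grad \<phi> a = g" by (simp add: gr)
  show "hessian \<phi> x = X" by (rule hs)
qed

lemma subsolution_jet:
  assumes sub: "viscosity_subsolution L U \<Omega> v" and x: "x \<in> \<Omega>" "v x = ereal s" and X: "X \<in> sym_mats"
    and r: "r > 0" "\<And>h. norm h < r \<Longrightarrow> v (x + h) \<le> ereal (s + p \<bullet> h + (h \<bullet> (X *v h)) / 2)"
  shows "X + L x s p \<in> closure U"
proof -
  define \<phi> where "\<phi> = (\<lambda>y. s + p \<bullet> (y - x) + ((y - x) \<bullet> (X *v (y - x))) / 2)"
  note \<phi> = quadratic_test_function[OF X, where c = s and g = p and a = x, folded \<phi>_def]
  have "\<forall>\<^sub>F y in nhds x. v y \<le> ereal (\<phi> y)"
    unfolding eventually_nhds_metric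
  proof (intro exI[of _ r] conjI allI impI r(1))
    fix y assume "dist y x < r"
    then show "v y \<le> ereal (\<phi> y)" using r(2)[of "y - x"] by (simp add: \<phi>_def dist_norm)
  qed
  moreover have \<phi>x: "\<phi> x = s" by (simp add: \<phi>_def)
  ultimately have "F_op L \<phi> x \<in> closure U"
    using sub x \<phi>(1)[of \<Omega>] unfolding viscosity_subsolution_def by (metis (no_types, lifting))
  then show ?thesis by (simp add: F_op_def \<phi> \<phi>x)
qed

lemma supersolution_jet:
  assumes super: "viscosity_supersolution L U \<Omega> w" and x: "x \<in> \<Omega>" "w x = ereal s" and X: "X \<in> sym_mats"
    and r: "r > 0" "\<And>h. norm h < r \<Longrightarrow> ereal (s + p \<bullet> h + (h \<bullet> (X *v h)) / 2) \<le> w (x + h)"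
  shows "X + L x s p \<in> sym_mats - U"
proof -
  define \<phi> where "\<phi> = (\<lambda>y. s + p \<bullet> (y - x) + ((y - x) \<bullet> (X *v (y - x))) / 2)"
  note \<phi> = quadratic_test_function[OF X, where c = s and g = p and a = x, folded \<phi>_def]
  have "\<forall>\<^sub>F y in nhds x. ereal (\<phi> y) \<le> w y"
    unfolding eventually_nhds_metric
  proof (intro exI[of _ r] conjI allI impI r(1))
    fix y assume "dist y x < r"
    then show "ereal (\<phi> y) \<le> w y" using r(2)[of "y - x"] by (simp add: \<phi>_def dist_norm)
  qed
  moreover have \<phi>x: "\<phi> x = s" by (simp add: \<phi>_def)
  ultimately have "F_op L \<phi> x \<in> sym_mats - U"
    using super x \<phi>(1)[of \<Omega>] unfolding viscosity_supersolution_def by (metis (no_types, lifting))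
  then show ?thesis by (simp add: F_op_def \<phi> \<phi>x)
qed

section \<open>Semicontinuous functions and the strict comparison of matrices\<close>

lemma USC_closed_superlevel:
  fixes S :: "'a::metric_space set"
  assumes "\<psi> \<in> USC S" "closed S"
  shows "closed {x\<in>S. c \<le> \<psi> x}"
  unfolding closed_limpt
proof (intro allI impI)
  fix x assume lp: "x islimpt {x\<in>S. c \<le> \<psi> x}"
  then have xS: "x \<in> S"
    using \<open>closed S\<close> islimpt_subset[OF lp, of S] unfolding closed_limpt by auto
  have "c \<le> \<psi> x"
  proof (rule ccontr)
    assume "\<not> c \<le> \<psi> x"
    then have "Limsup (at x within S) \<psi> < c" using assms(1) xS unfolding USC_def by force
    then have "\<forall>\<^sub>F y in at x within S. \<psi> y < c" by (rule Limsup_lessD)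
    then obtain d where d: "d > 0" "\<And>y. y \<in> S \<Longrightarrow> y \<noteq> x \<Longrightarrow> dist y x < d \<Longrightarrow> \<psi> y < c"
      unfolding eventually_at by auto
    obtain y where "y \<in> {x\<in>S. c \<le> \<psi> x}" "y \<noteq> x" "dist y x < d"
      using lp d(1) unfolding islimpt_approachable by blast
    then show False using d(2)[of y] by auto
  qed
  then show "x \<in> {x\<in>S. c \<le> \<psi> x}" using xS by simp
qed

lemma LSC_uminus: "\<psi> \<in> LSC S \<Longrightarrow> (\<lambda>x. - \<psi> x) \<in> USC S"
  by (auto simp: LSC_def USC_def ereal_Limsup_uminus ereal_uminus_eq_reorder)

lemma LSC_closed_sublevel:
  fixes S :: "'a::metric_space set"
  assumes "\<psi> \<in> LSC S" "closed S"
  shows "closed {x\<in>S. \<psi> x \<le> c}"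
  using USC_closed_superlevel[OF LSC_uminus[OF assms(1)] assms(2), of "- c"] by simp

lemma USC_bounded_above:
  fixes S :: "'a::metric_space set"
  assumes "\<psi> \<in> USC S" "compact S"
  obtains M where "M \<ge> 0" "\<And>x. x \<in> S \<Longrightarrow> \<psi> x \<le> ereal M"
proof -
  have "S \<subseteq> (\<Union>n\<in>(UNIV :: nat set). - {x\<in>S. ereal (real n) \<le> \<psi> x})"
  proof
    fix x assume "x \<in> S"
    then have "\<psi> x \<noteq> \<infinity>" using assms(1) by (simp add: USC_def)
    then obtain n where "\<psi> x < ereal (real n)"
      using less_PInf_Ex_of_nat[of "\<psi> x"] by auto
    then show "x \<in> (\<Union>n\<in>(UNIV :: nat set). - {x\<in>S. ereal (real n) \<le> \<psi> x})"
      by (intro UN_I[of n]) (simp_all add: not_le)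
  qed
  moreover have "open (- {x\<in>S. ereal (real n) \<le> \<psi> x})" for n
    using USC_closed_superlevel[OF assms(1) compact_imp_closed[OF assms(2)]] by (simp add: open_Compl)
  ultimately obtain C where C: "finite C" "S \<subseteq> (\<Union>n\<in>C. - {x\<in>S. ereal (real n) \<le> \<psi> x})"
    using compactE_image[OF assms(2), of "UNIV :: nat set" "\<lambda>n. - {x\<in>S. ereal (real n) \<le> \<psi> x}"] by auto
  show ?thesis
  proof (rule that)
    show "real (Max (insert 0 C)) \<ge> 0" by simp
    fix x assume x: "x \<in> S"
    then obtain n where n: "n \<in> C" "\<psi> x < ereal (real n)" using C(2) by (force simp: not_le)
    then have "real n \<le> real (Max (insert 0 C))" using C(1) by simp
    then show "\<psi> x \<le> ereal (real (Max (insert 0 C)))" using n(2) by (metis ereal_less_eq(3) less_imp_le order_trans)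
  qed
qed

text \<open>A point of \<open>U\<close> closer to \<open>A\<close> than \<open>l\<close> still lies
  strictly below \<open>C\<close>, because the quadratic form of a matrix is bounded by its
  norm.\<close>

lemma in_U_if_above_closure:
  fixes U :: "(real ^ 'n ^ 'n) set"
  assumes U: "U \<subseteq> sym_mats"
    and up: "\<And>A B. A \<in> U \<Longrightarrow> B \<in> sym_mats \<Longrightarrow> pos_definite B \<Longrightarrow> A + B \<in> U"
    and A: "A \<in> closure U" and C: "C \<in> sym_mats" and "l > 0"
    and gap: "\<And>\<xi>. l * (norm \<xi>)\<^sup>2 \<le> \<xi> \<bullet> ((C - A) *v \<xi>)"
  shows "C \<in> U"
proof -
  obtain A' where A': "A' \<in> U" "dist A' A < l" using A \<open>l > 0\<close> by (meson closure_approachable)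
  have s: "C - A' \<in> sym_mats" using C A' U by (intro sym_mats_diff) auto
  have "0 < \<xi> \<bullet> ((C - A') *v \<xi>)" if "\<xi> \<noteq> 0" for \<xi>
  proof -
    have "C - A' = (C - A) - (A' - A)" by simp
    then have "\<xi> \<bullet> ((C - A') *v \<xi>) = \<xi> \<bullet> ((C - A) *v \<xi>) - \<xi> \<bullet> ((A' - A) *v \<xi>)"
      by (simp only: matrix_vector_mult_diff_rdistrib inner_diff_right)
    moreover have "\<xi> \<bullet> ((A' - A) *v \<xi>) \<le> norm (A' - A) * (norm \<xi>)\<^sup>2"
      using abs_quadratic_form_le abs_le_D1 by blast
    moreover have "norm (A' - A) * (norm \<xi>)\<^sup>2 < l * (norm \<xi>)\<^sup>2"
      using A'(2) that by (simp add: dist_norm)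
    ultimately show ?thesis using gap[of \<xi>] by linarith
  qed
  then have "pos_definite (C - A')" using s by (simp add: pos_definite_def)
  from up[OF A'(1) s this] show ?thesis by simp
qed

text \<open>The second-order chain rule for \<open>f\<close> of a quadratic polynomial. Concavity of
  \<open>f\<close> enters through the rank-one term
  \<open>f2 * (q \<bullet> h)\<^sup>2\<close>.\<close>

lemma composed_quadratic_expansion:
  fixes f f1 :: "real \<Rightarrow> real" and Z :: "real ^ 'n ^ 'n"
  assumes f: "\<And>s. (f has_real_derivative f1 s) (at s)" and f1: "(f1 has_real_derivative f2) (at s)"
    and Z: "Z \<in> sym_mats" and "\<rho> > 0"
  obtains r where "r > 0"
    "\<And>h. norm h < r \<Longrightarrow> f (s + q \<bullet> h + (h \<bullet> (Z *v h)) / 2)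
       \<le> f s + f1 s * (q \<bullet> h) + (f2 * (q \<bullet> h)\<^sup>2 + f1 s * (h \<bullet> (Z *v h))) / 2 + \<rho> * (norm h)\<^sup>2"
proof -
  define T where "T = (\<lambda>h. s + q \<bullet> h + (h \<bullet> (Z *v h)) / 2)"
  have dT: "(T has_derivative (\<lambda>k. (q + Z *v h) \<bullet> k)) (at h)" for h
    using quadratic_has_derivative[OF Z, of s q 0 h] by (simp add: T_def)
  define G where "G = (\<lambda>h. f1 (T h) *\<^sub>R (q + Z *v h))"
  have dF: "((\<lambda>h. f (T h)) has_derivative (\<lambda>k. G h \<bullet> k)) (at h)" for h
    using has_derivative_compose[OF dT f[of "T h", unfolded has_field_derivative_def]] by (simp add: G_def)
  have T0: "T 0 = s" by (simp add: T_def)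
  have "((\<lambda>h. f1 (T h)) has_derivative (\<lambda>k. f2 * (q \<bullet> k))) (at 0)"
    using has_derivative_compose[OF dT[of 0], of f1 "\<lambda>k. f2 * k"] f1 by (simp add: T0 has_field_derivative_def)
  moreover have "((\<lambda>h. q + Z *v h) has_derivative (\<lambda>k. Z *v k)) (at 0)"
    using bounded_linear_imp_has_derivative[OF matrix_vector_mul_bounded_linear[of Z]]
    by (auto intro!: derivative_eq_intros)
  ultimately have dG: "(G has_derivative (\<lambda>k. f1 s *\<^sub>R (Z *v k) + (f2 * (q \<bullet> k)) *\<^sub>R q)) (at 0)"
    unfolding G_def using has_derivative_scaleR[of "\<lambda>h. f1 (T h)" "\<lambda>k. f2 * (q \<bullet> k)" 0 UNIV "\<lambda>h. q + Z *v h" "\<lambda>k. Z *v k"]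
    by (simp add: T0)
  obtain r where r: "r > 0" "\<And>k. norm k < r \<Longrightarrow>
      \<bar>f (T (0 + k)) - f (T 0) - G 0 \<bullet> k - (k \<bullet> (f1 s *\<^sub>R (Z *v k) + (f2 * (q \<bullet> k)) *\<^sub>R q)) / 2\<bar> \<le> \<rho> * (norm k)\<^sup>2"
    using second_order_taylor[OF dF dG \<open>\<rho> > 0\<close>] by blast
  show ?thesis
  proof (rule that[OF r(1)])
    fix h :: "real ^ 'n" assume "norm h < r"
    then have "f (T h) - f s - f1 s * (q \<bullet> h) - (f1 s * (h \<bullet> (Z *v h)) + f2 * (q \<bullet> h)\<^sup>2) / 2 \<le> \<rho> * (norm h)\<^sup>2"
      using r(2)[of h] by (simp add: T0 G_def inner_add_right abs_le_iff power2_eq_square inner_commute mult_ac)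
    then show "f (s + q \<bullet> h + (h \<bullet> (Z *v h)) / 2)
       \<le> f s + f1 s * (q \<bullet> h) + (f2 * (q \<bullet> h)\<^sup>2 + f1 s * (h \<bullet> (Z *v h))) / 2 + \<rho> * (norm h)\<^sup>2"
      by (simp add: T_def add.commute)
  qed
qed

lemma usc_on_mono_compose:
  fixes D :: "'a::metric_space set"
  assumes usc: "usc_on D a" and "closed D" and g: "mono g" "continuous_on UNIV g"
  shows "usc_on D (\<lambda>x. g (a x))"
  unfolding usc_on_def closed_sequential_limits
proof (intro allI impI, elim conjE)
  fix c s x assume s: "\<forall>n. s n \<in> {x \<in> D. c \<le> g (a x)}" "s \<longlonglongrightarrow> x"
  then have xD: "x \<in> D" using \<open>closed D\<close> unfolding closed_sequential_limits by blast
  have le: "c \<le> g (a x + e)" if "e > 0" for e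
  proof -
    have "\<forall>\<^sub>F n in sequentially. a (s n) < a x + e"
      using s xD that by (intro usc_on_eventually_less[OF usc]) auto
    then obtain n where "a (s n) < a x + e" by (auto dest: eventually_happens)
    then have "g (a (s n)) \<le> g (a x + e)" using g(1) by (simp add: monoD)
    then show ?thesis using s(1)[rule_format, of n] by simp
  qed
  have "((\<lambda>e. g (a x + e)) \<longlongrightarrow> g (a x + 0)) (at_right 0)"
    by (intro continuous_on_tendsto_compose[OF g(2)] tendsto_intros) auto
  then have "c \<le> g (a x + 0)"
    by (rule tendsto_lowerbound) (auto intro!: exI[of _ 1] le simp: eventually_at_right_field)
  then show "x \<in> {x \<in> D. c \<le> g (a x)}" using xD by simp
qed

text \<open>The arguments of \<open>L\<close> are changed one at a time: value, point, gradient. The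
  first two changes cost \<open>4 * C * \<rho>\<close> and \<open>2 * C * \<rho>\<close> times
  \<open>|p|^m\<close>, which the gain in the dilation step absorbs; the remaining
  \<open>3 / 2 * \<nu>\<close> is \<open>\<nu>\<close> from the term in \<open>\<theta>\<close> and
  \<open>\<nu> / 2\<close> from \<open>e\<close>.\<close>

lemma strict_gap:
  fixes L :: "real ^ 'n \<Rightarrow> real \<Rightarrow> real ^ 'n \<Rightarrow> real ^ 'n ^ 'n"
  assumes ll: "locally_lipschitz_on (\<Omega> \<times> UNIV \<times> UNIV) (\<lambda>(x, s, p). L x s p)"
    and S: "open S" "convex S" "S \<subseteq> \<Omega>" and xy: "x \<in> S" "y \<in> S" "norm (x - y) \<le> 2 * \<rho>"
    and ss: "\<bar>s\<bar> \<le> R" "\<bar>s'\<bar> \<le> R" "s - s' \<le> 4 * \<rho>" and C: "C > 0" and m: "m > 0" and \<rho>: "\<rho> > 0"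
    and Lx: "\<And>x s p. x \<in> \<Omega> \<Longrightarrow> \<bar>s\<bar> \<le> R \<Longrightarrow> (\<lambda>y. L y s p) differentiable (at x) \<Longrightarrow>
           norm (grad (\<lambda>y. L y s p) x) \<le> C * norm p powr m"
    and Ls: "\<And>x s s' p. x \<in> \<Omega> \<Longrightarrow> - R \<le> s \<Longrightarrow> s \<le> s' \<Longrightarrow> s' \<le> R \<Longrightarrow>
           0 \<preceq> L x s' p - L x s p \<and> L x s' p - L x s p \<preceq> (C * (s' - s) * norm p powr m) *\<^sub>R mat 1"
    and Lp: "\<And>p. (\<lambda>q. L y s' q) differentiable (at p) \<Longrightarrow>
           (\<Sum>k\<in>UNIV. p $ k *\<^sub>R grad (\<lambda>q. L y s' q) p $ k) - L y s' p
             + (\<theta> * \<Lambda> * norm (grad (\<lambda>q. L y s' q) p)) *\<^sub>R mat 1 - \<theta> *\<^sub>R mat 1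
           \<preceq> C *\<^sub>R (p \<otimes> p) - (1 / C * norm p powr m) *\<^sub>R mat 1"
    and \<mu>: "0 < \<mu>" "\<mu> \<le> 1" and \<theta>: "\<mu> * \<theta> = \<nu>" and \<nu>: "\<nu> \<ge> 0" and e: "norm e \<le> \<nu> * \<Lambda>"
      "2 * C * (norm e)\<^sup>2 + norm e powr m / C \<le> \<nu> / 2"
    and small: "6 * C * \<rho> \<le> \<mu> / (4 powr m * C)" and p: "p = (1 + \<mu>) *\<^sub>R q + e"
  shows "\<xi> \<bullet> (L x s p *v \<xi>) \<le> (1 + \<mu>) * (\<xi> \<bullet> (L y s' q *v \<xi>)) + 8 * C * \<mu> * (q \<bullet> \<xi>)\<^sup>2 + 3 / 2 * \<nu> * (norm \<xi>)\<^sup>2"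
proof -
  define P where "P = norm p powr m"
  define n where "n = (norm \<xi>)\<^sup>2"
  have P0: "P \<ge> 0" and n0: "n \<ge> 0" by (simp_all add: P_def n_def)
  have x\<Omega>: "x \<in> \<Omega>" "y \<in> \<Omega>" using xy S by auto
  \<comment> \<open>Only an upper bound on \<open>s - s'\<close> is available; for
    \<open>s \<le> s'\<close> monotonicity of \<open>L\<close> in the value settles the
    matter.\<close>
  have 1: "\<xi> \<bullet> (L x s p *v \<xi>) \<le> \<xi> \<bullet> (L x s' p *v \<xi>) + 4 * C * \<rho> * P * n"
  proof (cases "s \<le> s'")
    case True
    then have "\<xi> \<bullet> (0 *v \<xi>) \<le> \<xi> \<bullet> ((L x s' p - L x s p) *v \<xi>)"
      using Ls[OF x\<Omega>(1), of s s' p] ss by (intro mat_le_quadratic_form) auto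
    then have "0 \<le> \<xi> \<bullet> ((L x s' p - L x s p) *v \<xi>)" by simp
    moreover have "4 * C * \<rho> * P * n \<ge> 0" using C \<rho> P0 n0 by simp
    ultimately show ?thesis
      unfolding matrix_vector_mult_diff_rdistrib inner_diff_right by linarith
  next
    case False
    then have "\<xi> \<bullet> ((L x s p - L x s' p) *v \<xi>) \<le> \<xi> \<bullet> (((C * (s - s') * norm p powr m) *\<^sub>R mat 1) *v \<xi>)"
      using Ls[OF x\<Omega>(1), of s' s p] ss by (intro mat_le_quadratic_form) auto
    then have "\<xi> \<bullet> (L x s p *v \<xi>) - \<xi> \<bullet> (L x s' p *v \<xi>) \<le> C * (s - s') * P * n"
      unfolding quadratic_form_mat_1 by (simp add: matrix_vector_mult_diff_rdistrib inner_diff_right P_def n_def)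
    also have "\<dots> \<le> C * (4 * \<rho>) * P * n"
      using ss C P0 n0 by (intro mult_right_mono mult_left_mono) auto
    finally show ?thesis by simp
  qed
  have 2: "\<xi> \<bullet> (L x s' p *v \<xi>) - \<xi> \<bullet> (L y s' p *v \<xi>) \<le> 2 * C * \<rho> * P * n"
  proof -
    have "locally_lipschitz_on S (\<lambda>y. L y s' p)"
      using locally_lipschitz_on_slices(1)[OF ll] S(3) unfolding locally_lipschitz_on_def
      by (meson Int_mono lipschitz_on_subset order_refl subsetD)
    moreover have "norm (grad (\<lambda>y. L y s' p) z) \<le> C * P"
      if "z \<in> S" "(\<lambda>y. L y s' p) differentiable (at z)" for z
      unfolding P_def using that S(3) ss(2) by (intro Lx) auto
    ultimately have "\<xi> \<bullet> (L x s' p *v \<xi>) - \<xi> \<bullet> (L y s' p *v \<xi>) \<le> C * P * norm (x - y) * n"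
      unfolding n_def by (rule quadratic_form_increment_le[OF S(1,2) _ _ xy(2,1)])
    also have "\<dots> \<le> C * P * (2 * \<rho>) * n"
      using xy C P0 n0 by (intro mult_right_mono mult_left_mono) auto
    finally show ?thesis by (simp add: mult_ac)
  qed
  have "norm e \<le> \<mu> * \<theta> * \<Lambda>" using e \<theta> by simp
  from dilation_inequality[OF locally_lipschitz_on_slices(2)[OF ll x\<Omega>(2)] C m Lp \<mu> this, of \<xi> q]
  have "\<xi> \<bullet> (L y s' p *v \<xi>) \<le> (1 + \<mu>) * (\<xi> \<bullet> (L y s' q *v \<xi>)) +
     \<mu> * (8 * C * (q \<bullet> \<xi>)\<^sup>2 + (2 * C * (norm e)\<^sup>2 + norm e powr m / C + \<theta> - P / (4 powr m * C)) * n)"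
    by (simp add: p P_def n_def)
  also have "\<mu> * (8 * C * (q \<bullet> \<xi>)\<^sup>2 + (2 * C * (norm e)\<^sup>2 + norm e powr m / C + \<theta> - P / (4 powr m * C)) * n)
    = 8 * C * \<mu> * (q \<bullet> \<xi>)\<^sup>2 + (\<mu> * (2 * C * (norm e)\<^sup>2 + norm e powr m / C) + \<nu> - (\<mu> / (4 powr m * C)) * P) * n"
    unfolding \<theta>[symmetric] by (simp add: algebra_simps)
  finally have 3: "\<xi> \<bullet> (L y s' p *v \<xi>) \<le> (1 + \<mu>) * (\<xi> \<bullet> (L y s' q *v \<xi>)) + (8 * C * \<mu> * (q \<bullet> \<xi>)\<^sup>2 +
      (\<mu> * (2 * C * (norm e)\<^sup>2 + norm e powr m / C) + \<nu> - (\<mu> / (4 powr m * C)) * P) * n)" .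
  have "\<mu> * (2 * C * (norm e)\<^sup>2 + norm e powr m / C) \<le> 1 * (\<nu> / 2)"
    using e C \<mu> by (intro mult_mono) auto
  moreover have "6 * C * \<rho> * P \<le> (\<mu> / (4 powr m * C)) * P" using small P0 by (intro mult_right_mono)
  ultimately have "\<mu> * (2 * C * (norm e)\<^sup>2 + norm e powr m / C) + \<nu> - (\<mu> / (4 powr m * C)) * P + 6 * C * \<rho> * P \<le> 3 / 2 * \<nu>"
    by simp
  then have "(\<mu> * (2 * C * (norm e)\<^sup>2 + norm e powr m / C) + \<nu> - (\<mu> / (4 powr m * C)) * P + 6 * C * \<rho> * P) * n \<le> 3 / 2 * \<nu> * n"
    using n0 by (intro mult_right_mono)
  then have "(\<mu> * (2 * C * (norm e)\<^sup>2 + norm e powr m / C) + \<nu> - (\<mu> / (4 powr m * C)) * P) * n + 6 * C * \<rho> * P * n \<le> 3 / 2 * \<nu> * n"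
    by (simp only: distrib_right)
  then show ?thesis using 1 2 3 unfolding n_def by linarith
qed

text \<open>Keeps quadratic test functions within the truncation levels \<open>- R\<close> and
  \<open>R\<close> near the contact point.\<close>

lemma quadratic_small_near_0:
  fixes X :: "real ^ 'n ^ 'n"
  assumes "\<epsilon> > 0"
  obtains r where "r > 0" "\<And>h. norm h < r \<Longrightarrow> \<bar>g \<bullet> h + (h \<bullet> (X *v h)) / 2\<bar> < \<epsilon>"
proof -
  define c where "c = norm g + norm X + 1"
  have c: "c > 0" by (simp add: c_def add_nonneg_pos)
  show ?thesis
  proof (rule that)
    show "min 1 (\<epsilon> / c) > 0" using assms c by simp
    fix h :: "real ^ 'n" assume h: "norm h < min 1 (\<epsilon> / c)"
    have "\<bar>g \<bullet> h\<bar> \<le> norm g * norm h" by (rule Cauchy_Schwarz_ineq2)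
    moreover have "\<bar>h \<bullet> (X *v h)\<bar> \<le> norm X * (norm h)\<^sup>2" by (rule abs_quadratic_form_le)
    moreover have "norm X * (norm h)\<^sup>2 \<le> norm X * norm h"
      using h by (intro mult_left_mono) (auto simp: power2_eq_square mult_left_le_one_le)
    moreover have "norm X * norm h \<ge> 0" by simp
    moreover have "norm g * norm h + norm X * norm h \<le> c * norm h"
      by (simp add: c_def distrib_right)
    moreover have "c * norm h < \<epsilon>" using h c by (simp add: pos_less_divide_eq mult.commute)
    ultimately show "\<bar>g \<bullet> h + (h \<bullet> (X *v h)) / 2\<bar> < \<epsilon>" by linarith
  qed
qed

text \<open>Since \<open>m > 1\<close>, both terms on the left are of higher order than
  \<open>\<nu>\<close>.\<close>

lemma ex_small_superlinear:
  fixes a b m t :: real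
  assumes "m > 1" "t > 0" "0 < a" "0 < c"
  obtains \<nu> where "0 < \<nu>" "\<nu> \<le> t" "b * (a * \<nu>)\<^sup>2 + (a * \<nu>) powr m / c \<le> \<nu> / 2"
proof -
  have "((\<lambda>\<nu>. \<nu> powr (m - 1)) \<longlongrightarrow> 0 powr (m - 1)) (at_right 0)"
    using assms by (intro tendsto_powr' tendsto_ident_at tendsto_const)
      (auto simp: eventually_at_right_field intro: exI[of _ 1])
  from tendsto_add[OF tendsto_mult[OF tendsto_const[of "b * a\<^sup>2"] tendsto_ident_at]
      tendsto_divide[OF tendsto_mult[OF tendsto_const[of "a powr m"] this] tendsto_const[of c]]]
  have "((\<lambda>\<nu>. b * a\<^sup>2 * \<nu> + a powr m * \<nu> powr (m - 1) / c) \<longlongrightarrow> 0) (at_right 0)"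
    using assms by simp
  then have "\<forall>\<^sub>F \<nu> in at_right 0. b * a\<^sup>2 * \<nu> + a powr m * \<nu> powr (m - 1) / c < 1 / 2"
    by (rule order_tendstoD(2)) simp
  then obtain d where d: "d > 0" "\<And>\<nu>. 0 < \<nu> \<Longrightarrow> \<nu> < d \<Longrightarrow> b * a\<^sup>2 * \<nu> + a powr m * \<nu> powr (m - 1) / c < 1 / 2"
    unfolding eventually_at_right_field by auto
  define \<nu> where "\<nu> = min t (d / 2)"
  have \<nu>: "0 < \<nu>" "\<nu> \<le> t" "\<nu> < d" using assms d(1) by (auto simp: \<nu>_def)
  have "\<nu> powr m = \<nu> * \<nu> powr (m - 1)" using \<nu> by (simp add: powr_diff)
  then have "b * (a * \<nu>)\<^sup>2 + (a * \<nu>) powr m / c = \<nu> * (b * a\<^sup>2 * \<nu> + a powr m * \<nu> powr (m - 1) / c)"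
    using assms \<nu> by (simp add: powr_mult power2_eq_square algebra_simps)
  also have "\<dots> \<le> \<nu> * (1 / 2)" using d(2)[OF \<nu>(1,3)] \<nu> by (intro mult_left_mono) auto
  finally show ?thesis using that \<nu> by simp
qed

theorem theorem3p2:
  fixes \<Omega> :: "(real ^ 'n) set"
    and L :: "real ^ 'n \<Rightarrow> real \<Rightarrow> real ^ 'n \<Rightarrow> real ^ 'n ^ 'n"
    and U :: "(real ^ 'n ^ 'n) set"
    and m :: real
    and w v :: "real ^ 'n \<Rightarrow> ereal"
  assumes "CARD('n) \<ge> 2"
    and "\<Omega> \<noteq> {}" and "bounded \<Omega>" and "open \<Omega>"
    and "\<And>x s p. x \<in> \<Omega> \<Longrightarrow> L x s p \<in> sym_mats"
    and "locally_lipschitz_on (\<Omega> \<times> UNIV \<times> UNIV) (\<lambda>(x, s, p). L x s p)"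
    and "m > 1"
    and "\<And>R \<Lambda>. R > 0 \<Longrightarrow> \<Lambda> > 0 \<Longrightarrow>
      \<exists>\<theta>\<^sub>0>0. \<exists>C>0. \<forall>x\<in>\<Omega>. \<forall>p.
        (\<forall>s. \<bar>s\<bar> \<le> R \<longrightarrow> (\<lambda>y. L y s p) differentiable (at x) \<longrightarrow>
           norm (grad (\<lambda>y. L y s p) x) \<le> C * norm p powr m) \<and>
        (\<forall>s s'. -R \<le> s \<and> s \<le> s' \<and> s' \<le> R \<longrightarrow>
           0 \<preceq> L x s' p - L x s p \<and>
           L x s' p - L x s p \<preceq> (C * (s' - s) * norm p powr m) *\<^sub>R mat 1) \<and>
        (\<forall>\<theta>\<in>{0..\<theta>\<^sub>0}. \<forall>s. \<bar>s\<bar> \<le> R \<longrightarrow> (\<lambda>q. L x s q) differentiable (at p) \<longrightarrow>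
           (\<Sum>k\<in>UNIV. p $ k *\<^sub>R grad (\<lambda>q. L x s q) p $ k) - L x s p
             + (\<theta> * \<Lambda> * norm (grad (\<lambda>q. L x s q) p)) *\<^sub>R mat 1 - \<theta> *\<^sub>R mat 1
           \<preceq> C *\<^sub>R (p \<otimes> p) - (1 / C * norm p powr m) *\<^sub>R mat 1)"
    and "U \<noteq> {}" and "openin (top_of_set sym_mats) U"
    and "\<And>A B. A \<in> U \<Longrightarrow> B \<in> sym_mats \<Longrightarrow> pos_definite B \<Longrightarrow> A + B \<in> U"
    and "\<And>A c. A \<in> U \<Longrightarrow> c \<in> {0<..<1} \<Longrightarrow> c *\<^sub>R A \<in> U"
    and "w \<in> LSC (closure \<Omega>)" and "viscosity_supersolution L U \<Omega> w"
    and "v \<in> USC (closure \<Omega>)" and "viscosity_subsolution L U \<Omega> v"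
    and "\<And>x. x \<in> \<Omega> \<Longrightarrow> w x \<ge> v x"
    and "\<And>x. x \<in> frontier \<Omega> \<Longrightarrow> w x > v x"
  shows "\<forall>x\<in>\<Omega>. w x > v x"
proof (rule ccontr)
  note bnd = assms(3) and op = assms(4) and ll = assms(6) and m = assms(7)
    and str = assms(8) and Uopen = assms(10) and Uup = assms(11) and Uscale = assms(12)
    and wL = assms(13) and super = assms(14) and vU = assms(15) and sub = assms(16)
    and wv = assms(17) and wvf = assms(18)
  assume "\<not> ?thesis"
  then obtain x0 where x0: "x0 \<in> \<Omega>" "\<not> v x0 < w x0" by blast
  then have eq0: "w x0 = v x0" using wv[OF x0(1)] by (simp add: order_antisym)
  define K where "K = closure \<Omega>"
  have cK: "compact K" and clK: "closed K" using bnd by (auto simp: K_def)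
  have \<Omega>K: "\<Omega> \<subseteq> K" by (simp add: K_def closure_subset)
  obtain Mv where Mv: "Mv \<ge> 0" "\<And>x. x \<in> K \<Longrightarrow> v x \<le> ereal Mv"
    using USC_bounded_above[OF vU] cK by (metis K_def)
  obtain Mw where Mw: "Mw \<ge> 0" "\<And>x. x \<in> K \<Longrightarrow> - w x \<le> ereal Mw"
    using USC_bounded_above[OF LSC_uminus[OF wL]] cK by (metis K_def)
  obtain B where B: "\<And>y. y \<in> K \<Longrightarrow> norm y \<le> B" using compact_imp_bounded[OF cK] by (auto simp: bounded_iff)
  define R1 where "R1 = max 1 B"
  have R1: "R1 \<ge> 1" "\<And>y. y \<in> K \<Longrightarrow> norm y \<le> R1" using B by (force simp: R1_def le_max_iff_disj)+
  \<comment> \<open>The perturbations by \<open>f\<close>, by \<open>\<nu>\<close> and by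
    \<open>\<rho>\<close> each cost at most 1, so the margin 5 keeps the contact values strictly
    inside the truncation. The factor in \<open>\<Lambda>\<close> anticipates
    \<open>|e| \<le> 3 * R1 * \<nu>\<close>.\<close>
  define R where "R = Mv + Mw + 5"
  define \<Lambda> where "\<Lambda> = 3 * R1"
  have "R > 0" "\<Lambda> > 0" using Mv Mw R1 by (auto simp: R_def \<Lambda>_def)
  from str[OF this] obtain \<theta>0 C where \<theta>0: "\<theta>0 > 0" and C: "C > 0" and
    Lx: "\<And>x s p. x \<in> \<Omega> \<Longrightarrow> \<bar>s\<bar> \<le> R \<Longrightarrow> (\<lambda>y. L y s p) differentiable (at x) \<Longrightarrow>
           norm (grad (\<lambda>y. L y s p) x) \<le> C * norm p powr m" and
    Ls: "\<And>x s s' p. x \<in> \<Omega> \<Longrightarrow> - R \<le> s \<Longrightarrow> s \<le> s' \<Longrightarrow> s' \<le> R \<Longrightarrow>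
           0 \<preceq> L x s' p - L x s p \<and> L x s' p - L x s p \<preceq> (C * (s' - s) * norm p powr m) *\<^sub>R mat 1" and
    Lp: "\<And>x \<theta> s p. x \<in> \<Omega> \<Longrightarrow> \<theta> \<in> {0..\<theta>0} \<Longrightarrow> \<bar>s\<bar> \<le> R \<Longrightarrow> (\<lambda>q. L x s q) differentiable (at p) \<Longrightarrow>
           (\<Sum>k\<in>UNIV. p $ k *\<^sub>R grad (\<lambda>q. L x s q) p $ k) - L x s p
             + (\<theta> * \<Lambda> * norm (grad (\<lambda>q. L x s q) p)) *\<^sub>R mat 1 - \<theta> *\<^sub>R mat 1
           \<preceq> C *\<^sub>R (p \<otimes> p) - (1 / C * norm p powr m) *\<^sub>R mat 1"
    by blast
  \<comment> \<open>On these compact sets \<open>v\<close> and \<open>w\<close> are finite, so the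
    real-valued theory applies; points outside are dealt with when test functions are built.\<close>
  define D1 where "D1 = {x\<in>K. ereal (- R) \<le> v x}"
  define D2 where "D2 = {y\<in>K. w y \<le> ereal R}"
  define V where "V = (\<lambda>x. real_of_ereal (v x))"
  define W where "W = (\<lambda>y. real_of_ereal (w y))"
  have V: "v x = ereal (V x)" "- R \<le> V x" "V x \<le> Mv" if "x \<in> D1" for x
  proof -
    have "ereal (- R) \<le> v x" "v x \<le> ereal Mv" using that Mv(2) by (auto simp: D1_def)
    then show "v x = ereal (V x)" "- R \<le> V x" "V x \<le> Mv" by (cases "v x"; simp add: V_def)+
  qed
  have W: "w y = ereal (W y)" "- Mw \<le> W y" "W y \<le> R" if "y \<in> D2" for y
  proof -
    have "w y \<le> ereal R" "- w y \<le> ereal Mw" using that Mw(2) by (auto simp: D2_def)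
    then show "w y = ereal (W y)" "- Mw \<le> W y" "W y \<le> R" by (cases "w y"; simp add: W_def)+
  qed
  have x0K: "x0 \<in> K" using x0 \<Omega>K by blast
  have x0D: "x0 \<in> D1" "x0 \<in> D2" "V x0 = W x0"
  proof -
    have "v x0 \<le> ereal Mv" "- v x0 \<le> ereal Mw" using Mv(2)[OF x0K] Mw(2)[OF x0K] eq0 by auto
    then have "ereal (- R) \<le> v x0" "w x0 \<le> ereal R"
      using Mv(1) Mw(1) unfolding eq0 by (cases "v x0"; simp add: R_def)+
    then show "x0 \<in> D1" "x0 \<in> D2" using x0K by (auto simp: D1_def D2_def)
    show "V x0 = W x0" by (simp add: V_def W_def eq0)
  qed
  have clv: "closed {x\<in>K. c \<le> v x}" for c
    unfolding K_def by (rule USC_closed_superlevel[OF vU closed_closure])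
  have clw: "closed {x\<in>K. w x \<le> c}" for c
    unfolding K_def by (rule LSC_closed_sublevel[OF wL closed_closure])
  have cD1: "compact D1" and cD2: "compact D2"
    using clv clw cK by (auto simp: D1_def D2_def compact_eq_bounded_closed intro: bounded_subset)
  have uV: "usc_on D1 V"
    unfolding usc_on_def
  proof
    fix c
    have "{x\<in>D1. c \<le> V x} = {x\<in>K. ereal (max c (- R)) \<le> v x}"
    proof (intro set_eqI iffI)
      fix x assume "x \<in> {x\<in>D1. c \<le> V x}"
      then show "x \<in> {x\<in>K. ereal (max c (- R)) \<le> v x}" using V[of x] by (auto simp: D1_def)
    next
      fix x assume x: "x \<in> {x\<in>K. ereal (max c (- R)) \<le> v x}"
      then have "ereal (- R) \<le> v x" by (auto intro: order_trans[rotated])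
      then have "x \<in> D1" using x by (simp add: D1_def)
      then show "x \<in> {x\<in>D1. c \<le> V x}" using V[of x] x by auto
    qed
    then show "closed {x\<in>D1. c \<le> V x}" by (simp only: clv)
  qed
  have uW: "usc_on D2 (\<lambda>y. - W y)"
    unfolding usc_on_def
  proof
    fix c
    have "{y\<in>D2. c \<le> - W y} = {y\<in>K. w y \<le> ereal (min R (- c))}"
    proof (intro set_eqI iffI)
      fix y assume "y \<in> {y\<in>D2. c \<le> - W y}"
      then show "y \<in> {y\<in>K. w y \<le> ereal (min R (- c))}" using W[of y] by (auto simp: D2_def)
    next
      fix y assume y: "y \<in> {y\<in>K. w y \<le> ereal (min R (- c))}"
      then have "w y \<le> ereal R" by (auto intro: order_trans)
      then have "y \<in> D2" using y by (simp add: D2_def)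
      then show "y \<in> {y\<in>D2. c \<le> - W y}" using W[of y] y by auto
    qed
    then show "closed {y\<in>D2. c \<le> - W y}" by (simp only: clw)
  qed
  have le_VW: "V x \<le> W x" if "x \<in> D1" "x \<in> D2" for x
  proof -
    have "v x \<le> w x"
    proof (cases "x \<in> \<Omega>")
      case False
      then have "x \<in> frontier \<Omega>" using that op by (auto simp: D1_def K_def frontier_def interior_open)
      then show ?thesis using wvf by (simp add: less_imp_le)
    qed (use wv in auto)
    then show ?thesis using V(1)[OF that(1)] W(1)[OF that(2)] by simp
  qed
  obtain c1 where c1: "c1 > 0" "\<And>x. x \<in> D1 \<Longrightarrow> x \<in> D2 \<Longrightarrow> x \<in> frontier \<Omega> \<Longrightarrow> V x - W x \<le> - c1"
  proof (cases "D1 \<inter> D2 \<inter> frontier \<Omega> = {}")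
    case True
    then show ?thesis by (intro that[of 1]) auto
  next
    case False
    define E where "E = D1 \<inter> D2 \<inter> frontier \<Omega>"
    have cE: "compact E" unfolding E_def by (intro compact_Int_closed compact_Int cD1 cD2 frontier_closed)
    have clE: "closed E" by (rule compact_imp_closed[OF cE])
    have "E \<subseteq> D1" "E \<subseteq> D2" by (auto simp: E_def)
    then have uE: "usc_on E (\<lambda>x. V x + - W x)"
      using usc_on_add[OF usc_on_subset[OF uV _ clE] usc_on_subset[OF uW _ clE] clE] by blast
    have "E \<noteq> {}" using False by (simp add: E_def)
    then obtain z where z: "z \<in> E" "\<And>x. x \<in> E \<Longrightarrow> V x + - W x \<le> V z + - W z"
      by (rule usc_on_attains_sup[OF uE cE]) blast
    have "ereal (V z) < ereal (W z)" using wvf[of z] V(1)[of z] W(1)[of z] z(1) by (simp add: E_def)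
    then show ?thesis using z(2) by (intro that[of "W z - V z"]) (force simp: E_def)+
  qed
  \<comment> \<open>Gives slope excess at most 1 and a displacement \<open>s - f s\<close> of at
    most \<open>c1 / 4\<close> and at most 1 for \<open>s \<ge> - R\<close>.\<close>
  define \<beta> where "\<beta> = min 1 (min (2 * C * c1) (8 * C))"
  have \<beta>: "0 < \<beta>" "\<beta> \<le> 1" "\<beta> / (8 * C) \<le> c1 / 4" "\<beta> / (8 * C) \<le> 1"
  proof -
    show "0 < \<beta>" "\<beta> \<le> 1" using C c1(1) by (auto simp: \<beta>_def)
    have "\<beta> \<le> 2 * C * c1" "\<beta> \<le> 8 * C" by (auto simp: \<beta>_def)
    then show "\<beta> / (8 * C) \<le> c1 / 4" "\<beta> / (8 * C) \<le> 1"
      using C by (auto simp: field_simps)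
  qed
  \<comment> \<open>The decay rate \<open>8 * C\<close> makes the second derivative of
    \<open>f\<close> cancel exactly the term
    \<open>8 * C * \<mu> * (q \<bullet> \<xi>)\<^sup>2\<close> of \<open>strict_gap\<close>.\<close>
  define mu where "mu = (\<lambda>s. \<beta> * exp (- 8 * C * (s + R)))"
  define f where "f = (\<lambda>s. s - mu s / (8 * C))"
  have mu_le: "mu s \<le> \<beta>" if "s \<ge> - R" for s
    using that \<beta> C by (simp add: mu_def mult_left_le)
  have mu_pos: "mu s > 0" for s using \<beta> by (simp add: mu_def)
  have mu_anti: "mu t \<le> mu s" if "s \<le> t" for s t
    using that \<beta> C by (simp add: mu_def mult_left_mono)
  define \<mu>0 where "\<mu>0 = mu R"
  have \<mu>0: "0 < \<mu>0" "\<And>s. s \<le> R \<Longrightarrow> \<mu>0 \<le> mu s" using mu_pos mu_anti by (auto simp: \<mu>0_def)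
  have dmu: "(mu has_real_derivative (- 8 * C * mu s)) (at s)" for s
    unfolding mu_def by (auto intro!: derivative_eq_intros)
  have df: "(f has_real_derivative (1 + mu s)) (at s)" for s
    unfolding f_def using C by (auto intro!: derivative_eq_intros dmu)
  have f_exp: "f s + (t - s) \<le> f t" if "s \<le> t" for s t
    using mu_anti[OF that] C by (simp add: f_def divide_right_mono)
  have f_mono: "f s < f t \<longleftrightarrow> s < t" for s t
    using f_exp[of s t] f_exp[of t s] by linarith
  have f_le: "f s \<le> s" for s using mu_pos[of s] C by (simp add: f_def less_imp_le)
  have f_ge: "s - \<beta> / (8 * C) \<le> f s" if "s \<ge> - R" for s
    using mu_le[OF that] C by (simp add: f_def divide_right_mono)
  \<comment> \<open>Upper bounds for \<open>\<nu>\<close>: the quadratic perturbation stays below 1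
    and below \<open>c1 / 4\<close> on \<open>K\<close>, and
    \<open>\<nu> / \<mu> \<le> \<theta>0\<close>.\<close>
  define t where "t = min (1 / R1\<^sup>2) (min (c1 / (4 * R1\<^sup>2)) (\<theta>0 * \<mu>0))"
  have R1sq: "R1\<^sup>2 > 0" using R1 by simp
  have t: "t > 0" "3 * R1 > 0" using R1 R1sq c1 \<theta>0 \<mu>0 by (simp_all add: t_def)
  obtain \<nu> where \<nu>: "0 < \<nu>" "\<nu> \<le> t"
      "2 * C * (3 * R1 * \<nu>)\<^sup>2 + (3 * R1 * \<nu>) powr m / C \<le> \<nu> / 2"
    by (rule ex_small_superlinear[OF m t C, of "2 * C"])
  have \<nu>R: "\<nu> * R1\<^sup>2 \<le> 1" "\<nu> * R1\<^sup>2 \<le> c1 / 4" "\<nu> \<le> \<theta>0 * \<mu>0"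
    using \<nu>(2) R1sq by (auto simp: t_def field_simps)
  have \<nu>R1: "\<nu> * R1 \<le> 1"
  proof -
    have "\<nu> * R1 \<le> \<nu> * R1\<^sup>2" using \<nu> R1 by (intro mult_left_mono) (auto simp: power2_eq_square)
    then show ?thesis using \<nu>R by linarith
  qed
  define b where "b = (\<lambda>y. - f (W y) + \<nu> * (norm y)\<^sup>2)"
  have ub: "usc_on D2 b"
  proof -
    have "mono (\<lambda>t. - f (- t))"
    proof (rule monoI)
      fix s t :: real assume "s \<le> t"
      then show "- f (- s) \<le> - f (- t)" using f_exp[of "- t" "- s"] by simp
    qed
    moreover have cf: "continuous_on UNIV f"
      using df DERIV_isCont by (blast intro: continuous_at_imp_continuous_on)
    have "continuous_on UNIV (\<lambda>t. - f (- t))"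
      by (rule continuous_on_minus, rule continuous_on_compose2[OF cf]) (auto intro: continuous_intros)
    ultimately have "usc_on D2 (\<lambda>y. - f (- (- W y)))"
      by (rule usc_on_mono_compose[OF uW compact_imp_closed[OF cD2]])
    then show ?thesis
      unfolding b_def
      by (intro usc_on_add_continuous compact_imp_closed cD2 continuous_intros) simp_all
  qed
  \<comment> \<open>As \<open>f s \<le> s\<close>, the perturbed \<open>w\<close> lies at or below
    \<open>v\<close> at the touching point, so the doubled maximum is at least nearly
    non-negative.\<close>
  have base: "0 \<le> V x0 + b x0"
  proof -
    have "0 \<le> \<nu> * (norm x0)\<^sup>2" using \<nu>(1) by simp
    then show ?thesis using f_le[of "W x0"] x0D(3) unfolding b_def by linarith
  qed
  have nb: "\<nu> * (norm y)\<^sup>2 \<le> \<nu> * R1\<^sup>2" if "y \<in> K" for y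
    using R1(2)[OF that] \<nu> by (intro mult_left_mono power_mono) auto
  obtain x1 where x1: "x1 \<in> D1" "x1 \<in> D2" "V x0 + b x0 \<le> V x1 + b x1" and
    near: "\<And>\<rho>. \<rho> > 0 \<Longrightarrow> \<exists>p x y q T r. norm p < \<rho> \<and> x \<in> D1 \<and> y \<in> D2 \<and> norm (x - x1) < \<rho> \<and> norm (y - x1) < \<rho> \<and>
      V x < V x1 + \<rho> \<and> b y < b x1 + \<rho> \<and> V x0 + b x0 - \<rho> < V x + b y \<and> linear T \<and> r > 0 \<and>
      (\<forall>h. norm h < r \<longrightarrow> x + h \<in> D1 \<longrightarrow> V (x + h) \<le> V x + q \<bullet> h + (h \<bullet> T h) / 2 + \<rho> * (norm h)\<^sup>2) \<and>
      (\<forall>h. norm h < r \<longrightarrow> y + h \<in> D2 \<longrightarrow> b (y + h) \<le> b y + (p - q) \<bullet> h - (h \<bullet> T h) / 2 + \<rho> * (norm h)\<^sup>2)"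
    by (rule doubling_limit[OF cD1 uV cD2 ub x0D(1,2)]) blast
  have x1K: "x1 \<in> K" using x1 by (simp add: D1_def)
  have RMw: "- R \<le> - Mw" "Mv \<le> R" using Mv Mw by (simp_all add: R_def)
  \<comment> \<open>On the boundary the gap \<open>c1\<close> exceeds the two perturbations, each at
    most \<open>c1 / 4\<close>.\<close>
  have "x1 \<notin> frontier \<Omega>"
  proof
    assume "x1 \<in> frontier \<Omega>"
    then have "V x1 - W x1 \<le> - c1" using c1(2) x1 by blast
    moreover have "0 \<le> V x1 - f (W x1) + \<nu> * (norm x1)\<^sup>2" using base x1(3) by (simp add: b_def)
    moreover have "W x1 - \<beta> / (8 * C) \<le> f (W x1)" using W(2)[OF x1(2)] RMw by (intro f_ge) simp
    ultimately show False using nb[OF x1K] \<nu>R(2) \<beta>(3) c1(1) by linarith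
  qed
  then have x1\<Omega>: "x1 \<in> \<Omega>" using x1K op by (auto simp: K_def frontier_def interior_open)
  obtain \<delta> where \<delta>: "\<delta> > 0" "ball x1 \<delta> \<subseteq> \<Omega>" using op x1\<Omega> by (meson openE)
  \<comment> \<open>The bound by \<open>\<delta>\<close> keeps both points in one convex ball,
    \<open>\<nu> / 32\<close> keeps the matrix errors, at most \<open>8 * \<rho>\<close>, below
    \<open>\<nu> / 4\<close>, and the last one is the smallness required by
    \<open>strict_gap\<close>.\<close>
  define \<rho> where "\<rho> = min 1 (min \<delta> (min (\<nu> / 32) (\<mu>0 / (4 powr m * C) / (6 * C))))"
  have \<rho>: "\<rho> > 0" "\<rho> \<le> 1" "\<rho> \<le> \<delta>" "\<rho> \<le> \<nu> / 32" "\<rho> \<le> \<mu>0 / (4 powr m * C) / (6 * C)"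
    using \<delta> \<nu> \<mu>0 C by (auto simp: \<rho>_def)
  obtain p0 x y p T r where xy: "norm p0 < \<rho>" "x \<in> D1" "y \<in> D2" "norm (x - x1) < \<rho>" "norm (y - x1) < \<rho>"
    and vals: "V x < V x1 + \<rho>" "b y < b x1 + \<rho>" "V x0 + b x0 - \<rho> < V x + b y"
    and T: "linear T" and r: "r > 0"
    and jv: "\<And>h. norm h < r \<Longrightarrow> x + h \<in> D1 \<Longrightarrow> V (x + h) \<le> V x + p \<bullet> h + (h \<bullet> T h) / 2 + \<rho> * (norm h)\<^sup>2"
    and jw: "\<And>h. norm h < r \<Longrightarrow> y + h \<in> D2 \<Longrightarrow> b (y + h) \<le> b y + (p0 - p) \<bullet> h - (h \<bullet> T h) / 2 + \<rho> * (norm h)\<^sup>2"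
    using near[OF \<rho>(1)] by blast
  have xyb: "x \<in> ball x1 \<delta>" "y \<in> ball x1 \<delta>"
    using xy \<rho>(3) by (auto simp: dist_norm norm_minus_commute)
  have xy\<Omega>: "x \<in> \<Omega>" "y \<in> \<Omega>" using xyb \<delta> by auto
  have yK: "y \<in> K" using xy\<Omega> \<Omega>K by blast
  have Wy: "- R \<le> W y" using W(2)[OF xy(3)] RMw by simp
  have sum: "f (W y) < V x + \<nu> * (norm y)\<^sup>2 + \<rho>" using vals(3) base by (simp add: b_def)
  have Vx: "- R < V x" "\<bar>V x\<bar> \<le> R"
  proof -
    show "- R < V x"
      using sum f_ge[OF Wy] \<beta>(4) W(2)[OF xy(3)] nb[OF yK] \<nu>R(1) \<rho>(2) Mv(1) unfolding R_def by linarith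
    then show "\<bar>V x\<bar> \<le> R" using V(3)[OF xy(2)] RMw by simp
  qed
  have WyR: "W y < R" "\<bar>W y\<bar> \<le> R"
  proof -
    show "W y < R"
      using sum f_ge[OF Wy] \<beta>(4) V(3)[OF xy(2)] nb[OF yK] \<nu>R(1) \<rho>(2) Mw(1) unfolding R_def by linarith
    then show "\<bar>W y\<bar> \<le> R" using Wy by simp
  qed
  \<comment> \<open>The values are compared through \<open>x1\<close>, where
    \<open>V \<le> W\<close>. Since \<open>f\<close> expands distances, closeness of
    \<open>f (W x1)\<close> and \<open>f (W y)\<close> from above passes to
    \<open>W\<close>.\<close>
  have VW: "V x - W y \<le> 4 * \<rho>"
  proof -
    have "(norm x1)\<^sup>2 - (norm y)\<^sup>2 = (norm x1 - norm y) * (norm x1 + norm y)"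
      by (simp add: power2_eq_square algebra_simps)
    also have "\<dots> \<le> \<rho> * (R1 + R1)"
    proof (intro mult_mono add_mono R1(2) x1K yK)
      show "norm x1 - norm y \<le> \<rho>" using norm_triangle_ineq2[of x1 y] xy(5) by (simp add: norm_minus_commute)
    qed (use \<rho> in auto)
    finally have "\<nu> * ((norm x1)\<^sup>2 - (norm y)\<^sup>2) \<le> \<nu> * (\<rho> * (R1 + R1))" using \<nu> by (intro mult_left_mono) auto
    also have "\<dots> = (\<nu> * R1) * (2 * \<rho>)" by simp
    also have "\<dots> \<le> 1 * (2 * \<rho>)" using \<nu>R1 \<rho> by (intro mult_right_mono) auto
    finally have "f (W x1) - f (W y) < 3 * \<rho>" using vals(2) by (simp add: b_def algebra_simps)
    then have "W x1 - W y < 3 * \<rho>"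
      using f_exp[of "W y" "W x1"] \<rho>(1) by (cases "W y \<le> W x1") auto
    then show ?thesis using vals(1) le_VW[OF x1(1,2)] by linarith
  qed
  obtain X where X: "X \<in> sym_mats" "\<And>h. h \<bullet> (X *v h) = h \<bullet> T h"
    using linear_quadratic_form_matrix[OF T] by metis
  define \<mu> where "\<mu> = mu (W y)"
  define \<kappa> where "\<kappa> = 1 + \<mu>"
  define \<theta> where "\<theta> = \<nu> / \<mu>"
  \<comment> \<open>Gradient bookkeeping: \<open>b\<close> has slope \<open>p0 - p\<close> at
    \<open>y\<close>, and \<open>b\<close> is \<open>- f (W y)\<close> plus the quadratic, so a test
    function for \<open>w\<close> has slope \<open>q\<close> with
    \<open>\<kappa> *\<^sub>R q = p - e\<close>.\<close>
  define e where "e = p0 - (2 * \<nu>) *\<^sub>R y"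
  define q where "q = (1 / \<kappa>) *\<^sub>R (p - e)"
  have \<mu>: "0 < \<mu>" "\<mu> \<le> 1" "\<mu>0 \<le> \<mu>"
    using mu_pos mu_le[OF Wy] \<beta>(2) \<mu>0(2)[of "W y"] WyR by (auto simp: \<mu>_def)
  have \<kappa>: "1 < \<kappa>" "\<kappa> \<le> 2" using \<mu> by (auto simp: \<kappa>_def)
  have pq: "p = (1 + \<mu>) *\<^sub>R q + e" using \<kappa> by (simp add: q_def \<kappa>_def[symmetric])
  have \<mu>\<theta>: "\<mu> * \<theta> = \<nu>" using \<mu> by (simp add: \<theta>_def)
  have \<theta>: "\<theta> \<in> {0..\<theta>0}"
  proof -
    have "\<nu> \<le> \<theta>0 * \<mu>" using \<nu>R(3) mult_left_mono[OF \<mu>(3), of \<theta>0] \<theta>0 by linarith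
    then show ?thesis using \<mu> \<nu> by (simp add: \<theta>_def pos_divide_le_eq)
  qed
  have ne: "norm e \<le> 3 * R1 * \<nu>"
  proof -
    have "norm e \<le> norm p0 + norm ((2 * \<nu>) *\<^sub>R y)" unfolding e_def by (rule norm_triangle_ineq4)
    also have "norm ((2 * \<nu>) *\<^sub>R y) \<le> 2 * \<nu> * R1" using \<nu> R1(2)[OF yK] by simp
    also have "norm p0 \<le> \<nu> * R1"
    proof -
      have "\<nu> * 1 \<le> \<nu> * R1" using \<nu> R1 by (intro mult_left_mono) auto
      then show ?thesis using xy(1) \<rho>(4) \<nu>(1) by linarith
    qed
    finally show ?thesis by simp
  qed
  have ne2: "2 * C * (norm e)\<^sup>2 + norm e powr m / C \<le> \<nu> / 2"
  proof -
    have "(norm e)\<^sup>2 \<le> (3 * R1 * \<nu>)\<^sup>2" using ne by (intro power_mono) auto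
    then have "2 * C * (norm e)\<^sup>2 \<le> 2 * C * (3 * R1 * \<nu>)\<^sup>2" using C by (intro mult_left_mono) auto
    moreover have "norm e powr m / C \<le> (3 * R1 * \<nu>) powr m / C"
      using ne m C by (intro divide_right_mono powr_mono2) auto
    ultimately show ?thesis using \<nu>(3) by linarith
  qed
  have gap: "\<xi> \<bullet> (L x (V x) p *v \<xi>) \<le> (1 + \<mu>) * (\<xi> \<bullet> (L y (W y) q *v \<xi>)) + 8 * C * \<mu> * (q \<bullet> \<xi>)\<^sup>2 + 3 / 2 * \<nu> * (norm \<xi>)\<^sup>2" for \<xi>
  proof (rule strict_gap[OF ll open_ball convex_ball \<delta>(2) xyb _ Vx(2) WyR(2) VW C _ \<rho>(1) Lx Ls Lp[OF xy\<Omega>(2) \<theta> WyR(2)]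
        \<mu>(1,2) \<mu>\<theta> _ _ ne2 _ pq])
    show "norm (x - y) \<le> 2 * \<rho>"
      using norm_triangle_ineq4[of "x - x1" "y - x1"] xy(4,5) by simp
    show "m > 0" using m by simp
    show "\<nu> \<ge> 0" using \<nu> by simp
    show "norm e \<le> \<nu> * \<Lambda>" using ne by (simp add: \<Lambda>_def mult_ac)
    have "6 * C * \<rho> \<le> 6 * C * (\<mu>0 / (4 powr m * C) / (6 * C))" using \<rho>(5) C by (intro mult_left_mono) auto
    also have "\<dots> = \<mu>0 / (4 powr m * C)" using C by simp
    also have "\<dots> \<le> \<mu> / (4 powr m * C)" using \<mu>(3) C by (intro divide_right_mono) auto
    finally show "6 * C * \<rho> \<le> \<mu> / (4 powr m * C)" .
  qed
  define Xv where "Xv = X + (2 * \<rho>) *\<^sub>R mat 1"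
  have Xv: "Xv \<in> sym_mats" "\<And>h. h \<bullet> (Xv *v h) = h \<bullet> (X *v h) + 2 * \<rho> * (norm h)\<^sup>2"
    unfolding Xv_def
    by (intro sym_mats_add sym_mats_scaleR sym_mats_mat_1 X)
      (simp add: matrix_vector_mult_add_rdistrib inner_add_right quadratic_form_mat_1)
  have Av: "Xv + L x (V x) p \<in> closure U"
  proof -
    obtain r1 where r1: "r1 > 0" "\<And>h. norm h < r1 \<Longrightarrow> \<bar>p \<bullet> h + (h \<bullet> (Xv *v h)) / 2\<bar> < V x + R"
      using quadratic_small_near_0[of "V x + R" p Xv] Vx by auto
    obtain r2 where r2: "r2 > 0" "ball x r2 \<subseteq> \<Omega>" using op xy\<Omega>(1) by (meson openE)
    show ?thesis
    proof (rule subsolution_jet[OF sub xy\<Omega>(1) V(1)[OF xy(2)] Xv(1), of "min r (min r1 r2)"])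
      show "0 < min r (min r1 r2)" using r r1 r2 by simp
      fix h :: "real ^ 'n" assume h: "norm h < min r (min r1 r2)"
      have xh: "x + h \<in> K" using r2 h \<Omega>K by (auto simp: dist_norm subset_iff)
      show "v (x + h) \<le> ereal (V x + p \<bullet> h + (h \<bullet> (Xv *v h)) / 2)"
      proof (cases "x + h \<in> D1")
        case True
        then show ?thesis using jv[of h] h V(1)[OF True] by (simp add: Xv(2) X(2) add_divide_distrib)
      next
        \<comment> \<open>Here \<open>v\<close> is below \<open>- R\<close>, while the test function
          stays above \<open>- R\<close> because its value at \<open>x\<close> does so
          strictly.\<close>
        case False
        then have "v (x + h) \<le> ereal (- R)" using xh by (simp add: D1_def)
        also have "- R \<le> V x + p \<bullet> h + (h \<bullet> (Xv *v h)) / 2" using r1(2)[of h] h by (simp add: abs_less_iff)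
        finally show ?thesis by simp
      qed
    qed
  qed
  \<comment> \<open>Solved so that \<open>f\<close> composed with the quadratic of Hessian
    \<open>Z\<close> expands to the lower bound known for \<open>f (W (y + h))\<close>: the tensor
    cancels the second derivative of \<open>f\<close>, and the last term pays for the Taylor
    remainder \<open>\<kappa> * \<rho>\<close>.\<close>
  define Z where "Z = (1 / \<kappa>) *\<^sub>R (X + (2 * (\<nu> - \<rho>)) *\<^sub>R mat 1 + (8 * C * \<mu>) *\<^sub>R (q \<otimes> q)) - (2 * \<rho>) *\<^sub>R mat 1"
  have Zsym: "Z \<in> sym_mats"
    unfolding Z_def by (intro sym_mats_diff sym_mats_add sym_mats_scaleR sym_mats_mat_1 sym_mats_tensor X)
  have Z: "\<kappa> * (h \<bullet> (Z *v h)) = h \<bullet> (X *v h) + 2 * (\<nu> - \<rho>) * (norm h)\<^sup>2 + 8 * C * \<mu> * (q \<bullet> h)\<^sup>2 - 2 * \<kappa> * \<rho> * (norm h)\<^sup>2" for h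
  proof -
    have "h \<bullet> (Z *v h) = (1 / \<kappa>) * (h \<bullet> (X *v h) + 2 * (\<nu> - \<rho>) * (norm h)\<^sup>2 + 8 * C * \<mu> * (q \<bullet> h)\<^sup>2) - 2 * \<rho> * (norm h)\<^sup>2"
      unfolding Z_def matrix_vector_mult_diff_rdistrib inner_diff_right quadratic_form_mat_1
        scaleR_matrix_vector_assoc[symmetric, of "1 / \<kappa>"] scaleR_matrix_vector_assoc[symmetric, of "8 * C * \<mu>"]
        matrix_vector_mult_add_rdistrib inner_add_right inner_scaleR_right quadratic_form_tensor ..
    then show ?thesis using \<kappa> by (simp add: right_diff_distrib)
  qed
  have Aw: "Z + L y (W y) q \<in> sym_mats - U"
  proof -
    obtain r1 where r1: "r1 > 0" "\<And>h. norm h < r1 \<Longrightarrow> \<bar>q \<bullet> h + (h \<bullet> (Z *v h)) / 2\<bar> < R - W y"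
      using quadratic_small_near_0[of "R - W y" q Z] WyR by auto
    obtain r2 where r2: "r2 > 0" "ball y r2 \<subseteq> \<Omega>" using op xy\<Omega>(2) by (meson openE)
    have "((\<lambda>s. 1 + mu s) has_real_derivative (- 8 * C * \<mu>)) (at (W y))"
      using dmu[of "W y"] by (auto intro!: derivative_eq_intros simp: \<mu>_def)
    from composed_quadratic_expansion[OF df this Zsym, of "\<kappa> * \<rho>"]
    obtain r3 where r3: "r3 > 0" "\<And>h. norm h < r3 \<Longrightarrow> f (W y + q \<bullet> h + (h \<bullet> (Z *v h)) / 2)
       \<le> f (W y) + \<kappa> * (q \<bullet> h) + (- 8 * C * \<mu> * (q \<bullet> h)\<^sup>2 + \<kappa> * (h \<bullet> (Z *v h))) / 2 + \<kappa> * \<rho> * (norm h)\<^sup>2"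
      using \<kappa> \<rho>(1) by (auto simp: \<kappa>_def \<mu>_def)
    show ?thesis
    proof (rule supersolution_jet[OF super xy\<Omega>(2) W(1)[OF xy(3)] Zsym, of "min r (min r1 (min r2 r3))"])
      show "0 < min r (min r1 (min r2 r3))" using r r1 r2 r3 by simp
      fix h :: "real ^ 'n" assume h: "norm h < min r (min r1 (min r2 r3))"
      have yh: "y + h \<in> K" using r2 h \<Omega>K by (auto simp: dist_norm subset_iff)
      show "ereal (W y + q \<bullet> h + (h \<bullet> (Z *v h)) / 2) \<le> w (y + h)"
      proof (cases "y + h \<in> D2")
        case True
        have "f (W y + q \<bullet> h + (h \<bullet> (Z *v h)) / 2)
           \<le> f (W y) + \<kappa> * (q \<bullet> h) + (h \<bullet> (X *v h)) / 2 + (\<nu> - \<rho>) * (norm h)\<^sup>2"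
        proof -
          have "f (W y + q \<bullet> h + (h \<bullet> (Z *v h)) / 2)
            \<le> f (W y) + \<kappa> * (q \<bullet> h) + (- 8 * C * \<mu> * (q \<bullet> h)\<^sup>2 + \<kappa> * (h \<bullet> (Z *v h))) / 2 + \<kappa> * \<rho> * (norm h)\<^sup>2"
            by (intro r3) (use h in auto)
          also have "\<dots> = f (W y) + \<kappa> * (q \<bullet> h) + (h \<bullet> (X *v h)) / 2 + (\<nu> - \<rho>) * (norm h)\<^sup>2"
            unfolding Z by (simp add: add_divide_distrib diff_divide_distrib)
          finally show ?thesis .
        qed
        also have "\<kappa> * (q \<bullet> h) = (p - p0) \<bullet> h + 2 * \<nu> * (y \<bullet> h)"
          using \<kappa> by (simp add: q_def e_def inner_diff_left)
        also have "f (W y) + ((p - p0) \<bullet> h + 2 * \<nu> * (y \<bullet> h)) + (h \<bullet> (X *v h)) / 2 + (\<nu> - \<rho>) * (norm h)\<^sup>2 \<le> f (W (y + h))"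
        proof -
          have "b (y + h) \<le> b y + (p0 - p) \<bullet> h - (h \<bullet> T h) / 2 + \<rho> * (norm h)\<^sup>2"
            by (intro jw) (use h True in auto)
          moreover have "2 * \<nu> * (y \<bullet> h) = \<nu> * (2 * (y \<bullet> h))" by simp
          ultimately show ?thesis
            unfolding b_def norm_add_sq X(2) inner_diff_left distrib_left left_diff_distrib by linarith
        qed
        finally have "W y + q \<bullet> h + (h \<bullet> (Z *v h)) / 2 \<le> W (y + h)"
          using f_mono by (meson linorder_not_less)
        then show ?thesis using W(1)[OF True] by simp
      next
        case False
        have "W y + q \<bullet> h + (h \<bullet> (Z *v h)) / 2 \<le> R" using r1(2)[of h] h by (simp add: abs_less_iff)
        then have "ereal (W y + q \<bullet> h + (h \<bullet> (Z *v h)) / 2) \<le> ereal R" by simp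
        also have "\<dots> \<le> w (y + h)" using False yh by (simp add: D2_def)
        finally show ?thesis .
      qed
    qed
  qed
  \<comment> \<open>Multiplied by \<open>\<kappa>\<close>, the matrix of the supersolution exceeds
    that of the subsolution by \<open>\<nu> / 4\<close>; scaling back by
    \<open>1 / \<kappa> < 1\<close> stays in \<open>U\<close> and contradicts
    \<open>Aw\<close>.\<close>
  have "\<kappa> *\<^sub>R (Z + L y (W y) q) \<in> U"
  proof (rule in_U_if_above_closure[OF _ Uup Av, of _ "\<nu> / 4"])
    show "U \<subseteq> sym_mats" using Uopen openin_imp_subset by blast
    show "\<kappa> *\<^sub>R (Z + L y (W y) q) \<in> sym_mats" using Aw by (intro sym_mats_scaleR) auto
    show "0 < \<nu> / 4" using \<nu> by simp
    fix \<xi> :: "real ^ 'n"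
    have "\<xi> \<bullet> ((\<kappa> *\<^sub>R (Z + L y (W y) q) - (Xv + L x (V x) p)) *v \<xi>)
        = \<kappa> * (\<xi> \<bullet> (Z *v \<xi>)) + \<kappa> * (\<xi> \<bullet> (L y (W y) q *v \<xi>)) - \<xi> \<bullet> (Xv *v \<xi>) - \<xi> \<bullet> (L x (V x) p *v \<xi>)"
      by (simp add: matrix_vector_mult_diff_rdistrib matrix_vector_mult_add_rdistrib
        scaleR_matrix_vector_assoc[symmetric] inner_diff_right inner_add_right distrib_left)
    also have "\<dots> \<ge> 2 * (\<nu> - \<rho>) * (norm \<xi>)\<^sup>2 - 2 * \<kappa> * \<rho> * (norm \<xi>)\<^sup>2 - 2 * \<rho> * (norm \<xi>)\<^sup>2 - 3 / 2 * \<nu> * (norm \<xi>)\<^sup>2"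
      using gap[of \<xi>, folded \<kappa>_def] Z[of \<xi>] Xv(2)[of \<xi>] by linarith
    moreover have "2 * (\<nu> - \<rho>) * (norm \<xi>)\<^sup>2 - 2 * \<kappa> * \<rho> * (norm \<xi>)\<^sup>2 - 2 * \<rho> * (norm \<xi>)\<^sup>2 - 3 / 2 * \<nu> * (norm \<xi>)\<^sup>2
        = (2 * (\<nu> - \<rho>) - 2 * \<kappa> * \<rho> - 2 * \<rho> - 3 / 2 * \<nu>) * (norm \<xi>)\<^sup>2"
      by (simp add: algebra_simps)
    moreover have "\<nu> / 4 * (norm \<xi>)\<^sup>2 \<le> (2 * (\<nu> - \<rho>) - 2 * \<kappa> * \<rho> - 2 * \<rho> - 3 / 2 * \<nu>) * (norm \<xi>)\<^sup>2"
    proof (intro mult_right_mono)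
      have "2 * \<kappa> * \<rho> \<le> 4 * \<rho>" using \<kappa> \<rho> by (intro mult_right_mono) auto
      moreover have "2 * (\<nu> - \<rho>) - 2 * \<kappa> * \<rho> - 2 * \<rho> - 3 / 2 * \<nu> = \<nu> / 2 - 4 * \<rho> - 2 * \<kappa> * \<rho>"
        by simp
      ultimately show "\<nu> / 4 \<le> 2 * (\<nu> - \<rho>) - 2 * \<kappa> * \<rho> - 2 * \<rho> - 3 / 2 * \<nu>" using \<rho>(4) by linarith
    qed simp
    ultimately show "\<nu> / 4 * (norm \<xi>)\<^sup>2 \<le> \<xi> \<bullet> ((\<kappa> *\<^sub>R (Z + L y (W y) q) - (Xv + L x (V x) p)) *v \<xi>)"
      by linarith
  qed
  then have "(1 / \<kappa>) *\<^sub>R (\<kappa> *\<^sub>R (Z + L y (W y) q)) \<in> U"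
    by (rule Uscale) (use \<kappa> in auto)
  then show False using Aw \<kappa> by simp
qed

end
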